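(* For each of the following pairs of $2$-generated groups $(G,H)$, the group $H$ is a homomorphic image of $G$, but there exist generating pairs $(h_1,h_2)$ of $H$ such that for all homomorphisms $\vartheta \colon G \to H$ and all generating pairs $(g_1,g_2)$ of $G$ we have $(g_1^{\,\vartheta}, g_2^{\,\vartheta}) \ne (h_1,h_2)$: (i) $G = C_2 \ast C_3$ and $H = \mathrm{PSL}(2,q)$, where $q$ is a prime power such that $q \ge 4$, but $q \ne 9$; (ii) $G = C_2 \ast C_p$ and $H = \mathrm{PSL}(2,q)$, where $q = p^k$ is a power of a prime $p \ge 3$ such that $q \ge 7$, but $q \ne 9$; (iii) $G = C_2 \ast C_m$ and $H = \mathrm{PSL}(2,q)$, where $m \in \mathbb{N}$ and $q = p^k$ is a power of a prime $p$ such that $q \equiv 3 \pmod 4$, but $q \ne 3$, and at least one of the following holds: $p \mid m$, or $\gcd(m,(q+1)/2) \ge 3$, or $\gcd(m,(q-1)/2) \ge 3$; (iv) $G = C_3 \ast C_3$ and $H = \mathrm{PSL}(2,q)$, where $q$ is a prime power such that $q \ge 5$.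
   Context: $C_n$ denotes the cyclic group of order $n$, $\ast$ denotes the free product of groups, and $\mathbb{N}$ is the set of positive integers. $\mathrm{PSL}(2,q) = \mathrm{SL}(2,\mathbb{F}_q)/\{\pm I\}$. A generating pair of a group $K$ is an ordered pair $(k_1,k_2) \in K \times K$ with $\langle k_1,k_2\rangle = K$. Homomorphisms are written on the right: $g^{\vartheta}$ is the image of $g$ under $\vartheta$. *)

theory Defs
  imports
    "HOL-Algebra.Elementary_Groups"
    "HOL-Analysis.Determinants"
    "HOL-Number_Theory.Prime_Powers"
begin

text \<open>
  The free product of two groups is the monoid of words in the disjoint union of their carriers
  modulo the least congruence that multiplies adjacent letters of the same factor and deletes
  the two neutral letters.
\<close>

definition fp_words ::
  "('a, 'm) monoid_scheme \<Rightarrow> ('b, 'n) monoid_scheme \<Rightarrow> ('a + 'b) list set" where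
  "fp_words A B = lists (carrier A <+> carrier B)"

inductive_set fp_rel ::
  "('a, 'm) monoid_scheme \<Rightarrow> ('b, 'n) monoid_scheme \<Rightarrow> (('a + 'b) list \<times> ('a + 'b) list) set"
  for A B where
  refl: "u \<in> fp_words A B \<Longrightarrow> (u, u) \<in> fp_rel A B"
| sym: "(u, v) \<in> fp_rel A B \<Longrightarrow> (v, u) \<in> fp_rel A B"
| trans: "(u, v) \<in> fp_rel A B \<Longrightarrow> (v, w) \<in> fp_rel A B \<Longrightarrow> (u, w) \<in> fp_rel A B"
| append: "(u, u') \<in> fp_rel A B \<Longrightarrow> (v, v') \<in> fp_rel A B \<Longrightarrow> (u @ v, u' @ v') \<in> fp_rel A B"
| one_left: "([Inl \<one>\<^bsub>A\<^esub>], []) \<in> fp_rel A B"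
| one_right: "([Inr \<one>\<^bsub>B\<^esub>], []) \<in> fp_rel A B"
| mult_left: "a \<in> carrier A \<Longrightarrow> a' \<in> carrier A \<Longrightarrow>
    ([Inl a, Inl a'], [Inl (a \<otimes>\<^bsub>A\<^esub> a')]) \<in> fp_rel A B"
| mult_right: "b \<in> carrier B \<Longrightarrow> b' \<in> carrier B \<Longrightarrow>
    ([Inr b, Inr b'], [Inr (b \<otimes>\<^bsub>B\<^esub> b')]) \<in> fp_rel A B"

definition free_product ::
  "('a, 'm) monoid_scheme \<Rightarrow> ('b, 'n) monoid_scheme \<Rightarrow> ('a + 'b) list set monoid" where
  "free_product A B =
    \<lparr>carrier = fp_words A B // fp_rel A B,
     monoid.mult = (\<lambda>X Y. \<Union>u\<in>X. \<Union>v\<in>Y. fp_rel A B `` {u @ v}),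
     one = fp_rel A B `` {[]}\<rparr>"

definition fp_inl :: "('a, 'm) monoid_scheme \<Rightarrow> ('b, 'n) monoid_scheme \<Rightarrow> 'a \<Rightarrow> ('a + 'b) list set" where
  "fp_inl A B a = fp_rel A B `` {[Inl a]}"

definition fp_inr :: "('a, 'm) monoid_scheme \<Rightarrow> ('b, 'n) monoid_scheme \<Rightarrow> 'b \<Rightarrow> ('a + 'b) list set" where
  "fp_inr A B b = fp_rel A B `` {[Inr b]}"

lemma fp_words_simps [simp]:
  "[] \<in> fp_words A B"
  "Inl a # w \<in> fp_words A B \<longleftrightarrow> a \<in> carrier A \<and> w \<in> fp_words A B"
  "Inr b # w \<in> fp_words A B \<longleftrightarrow> b \<in> carrier B \<and> w \<in> fp_words A B"
  "u @ w \<in> fp_words A B \<longleftrightarrow> u \<in> fp_words A B \<and> w \<in> fp_words A B"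
  by (auto simp: fp_words_def)

context
  fixes A :: "('a, 'm) monoid_scheme" and B :: "('b, 'n) monoid_scheme"
  assumes A: "group A" and B: "group B"
begin

interpretation A: group A by (rule A)
interpretation B: group B by (rule B)

lemma fp_rel_words: "(u, v) \<in> fp_rel A B \<Longrightarrow> u \<in> fp_words A B \<and> v \<in> fp_words A B"
  by (induction rule: fp_rel.induct) auto

lemma equiv_fp_rel: "equiv (fp_words A B) (fp_rel A B)"
proof (rule equivI)
  show "fp_rel A B \<subseteq> fp_words A B \<times> fp_words A B"
    using fp_rel_words by auto
  show "refl_on (fp_words A B) (fp_rel A B)"
    by (auto simp: refl_on_def intro: fp_rel.refl)
qed (auto intro!: symI transI intro: fp_rel.sym fp_rel.trans)

lemma fp_class_eq_iff:
  "u \<in> fp_words A B \<Longrightarrow> v \<in> fp_words A B \<Longrightarrow>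
    fp_rel A B `` {u} = fp_rel A B `` {v} \<longleftrightarrow> (u, v) \<in> fp_rel A B"
  using eq_equiv_class_iff[OF equiv_fp_rel] by blast

lemma fp_mult_class:
  assumes "u \<in> fp_words A B" "v \<in> fp_words A B"
  shows "fp_rel A B `` {u} \<otimes>\<^bsub>free_product A B\<^esub> fp_rel A B `` {v} = fp_rel A B `` {u @ v}"
proof -
  have *: "fp_rel A B `` {u' @ v'} = fp_rel A B `` {u @ v}"
    if "(u, u') \<in> fp_rel A B" "(v, v') \<in> fp_rel A B" for u' v'
    using equiv_class_eq[OF equiv_fp_rel fp_rel.append[OF that]] by simp
  have "u \<in> fp_rel A B `` {u}" "v \<in> fp_rel A B `` {v}"
    using assms by (auto intro: fp_rel.refl)
  with * show ?thesis
    unfolding free_product_def by (auto simp del: Image_singleton_iff)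
qed

lemma fp_inv_ex:
  "u \<in> fp_words A B \<Longrightarrow> \<exists>v\<in>fp_words A B. (v @ u, []) \<in> fp_rel A B"
proof (induction u)
  case Nil
  then show ?case by (auto intro!: bexI[of _ "[]"] fp_rel.refl)
next
  case (Cons x u)
  then have "u \<in> fp_words A B" by (cases x) auto
  with Cons obtain v where v: "v \<in> fp_words A B" "(v @ u, []) \<in> fp_rel A B" by auto
  obtain y where y: "[y] \<in> fp_words A B" "([y, x], []) \<in> fp_rel A B"
  proof (cases x)
    case (Inl a)
    with Cons.prems have a: "a \<in> carrier A" by simp
    from fp_rel.mult_left[OF A.inv_closed[OF a] a, of B]
    have "([Inl (inv\<^bsub>A\<^esub> a), x], []) \<in> fp_rel A B"
      using a Inl by (auto intro: fp_rel.trans[OF _ fp_rel.one_left])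
    with that[of "Inl (inv\<^bsub>A\<^esub> a)"] a show ?thesis by simp
  next
    case (Inr b)
    with Cons.prems have b: "b \<in> carrier B" by simp
    from fp_rel.mult_right[OF B.inv_closed[OF b] b, of A]
    have "([Inr (inv\<^bsub>B\<^esub> b), x], []) \<in> fp_rel A B"
      using b Inr by (auto intro: fp_rel.trans[OF _ fp_rel.one_right])
    with that[of "Inr (inv\<^bsub>B\<^esub> b)"] b show ?thesis by simp
  qed
  have "(v @ ([y, x] @ u), v @ ([] @ u)) \<in> fp_rel A B"
    using v \<open>u \<in> _\<close> y by (intro fp_rel.append fp_rel.refl) auto
  then have "((v @ [y]) @ (x # u), []) \<in> fp_rel A B"
    using v(2) by (auto intro: fp_rel.trans)
  with v y show ?case by (intro bexI[of _ "v @ [y]"]) auto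
qed

lemma group_free_product: "group (free_product A B)"
proof (rule groupI)
  have one: "\<one>\<^bsub>free_product A B\<^esub> = fp_rel A B `` {[]}"
    and carrier: "carrier (free_product A B) = fp_words A B // fp_rel A B"
    by (simp_all add: free_product_def)
  show "\<one>\<^bsub>free_product A B\<^esub> \<in> carrier (free_product A B)"
    by (simp add: one carrier quotientI)
  fix X assume "X \<in> carrier (free_product A B)"
  then obtain u where u: "u \<in> fp_words A B" "X = fp_rel A B `` {u}"
    by (auto simp: carrier elim: quotientE)
  show "\<one>\<^bsub>free_product A B\<^esub> \<otimes>\<^bsub>free_product A B\<^esub> X = X"
    using u by (simp add: one fp_mult_class)
  obtain v where v: "v \<in> fp_words A B" "(v @ u, []) \<in> fp_rel A B"
    using fp_inv_ex u by auto
  then show "\<exists>Y\<in>carrier (free_product A B). Y \<otimes>\<^bsub>free_product A B\<^esub> X = \<one>\<^bsub>free_product A B\<^esub>"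
    using u by (intro bexI[of _ "fp_rel A B `` {v}"])
      (auto simp: one carrier fp_mult_class fp_class_eq_iff quotientI)
  fix Y assume "Y \<in> carrier (free_product A B)"
  then obtain v where v: "v \<in> fp_words A B" "Y = fp_rel A B `` {v}"
    by (auto simp: carrier elim: quotientE)
  show "X \<otimes>\<^bsub>free_product A B\<^esub> Y \<in> carrier (free_product A B)"
    using u v by (simp add: carrier fp_mult_class quotientI)
  fix Z assume "Z \<in> carrier (free_product A B)"
  then obtain w where w: "w \<in> fp_words A B" "Z = fp_rel A B `` {w}"
    by (auto simp: carrier elim: quotientE)
  show "X \<otimes>\<^bsub>free_product A B\<^esub> Y \<otimes>\<^bsub>free_product A B\<^esub> Z =
      X \<otimes>\<^bsub>free_product A B\<^esub> (Y \<otimes>\<^bsub>free_product A B\<^esub> Z)"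
    using u v w by (simp add: fp_mult_class)
qed

lemma fp_inl_hom: "fp_inl A B \<in> hom A (free_product A B)"
proof (rule homI)
  fix x y assume xy: "x \<in> carrier A" "y \<in> carrier A"
  show "fp_inl A B x \<in> carrier (free_product A B)"
    using xy by (simp add: fp_inl_def free_product_def quotientI)
  show "fp_inl A B (x \<otimes>\<^bsub>A\<^esub> y) = fp_inl A B x \<otimes>\<^bsub>free_product A B\<^esub> fp_inl A B y"
    using xy fp_rel.sym[OF fp_rel.mult_left[OF xy]]
    by (simp add: fp_inl_def fp_mult_class fp_class_eq_iff)
qed

lemma fp_inr_hom: "fp_inr A B \<in> hom B (free_product A B)"
proof (rule homI)
  fix x y assume xy: "x \<in> carrier B" "y \<in> carrier B"
  show "fp_inr A B x \<in> carrier (free_product A B)"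
    using xy by (simp add: fp_inr_def free_product_def quotientI)
  show "fp_inr A B (x \<otimes>\<^bsub>B\<^esub> y) = fp_inr A B x \<otimes>\<^bsub>free_product A B\<^esub> fp_inr A B y"
    using xy fp_rel.sym[OF fp_rel.mult_right[OF xy]]
    by (simp add: fp_inr_def fp_mult_class fp_class_eq_iff)
qed

text \<open>The universal property of the coproduct.\<close>

lemma free_product_lift:
  fixes K :: "('k, 'l) monoid_scheme"
  assumes K: "group K" and f: "f \<in> hom A K" and g: "g \<in> hom B K"
  shows "\<exists>h\<in>hom (free_product A B) K.
    (\<forall>a\<in>carrier A. h (fp_inl A B a) = f a) \<and> (\<forall>b\<in>carrier B. h (fp_inr A B b) = g b)"
proof -
  interpret K: group K by (rule K)
  have fc: "f a \<in> carrier K" if "a \<in> carrier A" for a using f that by (rule hom_in_carrier)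
  have gc: "g b \<in> carrier K" if "b \<in> carrier B" for b using g that by (rule hom_in_carrier)
  define val where "val w = foldr (\<lambda>x k. case_sum f g x \<otimes>\<^bsub>K\<^esub> k) w \<one>\<^bsub>K\<^esub>" for w
  have val_simps: "val [] = \<one>\<^bsub>K\<^esub>" "val (x # w) = case_sum f g x \<otimes>\<^bsub>K\<^esub> val w" for x w
    by (simp_all add: val_def)
  have val_closed: "val w \<in> carrier K" if "w \<in> fp_words A B" for w
    using that
  proof (induction w)
    case (Cons x w)
    then show ?case by (cases x) (auto simp: val_simps fc gc)
  qed (simp add: val_simps)
  have val_append: "val (u @ w) = val u \<otimes>\<^bsub>K\<^esub> val w"
    if "u \<in> fp_words A B" "w \<in> fp_words A B" for u w
    using that
  proof (induction u)
    case (Cons x u)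
    then show ?case by (cases x) (auto simp: val_simps fc gc val_closed K.m_assoc)
  qed (simp add: val_simps val_closed)
  have val_rel: "val u = val v" if "(u, v) \<in> fp_rel A B" for u v
    using that
  proof (induction rule: fp_rel.induct)
    case (append u u' v v')
    then show ?case using fp_rel_words by (simp add: val_append)
  qed (auto simp: val_simps fc gc hom_mult[OF f] hom_mult[OF g]
        hom_one[OF f A K] hom_one[OF g B K])
  define h where "h X = val (SOME u. u \<in> X)" for X
  have h: "h (fp_rel A B `` {u}) = val u" if "u \<in> fp_words A B" for u
  proof -
    have "u \<in> fp_rel A B `` {u}" using that by (auto intro: fp_rel.refl)
    then have "(SOME v. v \<in> fp_rel A B `` {u}) \<in> fp_rel A B `` {u}" by (rule someI)
    then show ?thesis using val_rel by (auto simp: h_def)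
  qed
  have "h \<in> hom (free_product A B) K"
  proof (rule homI)
    fix X assume "X \<in> carrier (free_product A B)"
    then obtain u where u: "u \<in> fp_words A B" "X = fp_rel A B `` {u}"
      by (auto simp: free_product_def elim: quotientE)
    show "h X \<in> carrier K" using u by (simp add: h val_closed)
    fix Y assume "Y \<in> carrier (free_product A B)"
    then obtain v where v: "v \<in> fp_words A B" "Y = fp_rel A B `` {v}"
      by (auto simp: free_product_def elim: quotientE)
    show "h (X \<otimes>\<^bsub>free_product A B\<^esub> Y) = h X \<otimes>\<^bsub>K\<^esub> h Y"
      using u v by (simp add: h fp_mult_class val_append)
  qed
  then show ?thesis
    by (intro bexI[of _ h]) (auto simp: fp_inl_def fp_inr_def h val_simps fc gc)
qed

lemma free_product_hom_eq:
  fixes K :: "('k, 'l) monoid_scheme"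
  assumes K: "group K"
    and h: "h \<in> hom (free_product A B) K" and h': "h' \<in> hom (free_product A B) K"
    and inl: "\<And>a. a \<in> carrier A \<Longrightarrow> h (fp_inl A B a) = h' (fp_inl A B a)"
    and inr: "\<And>b. b \<in> carrier B \<Longrightarrow> h (fp_inr A B b) = h' (fp_inr A B b)"
    and X: "X \<in> carrier (free_product A B)"
  shows "h X = h' X"
proof -
  have "h (fp_rel A B `` {u}) = h' (fp_rel A B `` {u})" if "u \<in> fp_words A B" for u
    using that
  proof (induction u)
    case Nil
    have "fp_rel A B `` {[]} = \<one>\<^bsub>free_product A B\<^esub>" by (simp add: free_product_def)
    then show ?case
      using hom_one[OF h group_free_product K] hom_one[OF h' group_free_product K] by simp
  next
    case (Cons x u)
    then have u: "u \<in> fp_words A B" and x: "[x] \<in> fp_words A B" by (cases x; simp)+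
    have cl: "fp_rel A B `` {w} \<in> carrier (free_product A B)" if "w \<in> fp_words A B" for w
      using that by (simp add: free_product_def quotientI)
    have "h (fp_rel A B `` {[x]}) = h' (fp_rel A B `` {[x]})"
      using x inl inr by (cases x) (auto simp: fp_inl_def fp_inr_def)
    moreover have "fp_rel A B `` {x # u} =
        fp_rel A B `` {[x]} \<otimes>\<^bsub>free_product A B\<^esub> fp_rel A B `` {u}"
      using u x by (simp add: fp_mult_class)
    ultimately show ?case
      using Cons.IH[OF u] by (simp add: hom_mult[OF h cl cl] hom_mult[OF h' cl cl] u x)
  qed
  with X show ?thesis by (auto simp: free_product_def elim: quotientE)
qed

end

definition SL2 :: "'f::field itself \<Rightarrow> ('f^2^2) monoid" where
  "SL2 _ = \<lparr>carrier = {M. det M = 1}, monoid.mult = (**), one = mat 1\<rparr>"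

definition PSL2 :: "'f::field itself \<Rightarrow> ('f^2^2) set monoid" where
  "PSL2 F = SL2 F Mod {mat 1, - mat 1}"

lemma group_SL2: "group (SL2 F)"
proof (rule groupI)
  fix M assume M: "M \<in> carrier (SL2 F)"
  then have "invertible M" by (simp add: SL2_def invertible_det_nz)
  then obtain N where N: "N ** M = mat 1" by (auto simp: invertible_def)
  then have "det N * det M = 1" by (metis det_mul det_I)
  with M N show "\<exists>N\<in>carrier (SL2 F). N \<otimes>\<^bsub>SL2 F\<^esub> M = \<one>\<^bsub>SL2 F\<^esub>"
    by (auto simp: SL2_def)
qed (auto simp: SL2_def det_mul matrix_mul_assoc)

lemma pm_one_normal_SL2: "{mat 1, - mat 1} \<lhd> SL2 F"
proof -
  interpret group "SL2 F" by (rule group_SL2)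
  have neg: "(- mat 1 :: 'a^2^2) ** M = - M" "M ** (- mat 1 :: 'a^2^2) = - M" for M :: "'a^2^2"
    by (simp_all add: vec_eq_iff matrix_matrix_mult_def mat_def forall_2 sum_2)
  have mem: "mat 1 \<in> carrier (SL2 F)" "- mat 1 \<in> carrier (SL2 F)"
    by (simp_all add: SL2_def det_2 mat_def)
  have inv: "inv\<^bsub>SL2 F\<^esub> (- mat 1) = - mat 1"
    using mem by (intro inv_equality) (auto simp: SL2_def neg)
  have "subgroup {mat 1, - mat 1} (SL2 F)"
  proof (rule subgroupI)
    show "inv\<^bsub>SL2 F\<^esub> M \<in> {mat 1, - mat 1}" if "M \<in> {mat 1, - mat 1}" for M
      using that inv inv_one by (auto simp: SL2_def)
  qed (use mem in \<open>auto simp: SL2_def neg\<close>)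
  then show ?thesis
    by (auto intro!: normalI simp: r_coset_def l_coset_def) (auto simp: SL2_def neg)
qed

lemma group_PSL2: "group (PSL2 F)"
  unfolding PSL2_def by (rule normal.factorgroup_is_group[OF pm_one_normal_SL2])

definition generating_pair :: "('a, 'm) monoid_scheme \<Rightarrow> 'a \<Rightarrow> 'a \<Rightarrow> bool" where
  "generating_pair K k1 k2 \<longleftrightarrow>
    k1 \<in> carrier K \<and> k2 \<in> carrier K \<and> generate K {k1, k2} = carrier K"

definition two_generated :: "('a, 'm) monoid_scheme \<Rightarrow> bool" where
  "two_generated K \<longleftrightarrow> (\<exists>k1 k2. generating_pair K k1 k2)"

text \<open>
  \<open>H\<close> is a homomorphic image of \<open>G\<close>, but some generating pair of \<open>H\<close> is not the image of
  any generating pair of \<open>G\<close> under any homomorphism.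
\<close>

definition image_with_non_lifting_pair ::
  "('a, 'm) monoid_scheme \<Rightarrow> ('b, 'n) monoid_scheme \<Rightarrow> bool" where
  "image_with_non_lifting_pair G H \<longleftrightarrow>
    two_generated G \<and> two_generated H \<and> epi G H \<noteq> {} \<and>
    (\<exists>h1 h2. generating_pair H h1 h2 \<and>
      (\<forall>\<theta>\<in>hom G H. \<forall>g1 g2. generating_pair G g1 g2 \<longrightarrow> (\<theta> g1, \<theta> g2) \<noteq> (h1, h2)))"

abbreviation C :: "nat \<Rightarrow> int monoid" where
  "C \<equiv> integer_mod_group"

end

theory Submission
  imports Defs "HOL-Algebra.Multiplicative_Group" "HOL-Computational_Algebra.Polynomial"
    "HOL-Number_Theory.Cong"
begin

text \<open>
  Let \<open>h\<^sub>1\<close>, \<open>h\<^sub>2\<close> be images, not commuting with each other, of a generating pair of a free product of two cyclic groups under a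
  homomorphism to the projective group over a field, and let \<open>X\<close>, \<open>Y\<close> be matrices for the images of
  the generators of the factors. The commutator of \<open>h\<^sub>1\<close> and \<open>h\<^sub>2\<close> is conjugate to that of suitable
  powers \<open>X\<^sup>i\<close>, \<open>Y\<^sup>j\<close>, as also follows from Grushko's theorem and Nielsen moves. Here the pair \<open>X\<close>,
  \<open>Y\<close> is deformed into a family over a polynomial ring, by conjugating \<open>X\<close> with a transvection whose
  entry is the indeterminate. Two pairs of matrices with the same span of \<open>1\<close>, \<open>A\<close>, \<open>B\<close>, \<open>A B\<close> have
  associated discriminants \<open>det (A B - B A) = 2 - tr [A, B]\<close>; this applies to the given generating
  pair and to the canonical one, so both commutator traces have degree four. On the other hand the
  degree of the trace of a cyclically reduced word counts its syllables. So the commutator of the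
  generating pair is a word of two syllables with exponent sums zero, which is the commutator of two
  powers (\<open>commutator_of_generating_pair\<close>, and \<open>image_with_non_lifting_pairI\<close> for the projective group).

  The Fricke identity then restricts the commutator trace \<open>\<tau>\<close> of a pair that lifts. If the orders are two
  and three, \<open>\<tau> + 1\<close> is a square; if they are two and the odd characteristic, \<open>\<tau> - 2\<close> is a square; if both
  are three, \<open>\<tau>\<close> has the form \<open>c\<^sup>2 - c\<close>; and if one is two and \<open>- 1\<close> is not a square, \<open>\<tau> = - 2\<close> occurs only
  for commuting elements. For orders two and three in characteristic two the first condition is void,
  but \<open>\<tau> = 1\<close> then means that the image is dihedral of order six. In each case some generating pair
  has a commutator trace that is excluded in this way.

  That the pairs in question generate is proved without a classification of the subgroups. Suppose
  that a subgroup contains the diagonal torus and an element \<open>g\<close> without zero entries. The elements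
  \<open>g t g\<close>, with \<open>t\<close> in the torus, move the point at infinity into at most two large orbits of the
  torus, but their products of diagonal entries take many values. By the pigeonhole principle two of
  them differ by a triangular element outside the torus, which leads to a transvection, and then to
  the whole group (\<open>full_if_torus_and_collision\<close>, \<open>full_if_torus_and_generic\<close>). Over small prime fields a
  transvection is available instead, as a generator or as a power of a commutator, and a few
  remaining fields are treated by explicit elements.
\<close>

section \<open>Two by two matrices\<close>

definition mat2 :: "'a \<Rightarrow> 'a \<Rightarrow> 'a \<Rightarrow> 'a \<Rightarrow> 'a^2^2" where
  "mat2 a b c d = (\<chi> i j. if i = 1 then if j = 1 then a else b else if j = 1 then c else d)"

lemma mat2_nth [simp]:
  "mat2 a b c d $ 1 $ 1 = a" "mat2 a b c d $ 1 $ 2 = b"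
  "mat2 a b c d $ 2 $ 1 = c" "mat2 a b c d $ 2 $ 2 = d"
  by (simp_all add: mat2_def)

lemma mat2_eta: "M = mat2 (M $ 1 $ 1) (M $ 1 $ 2) (M $ 2 $ 1) (M $ 2 $ 2)"
  by (simp add: vec_eq_iff forall_2)

lemma mat2_cases: obtains a b c d where "M = mat2 a b c d"
  using mat2_eta by blast

lemma mat2_eq_iff [simp]:
  "mat2 a b c d = mat2 a' b' c' d' \<longleftrightarrow> a = a' \<and> b = b' \<and> c = c' \<and> d = d'"
  by (auto simp: vec_eq_iff forall_2)

lemma mat2_mult [simp]:
  fixes a :: "'a::semiring_1"
  shows "mat2 a b c d ** mat2 a' b' c' d' =
    mat2 (a * a' + b * c') (a * b' + b * d') (c * a' + d * c') (c * b' + d * d')"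
  by (simp add: vec_eq_iff forall_2 matrix_matrix_mult_def sum_2)

lemma mat2_add [simp]:
  "mat2 a b c d + mat2 a' b' c' d' = mat2 (a + a') (b + b') (c + c') (d + d')"
  by (simp add: vec_eq_iff forall_2)

lemma mat2_diff [simp]:
  "mat2 a b c d - mat2 a' b' c' d' = mat2 (a - a') (b - b') (c - c') (d - d')"
  by (simp add: vec_eq_iff forall_2)

lemma mat2_uminus [simp]: "- mat2 a b c d = mat2 (- a) (- b) (- c) (- d)"
  by (simp add: vec_eq_iff forall_2)

lemma zero_mat2: "0 = mat2 0 0 0 (0::'a::zero)"
  by (simp add: vec_eq_iff forall_2)

lemma mat_eq_mat2: "mat k = mat2 k 0 0 k"
  by (simp add: vec_eq_iff forall_2 mat_def)

lemma mat_mult_mat2 [simp]: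
  fixes k :: "'a::comm_ring_1"
  shows "mat k ** mat2 a b c d = mat2 (k * a) (k * b) (k * c) (k * d)"
  by (simp add: mat_eq_mat2)

lemma mat_0_mult [simp]: "mat 0 ** (M :: 'a::comm_ring_1^2^2) = 0"
  by (simp add: vec_eq_iff matrix_matrix_mult_def mat_def)

lemma minus_char_2:
  assumes "(2::'a::comm_ring_1) = 0"
  shows "- x = (x::'a)"
proof -
  have "x + x = 2 * x" by simp
  then have "x + x = 0" using assms by simp
  then show ?thesis by (simp add: add_eq_0_iff)
qed

lemma four_neq_0: "(2::'a::idom) \<noteq> 0 \<Longrightarrow> (4::'a) \<noteq> 0"
proof -
  have "(4::'a) = 2 * 2" by simp
  then show "(2::'a) \<noteq> 0 \<Longrightarrow> (4::'a) \<noteq> 0" by (metis mult_eq_0_iff)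
qed

lemma det_mat2 [simp]: "det (mat2 a b c d) = a * d - b * c"
  by (simp add: det_2)

lemma trace_mat2 [simp]: "trace (mat2 a b c d) = a + d"
  by (simp add: trace_def sum_2)

lemma mat2_minus_mult [simp]:
  fixes M N :: "'a::ring_1^2^2"
  shows "(- M) ** N = - (M ** N)" "M ** (- N) = - (M ** N)"
proof -
  obtain a b c d where "M = mat2 a b c d" by (rule mat2_cases)
  moreover obtain a' b' c' d' where "N = mat2 a' b' c' d'" by (rule mat2_cases)
  ultimately show "(- M) ** N = - (M ** N)" "M ** (- N) = - (M ** N)" by simp_all
qed

lemma det_minus_2 [simp]: "det (- M) = det (M :: 'a::comm_ring_1^2^2)"
  by (cases M rule: mat2_cases) simp

lemma trace_minus_2 [simp]: "trace (- M) = - trace (M :: 'a::comm_ring_1^2^2)"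
  by (cases M rule: mat2_cases) simp

text \<open>The adjugate, which inverts the matrices of determinant one over any commutative ring.\<close>

definition adj2 :: "'a::comm_ring_1^2^2 \<Rightarrow> 'a^2^2" where
  "adj2 M = mat2 (M $ 2 $ 2) (- (M $ 1 $ 2)) (- (M $ 2 $ 1)) (M $ 1 $ 1)"

lemma adj2_mat2 [simp]: "adj2 (mat2 a b c d) = mat2 d (- b) (- c) a"
  by (simp add: adj2_def)

lemma adj2_mult: "adj2 (M ** N) = adj2 N ** adj2 M"
  by (cases M rule: mat2_cases; cases N rule: mat2_cases) (simp add: algebra_simps)

lemma adj2_minus [simp]: "adj2 (- M) = - adj2 M"
  by (cases M rule: mat2_cases) simp

lemma adj2_adj2 [simp]: "adj2 (adj2 M) = M"
  by (cases M rule: mat2_cases) simp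

lemma adj2_one [simp]: "adj2 (mat 1) = mat 1"
  by (simp add: mat_eq_mat2)

lemma det_adj2 [simp]: "det (adj2 M) = det M"
  by (cases M rule: mat2_cases) (simp add: algebra_simps)

lemma trace_adj2 [simp]: "trace (adj2 M) = trace M"
  by (cases M rule: mat2_cases) (simp add: algebra_simps)

lemma adj2_eq: "adj2 M = mat (trace M) - M"
  by (cases M rule: mat2_cases) (simp add: mat_eq_mat2)

lemma mult_adj2: "M ** adj2 M = mat (det M)" "adj2 M ** M = mat (det M)"
  by (cases M rule: mat2_cases; simp add: mat_eq_mat2 algebra_simps)+

lemma det_one_adj2:
  assumes "det M = 1"
  shows "M ** adj2 M = mat 1" "adj2 M ** M = mat 1"
    "M ** (adj2 M ** N) = N" "adj2 M ** (M ** N) = N"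
  using assms mult_adj2[of M] by (simp_all add: matrix_mul_assoc)

text \<open>Matrices are compared up to sign throughout, as they stand for elements of the projective group.\<close>

definition sgn_eq :: "'a::comm_ring_1^2^2 \<Rightarrow> 'a^2^2 \<Rightarrow> bool" (infix "\<approx>" 50) where
  "M \<approx> N \<longleftrightarrow> M = N \<or> M = - N"

lemma sgn_eq_refl [simp]: "M \<approx> M" by (simp add: sgn_eq_def)
lemma sgn_eq_sym: "M \<approx> N \<Longrightarrow> N \<approx> M" by (auto simp: sgn_eq_def)
lemma sgn_eq_trans [trans]: "M \<approx> N \<Longrightarrow> N \<approx> P \<Longrightarrow> M \<approx> P" by (auto simp: sgn_eq_def)
lemma sgn_eq_mult: "M \<approx> M' \<Longrightarrow> N \<approx> N' \<Longrightarrow> M ** N \<approx> M' ** N'" by (auto simp: sgn_eq_def)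
lemma sgn_eq_minus [simp]: "- M \<approx> N \<longleftrightarrow> M \<approx> N" "M \<approx> - N \<longleftrightarrow> M \<approx> N"
  by (auto simp: sgn_eq_def)

primrec mpow :: "'a::comm_ring_1^2^2 \<Rightarrow> nat \<Rightarrow> 'a^2^2" where
  "mpow M 0 = mat 1"
| "mpow M (Suc n) = M ** mpow M n"

lemma mpow_add: "mpow M (m + n) = mpow M m ** mpow M n"
  by (induction m) (simp_all add: matrix_mul_assoc)

lemma mpow_commute: "mpow M m ** mpow M n = mpow M n ** mpow M m"
  by (metis add.commute mpow_add)

lemma mpow_1 [simp]: "mpow M (Suc 0) = M" by simp

lemma mpow_mult: "mpow M (m * n) = mpow (mpow M m) n"
  by (induction n) (simp_all add: mpow_add)

lemma mpow_one [simp]: "mpow (mat 1) n = mat 1"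
  by (induction n) simp_all

lemma det_mpow: "det (mpow M n) = det M ^ n"
  by (induction n) (simp_all add: det_mul)

lemma sgn_eq_mpow: "M \<approx> N \<Longrightarrow> mpow M n \<approx> mpow N n"
  by (induction n) (simp_all add: sgn_eq_mult)

lemma mpow_mod:
  assumes "mpow M a \<approx> mat 1"
  shows "mpow M (n mod a) \<approx> mpow M n"
proof -
  have "mpow M n = mpow (mpow M a) (n div a) ** mpow M (n mod a)"
    using mpow_add[of M "a * (n div a)" "n mod a"] by (simp add: mpow_mult)
  moreover have "mpow (mpow M a) (n div a) \<approx> mat 1"
    using sgn_eq_mpow[OF assms] by simp
  ultimately show ?thesis
    using sgn_eq_mult[of "mpow (mpow M a) (n div a)" "mat 1" "mpow M (n mod a)" "mpow M (n mod a)"]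
    by (simp add: sgn_eq_sym)
qed

lemma mpow_inverse:
  assumes "mpow M (m + n) \<approx> mat 1" "det M = 1"
  shows "mpow M n \<approx> adj2 (mpow M m)"
proof -
  have d: "det (mpow M m) = 1" using assms by (simp add: det_mpow)
  have "adj2 (mpow M m) ** mpow M (m + n) \<approx> adj2 (mpow M m) ** mat 1"
    by (intro sgn_eq_mult assms) simp
  then show ?thesis by (simp add: mpow_add det_one_adj2[OF d])
qed

text \<open>By the Cayley--Hamilton theorem a power of a matrix of determinant one is linear in the matrix,
  and the coefficients depend on nothing but the trace. This transfers the order of one matrix to
  all matrices of the same trace, without any diagonalization.\<close>

lemma mpow_linear:
  fixes b :: "'a::idom"
  shows "\<exists>p q. \<forall>M. det M = 1 \<and> trace M = b \<longrightarrow> mpow M n = mat p ** M + mat q"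
proof (induction n)
  case 0
  then show ?case by (intro exI[of _ 0] exI[of _ 1]) auto
next
  case (Suc n)
  then obtain p q where pq: "\<And>M. det M = 1 \<and> trace M = b \<Longrightarrow> mpow M n = mat p ** M + mat q" by blast
  have "mpow M (Suc n) = mat (p * b + q) ** M + mat (- p)" if "det M = 1 \<and> trace M = b" for M
  proof -
    have "mpow M (Suc n) = M ** (mat p ** M + mat q)" using pq[OF that] by simp
    also have "\<dots> = mat (p * b + q) ** M + mat (- p)"
    proof (cases M rule: mat2_cases)
      case (1 x y z w)
      then have "x * w - y * z = 1" "b = x + w" using that by auto
      then show ?thesis unfolding 1 by (simp add: mat_eq_mat2) (intro conjI, (Groebner_Basis.algebra | simp add: algebra_simps)+)
    qed
    finally show ?thesis .
  qed
  then show ?case by blast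
qed

lemma mpow_linear':
  fixes M :: "'a::idom^2^2"
  assumes "det M = 1"
  obtains p q where "mpow M n = mat p ** M + mat q"
  using mpow_linear[of "trace M" n] assms by auto

definition comm2 :: "'a::comm_ring_1^2^2 \<Rightarrow> 'a^2^2 \<Rightarrow> 'a^2^2" where
  "comm2 A B = A ** B ** adj2 A ** adj2 B"

lemma comm2_sgn: "A \<approx> A' \<Longrightarrow> B \<approx> B' \<Longrightarrow> comm2 A B = comm2 A' B'"
  by (auto simp: comm2_def sgn_eq_def)

lemma det_comm2: "det A = 1 \<Longrightarrow> det B = 1 \<Longrightarrow> det (comm2 A B) = 1"
  by (simp add: comm2_def det_mul)

text \<open>With \<open>N = A B A\<^sup>-\<^sup>1 B\<^sup>-\<^sup>1\<close> one has \<open>A B - B A = (N - 1) B A\<close>, and \<open>det (N - 1) = 2 - tr N\<close>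
  because \<open>det N = 1\<close>.\<close>

lemma trace_comm2:
  fixes A B :: "'a::idom^2^2"
  assumes "det A = 1" "det B = 1"
  shows "trace (comm2 A B) = 2 - det (A ** B - B ** A)"
proof -
  have "comm2 A B ** (B ** A) = A ** B"
    using assms by (simp add: comm2_def matrix_mul_assoc[symmetric] det_one_adj2)
  then have "A ** B - B ** A = (comm2 A B - mat 1) ** (B ** A)"
    by (cases "comm2 A B" rule: mat2_cases; cases "B ** A" rule: mat2_cases)
      (auto simp: mat_eq_mat2 algebra_simps)
  then have "det (A ** B - B ** A) = det (comm2 A B - mat 1)"
    using assms by (simp add: det_mul)
  also have "\<dots> = 2 - trace (comm2 A B)"
  proof (cases "comm2 A B" rule: mat2_cases)
    case (1 x y z w)
    with det_comm2[OF assms] have "x * w - y * z = 1" by simp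
    then show ?thesis by (simp add: 1 mat_eq_mat2) Groebner_Basis.algebra
  qed
  finally show ?thesis by simp
qed

text \<open>The Fricke identity: the trace of \<open>(A B) (B A)\<^sup>-\<^sup>1\<close> is \<open>tr (A B)\<^sup>2 - tr (A\<^sup>2 B\<^sup>2)\<close>, and the squares
  are linear in \<open>A\<close> and \<open>B\<close>.\<close>

lemma trace_comm2_Fricke:
  fixes A B :: "'a::idom^2^2"
  assumes "det A = 1" "det B = 1"
  shows "trace (comm2 A B) =
    trace A ^ 2 + trace B ^ 2 + trace (A ** B) ^ 2 - trace A * trace B * trace (A ** B) - 2"
proof -
  have sq: "M ** M = mat (trace M) ** M - mat 1" if "det M = 1" for M :: "'a^2^2"
  proof (cases M rule: mat2_cases)
    case (1 x y z w)
    then have "x * w - y * z = 1" using that by simp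
    then show ?thesis unfolding 1
      by (simp add: mat_eq_mat2) (intro conjI, (Groebner_Basis.algebra | simp add: algebra_simps)+)
  qed
  have adj: "trace (M ** adj2 N) = trace M * trace N - trace (M ** N)" for M N :: "'a^2^2"
    by (cases M rule: mat2_cases; cases N rule: mat2_cases) (simp add: algebra_simps)
  have "trace (comm2 A B) = trace (A ** B ** adj2 (B ** A))"
    by (simp add: comm2_def adj2_mult matrix_mul_assoc)
  also have "\<dots> = trace (A ** B) * trace (A ** B) - trace (A ** B ** (B ** A))"
    by (simp add: adj trace_mul_sym[of B A])
  also have "trace (A ** B ** (B ** A)) = trace ((A ** A) ** (B ** B))"
  proof -
    have "trace (A ** B ** (B ** A)) = trace ((A ** B ** B) ** A)" by (simp only: matrix_mul_assoc)
    also have "\<dots> = trace (A ** (A ** B ** B))" by (rule trace_mul_sym)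
    finally show ?thesis by (simp only: matrix_mul_assoc)
  qed
  also have "\<dots> = trace A * trace B * trace (A ** B) - trace A ^ 2 - trace B ^ 2 + 2"
    unfolding sq[OF assms(1)] sq[OF assms(2)]
    by (cases A rule: mat2_cases; cases B rule: mat2_cases)
      (simp add: mat_eq_mat2 algebra_simps power2_eq_square)
  finally show ?thesis by (simp add: power2_eq_square)
qed

lemma trace_conj:
  fixes M N Q :: "'a::comm_ring_1^2^2"
  assumes "Q ** M = N ** Q" "det Q = 1"
  shows "trace M = trace N"
proof -
  have "M = adj2 Q ** (N ** Q)" using assms det_one_adj2(4)[OF assms(2), of M] by simp
  then have "trace M = trace (N ** Q ** adj2 Q)" using trace_mul_sym[of "adj2 Q" "N ** Q"] by simp
  then show ?thesis using assms(2) by (simp add: matrix_mul_assoc[symmetric] det_one_adj2)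
qed

lemma sgn_eq_one_iff_linear:
  fixes M :: "'a::idom^2^2"
  assumes "mat p ** M + mat q \<approx> mat 1" "\<not> M \<approx> mat 1" "det M = 1"
  shows "p = 0"
proof (cases M rule: mat2_cases)
  case (1 a b c d)
  have "(p * a + q = 1 \<and> p * b = 0 \<and> p * c = 0 \<and> p * d + q = 1) \<or>
      (p * a + q = - 1 \<and> p * b = 0 \<and> p * c = 0 \<and> p * d + q = - 1)"
    using assms(1) by (simp add: 1 mat_eq_mat2 sgn_eq_def)
  then have e: "p * b = 0" "p * c = 0" "p * a + q = p * d + q" by (elim disjE conjE; simp only:)+
  show ?thesis
  proof (rule ccontr)
    assume "p \<noteq> 0"
    with e have "b = 0" "c = 0" "a = d" by auto
    moreover from this assms(3) have "a * a = 1" by (simp add: 1)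
    then have "a = 1 \<or> a = -1" by (simp add: square_eq_1_iff)
    ultimately show False using assms(2) by (auto simp: 1 mat_eq_mat2 sgn_eq_def)
  qed
qed

text \<open>The power \<open>M\<^sup>n = p M + q\<close> of a non-scalar \<open>M\<close> is scalar only if \<open>p = 0\<close>, and \<open>p\<close> is determined by
  the trace.\<close>

lemma mpow_sgn_one_by_trace:
  fixes M N :: "'a::idom^2^2"
  assumes "det M = 1" "\<not> M \<approx> mat 1" "mpow M n \<approx> mat 1" "det N = 1" "trace N = trace M"
  shows "mpow N n \<approx> mat 1"
proof -
  obtain p q where pq: "\<And>L. det L = 1 \<and> trace L = trace M \<Longrightarrow> mpow L n = mat p ** L + mat q"
    using mpow_linear[of "trace M" n] by blast
  have p: "p = 0" using sgn_eq_one_iff_linear[of p M q] assms pq[of M] by simp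
  have "mpow M n = mat q" "mpow N n = mat q"
    using assms pq[of M] pq[of N] p by simp_all
  then show ?thesis using assms(3) by simp
qed

section \<open>Finite fields\<close>

definition mult_generator :: "'a::field \<Rightarrow> bool" where
  "mult_generator g \<longleftrightarrow> g \<noteq> 0 \<and> (\<forall>x. x \<noteq> 0 \<longrightarrow> (\<exists>n. x = g ^ n))"

lemma finite_field_generator: "\<exists>g::'a::{field,finite}. mult_generator g"
proof -
  define R :: "'a ring" where
    "R = \<lparr>carrier = UNIV, monoid.mult = (*), one = 1, zero = 0, add = (+)\<rparr>"
  have R: "field R"
  proof (rule cring.cring_fieldI)
    show "cring R"
    proof (rule cringI)
      show "abelian_group R"
      proof (rule abelian_groupI)
        fix x assume "x \<in> carrier R"
        show "\<exists>y\<in>carrier R. y \<oplus>\<^bsub>R\<^esub> x = \<zero>\<^bsub>R\<^esub>"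
          by (intro bexI[of _ "- x"]) (simp_all add: R_def)
      qed (simp_all add: R_def algebra_simps)
      show "comm_monoid R"
        by (rule comm_monoidI) (simp_all add: R_def algebra_simps)
    qed (simp_all add: R_def algebra_simps)
    show "Units R = carrier R - {\<zero>\<^bsub>R\<^esub>}"
    proof -
      have "\<exists>y. y * x = 1 \<and> x * y = 1" if "x \<noteq> 0" for x :: 'a
        using that by (intro exI[of _ "inverse x"]) simp
      then show ?thesis by (force simp: R_def Units_def)
    qed
  qed
  have pow: "a [^]\<^bsub>R\<^esub> n = a ^ n" for a :: 'a and n :: nat
    by (induction n) (simp_all add: R_def)
  from field.finite_field_mult_group_has_gen[OF R]
  obtain g where g: "g \<in> carrier (Multiplicative_Group.mult_of R)"
    "carrier (Multiplicative_Group.mult_of R) = {g [^]\<^bsub>R\<^esub> i | i::nat. i \<in> UNIV}"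
    by (auto simp: R_def)
  then have "g \<noteq> 0" "\<And>x. x \<noteq> 0 \<Longrightarrow> \<exists>n. x = g ^ n"
    by (auto simp: pow Multiplicative_Group.carrier_mult_of) (auto simp: R_def)
  then show ?thesis by (auto simp: mult_generator_def)
qed

lemma finite_field_power:
  fixes x :: "'a::{field,finite}"
  assumes "x \<noteq> 0"
  shows "x ^ (CARD('a) - 1) = 1"
proof -
  have "(\<Prod>y\<in>UNIV - {0}. x * y) = (\<Prod>y\<in>UNIV - {0}. y)"
    by (rule prod.reindex_bij_witness[of _ "\<lambda>y. y / x" "\<lambda>y. x * y"]) (use assms in auto)
  then show ?thesis by (simp add: prod.distrib card_Diff_singleton)
qed

lemma card_le_period:
  assumes "A \<subseteq> range f" "\<And>n. f n = f (n mod k)" "k > (0::nat)"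
  shows "card A \<le> k"
proof -
  have "A \<subseteq> f ` {..<k}"
  proof
    fix x assume "x \<in> A"
    then obtain n where n: "x = f n" using assms(1) by blast
    show "x \<in> f ` {..<k}" unfolding n assms(2)[of n] using assms(3) by simp
  qed
  then have "card A \<le> card (f ` {..<k})" by (intro card_mono) simp_all
  also have "\<dots> \<le> k" using card_image_le[of "{..<k}" f] by simp
  finally show ?thesis .
qed

lemma mult_generator_power:
  fixes g :: "'a::{field,finite}"
  assumes "mult_generator g" "g ^ k = 1" "k > 0"
  shows "CARD('a) - 1 \<le> k"
proof -
  have "g ^ n = g ^ (n mod k)" for n
  proof -
    have "g ^ n = (g ^ k) ^ (n div k) * g ^ (n mod k)" by (simp flip: power_mult power_add)
    then show ?thesis using assms(2) by simp
  qed
  moreover have "UNIV - {0} \<subseteq> range (\<lambda>n. g ^ n)" using assms(1) by (auto simp: mult_generator_def)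
  ultimately have "card (UNIV - {0::'a}) \<le> k" using card_le_period[of "UNIV - {0}" "\<lambda>n. g ^ n" k] assms(3) by blast
  then show ?thesis by (simp add: card_Diff_singleton)
qed

lemma of_nat_card_eq_0: "of_nat CARD('a::{field,finite}) = (0::'a)"
proof -
  have "(\<Sum>x\<in>UNIV. x + 1) = (\<Sum>x\<in>UNIV. x::'a)"
    by (rule sum.reindex_bij_witness[of _ "\<lambda>x. x - 1" "\<lambda>x. x + 1"]) auto
  then show ?thesis by (simp add: sum.distrib)
qed

lemma CHAR_dvd_card: "CHAR('a::{field,finite}) dvd CARD('a)"
  using of_nat_card_eq_0[where 'a='a] by (simp add: of_nat_eq_0_iff_char_dvd)

lemma two_eq_0_iff_even: "(2::'a::{field,finite}) = 0 \<longleftrightarrow> even CARD('a)"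
proof
  assume "(2::'a) = 0"
  then have "CHAR('a) dvd 2" using of_nat_eq_0_iff_char_dvd[of 2, where 'a='a] by simp
  moreover have "prime CHAR('a)" by (intro prime_CHAR_semidom finite_imp_CHAR_pos) simp
  ultimately have "CHAR('a) = 2" using primes_dvd_imp_eq two_is_prime_nat by blast
  then show "even CARD('a)" using CHAR_dvd_card[where 'a='a] by simp
next
  assume "even CARD('a)"
  then have "odd (CARD('a) - 1)" by simp
  moreover have "(- 1::'a) ^ (CARD('a) - 1) = 1" by (rule finite_field_power) simp
  ultimately have "- 1 = (1::'a)" by simp
  then show "(2::'a) = 0" by (metis add.right_inverse one_add_one)
qed

lemma char_2_square_root:
  assumes "(2::'a::{field,finite}) = 0"
  shows "\<exists>s. s ^ 2 = (r::'a)"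
proof (cases "r = 0")
  case False
  obtain k where k: "CARD('a) = 2 * k" using assms two_eq_0_iff_even[where 'a='a] by (auto elim: evenE)
  have "CARD('a) > 0" by simp
  then have e: "CARD('a) = Suc (CARD('a) - 1)" by linarith
  have "(r ^ k) ^ 2 = r ^ CARD('a)" unfolding k power_mult[symmetric] by (simp only: mult.commute)
  also have "\<dots> = r * r ^ (CARD('a) - 1)" by (metis e power_Suc)
  also have "\<dots> = r" unfolding finite_field_power[OF False] by simp
  finally show ?thesis by blast
qed simp

definition nz_squares :: "'a::field set" where
  "nz_squares = {x ^ 2 | x. x \<noteq> 0}"

text \<open>The multiplicative group is cyclic, so the squares have index at most two in it.\<close>

lemma nz_squares_ratio:
  fixes u v :: "'a::{field,finite}"
  assumes "u \<noteq> 0" "v \<noteq> 0" "u \<in> nz_squares \<longleftrightarrow> v \<in> nz_squares"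
  shows "\<exists>r. r \<noteq> 0 \<and> r ^ 2 * u = v"
proof (cases "u \<in> nz_squares")
  case True
  then obtain x y where "u = x ^ 2" "v = y ^ 2" "x \<noteq> 0" "y \<noteq> 0"
    using assms(3) by (auto simp: nz_squares_def)
  then show ?thesis by (intro exI[of _ "y / x"]) (simp add: power_divide)
next
  case False
  obtain g :: 'a where g: "mult_generator g" using finite_field_generator by blast
  obtain m where m: "u = g ^ m" using g assms(1) by (auto simp: mult_generator_def)
  obtain n where n: "v = g ^ n" using g assms(2) by (auto simp: mult_generator_def)
  have g0: "g \<noteq> 0" using g by (simp add: mult_generator_def)
  have odd: "odd k" if k: "g ^ k \<notin> nz_squares" for k
  proof
    assume "even k"
    then obtain j where j: "k = j * 2" by (auto elim: evenE)
    have "g ^ j \<noteq> 0" using g0 by simp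
    then have "g ^ k \<in> nz_squares" unfolding j power_mult nz_squares_def by blast
    then show False using k by blast
  qed
  have "odd m" "odd n" using odd[of m] odd[of n] False assms(3) m n by blast+
  then have "even (m + n)" by simp
  then obtain j where "m + n = 2 * j" unfolding dvd_def by blast
  then have j: "m + n = j * 2" by simp
  have "(g ^ j / u) ^ 2 * u = g ^ (m + n) / u"
    using assms(1) unfolding j power_mult by (simp add: power_divide power2_eq_square)
  also have "\<dots> = v" using assms(1) by (simp add: power_add m n)
  finally show ?thesis using g0 assms(1) by (intro exI[of _ "g ^ j / u"]) simp
qed

lemma nz_squares_char_2:
  assumes "(2::'a::{field,finite}) = 0"
  shows "nz_squares = UNIV - {0::'a}"
proof
  show "UNIV - {0::'a} \<subseteq> nz_squares"
  proof
    fix r :: 'a assume r: "r \<in> UNIV - {0}"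
    obtain s where s: "s ^ 2 = r" using char_2_square_root[OF assms] by blast
    then have "s \<noteq> 0" using r by auto
    then show "r \<in> nz_squares" using s unfolding nz_squares_def by blast
  qed
qed (auto simp: nz_squares_def)

lemma card_nz_squares:
  "2 * card (nz_squares :: 'a::{field,finite} set) \<ge> CARD('a) - 1"
proof -
  have "UNIV - {0::'a} = (\<Union>v\<in>nz_squares. {x. x ^ 2 = v})"
    by (auto simp: nz_squares_def)
  then have "card (UNIV - {0::'a}) \<le> (\<Sum>v\<in>nz_squares. card {x::'a. x ^ 2 = v})"
    using card_UN_le[of "nz_squares :: 'a set" "\<lambda>v. {x. x ^ 2 = v}"] by simp
  also have "\<dots> \<le> (\<Sum>v\<in>(nz_squares :: 'a set). 2)"
  proof (rule sum_mono)
    fix v :: 'a assume "v \<in> nz_squares"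
    then obtain y where "v = y ^ 2" by (auto simp: nz_squares_def)
    then have "{x. x ^ 2 = v} \<subseteq> {y, - y}" by (auto simp: power2_eq_iff)
    then have "card {x. x ^ 2 = v} \<le> card {y, - y}" by (intro card_mono) auto
    then show "card {x. x ^ 2 = v} \<le> 2" using card_insert_le_m1[of 2 "{- y}" y] by simp
  qed
  finally show ?thesis by (simp add: card_Diff_singleton)
qed

section \<open>Generating the special linear group\<close>

text \<open>All matrices act on the projective line; the upper triangular ones are the stabilizer of the
  point at infinity.\<close>

definition upper :: "'a::field \<Rightarrow> 'a^2^2" where "upper t = mat2 1 t 0 1"
definition torus :: "'a::field \<Rightarrow> 'a^2^2" where "torus s = mat2 s 0 0 (1 / s)"

lemma torus_power: "mpow (torus s) n = torus (s ^ n)"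
  by (induction n) (simp_all add: torus_def mat_eq_mat2)

lemma upper_power: "mpow (upper t) n = upper (of_nat n * t)"
  by (induction n) (simp_all add: upper_def mat_eq_mat2 algebra_simps)

locale SL2_subgroup =
  fixes K :: "('a::{field,finite}^2^2) set"
  assumes det_one: "M \<in> K \<Longrightarrow> det M = 1"
    and one_mem: "mat 1 \<in> K"
    and mult_mem: "M \<in> K \<Longrightarrow> N \<in> K \<Longrightarrow> M ** N \<in> K"
    and adj_mem: "M \<in> K \<Longrightarrow> adj2 M \<in> K"
begin

lemma mpow_mem: "M \<in> K \<Longrightarrow> mpow M n \<in> K"
  by (induction n) (simp_all add: one_mem mult_mem)

text \<open>The element moving infinity yields a monomial matrix, which conjugates the upper to the lower
  transvections; the two families generate the special linear group.\<close>

lemma full_if_all_upper: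
  assumes U: "\<And>t. upper t \<in> K" and g: "mat2 a b c d \<in> K" and c: "c \<noteq> 0"
  shows "K = {M. det M = 1}"
proof -
  have dt: "a * d - b * c = 1" using det_one[OF g] by simp
  have "upper (- a / c) ** mat2 a b c d ** upper (- d / c) \<in> K"
    by (intro mult_mem U g)
  also have "upper (- a / c) ** mat2 a b c d ** upper (- d / c) = mat2 0 (- 1 / c) c 0"
    using c dt by (simp add: upper_def field_simps)
  finally have w: "mat2 0 (- 1 / c) c 0 \<in> K" .
  have L: "mat2 1 0 t 1 \<in> K" for t
  proof -
    have "mat2 0 (- 1 / c) c 0 ** upper (- t / c ^ 2) ** adj2 (mat2 0 (- 1 / c) c 0) \<in> K"
      by (intro mult_mem adj_mem U w)
    then show ?thesis using c by (simp add: upper_def field_simps power2_eq_square)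
  qed
  have lowright: "mat2 p q r s \<in> K" if "p * s - q * r = 1" "r \<noteq> 0" for p q r s
  proof -
    have "upper ((p - 1) / r) ** mat2 1 0 r 1 ** upper ((s - 1) / r) \<in> K"
      by (intro mult_mem U L)
    also have "upper ((p - 1) / r) ** mat2 1 0 r 1 ** upper ((s - 1) / r) = mat2 p q r s"
      using that by (simp add: upper_def field_simps)
    finally show ?thesis .
  qed
  have "M \<in> K" if "det M = 1" for M
  proof (cases M rule: mat2_cases)
    case (1 p q r s)
    then have ps: "p * s - q * r = 1" using that by simp
    show ?thesis
    proof (cases "r = 0")
      case True
      then have "s \<noteq> 0" using ps by auto
      have "mat2 (p + q) q s s ** adj2 (mat2 1 0 1 1) \<in> K"
        using ps True \<open>s \<noteq> 0\<close> by (intro mult_mem adj_mem L lowright) (auto simp: algebra_simps)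
      then show ?thesis by (simp add: 1 True)
    qed (use lowright ps 1 in auto)
  qed
  then show ?thesis using det_one by auto
qed

lemma upper_add_mem: "upper s \<in> K \<Longrightarrow> upper t \<in> K \<Longrightarrow> upper (s + t) \<in> K"
  using mult_mem[of "upper s" "upper t"] by (simp add: upper_def add.commute)

lemma upper_uminus_mem: "upper s \<in> K \<Longrightarrow> upper (- s) \<in> K"
  using adj_mem[of "upper s"] by (simp add: upper_def)

lemma upper_0_mem: "upper 0 \<in> K"
  using one_mem by (simp add: upper_def mat_eq_mat2)

lemma upper_of_nat_mem: "upper s \<in> K \<Longrightarrow> upper (of_nat n * s) \<in> K"
  by (induction n) (simp_all add: upper_0_mem upper_add_mem distrib_right)

lemma torus_upper_torus: "s \<noteq> 0 \<Longrightarrow> torus s ** upper t ** adj2 (torus s) = upper (s ^ 2 * t)"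
  by (simp add: torus_def upper_def power2_eq_square field_simps)

text \<open>Squares generate the whole field additively: in odd characteristic
  \<open>r = ((r + 1) / 2)\<^sup>2 - ((r - 1) / 2)\<^sup>2\<close>, in characteristic two every element is a square.\<close>

lemma full_if_torus_and_upper:
  assumes T: "\<And>s. s \<noteq> 0 \<Longrightarrow> torus s \<in> K" and u: "upper t \<in> K" "t \<noteq> 0"
    and g: "mat2 a b c d \<in> K" "c \<noteq> 0"
  shows "K = {M. det M = 1}"
proof -
  have sq: "upper (s ^ 2 * t) \<in> K" for s
  proof (cases "s = 0")
    case True then show ?thesis by (simp add: upper_0_mem)
  next
    case False
    then show ?thesis using T u by (simp flip: torus_upper_torus add: mult_mem adj_mem)
  qed
  have "upper (r * t) \<in> K" for r
  proof (cases "(2::'a) = 0")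
    case True
    then have "\<exists>s. s ^ 2 = r" by (rule char_2_square_root)
    then show ?thesis using sq by auto
  next
    case False
    have "((r + 1) / 2) ^ 2 - ((r - 1) / 2) ^ 2 = r"
    proof -
      have "(4::'a) = 2 * 2" by simp
      then have "(4::'a) \<noteq> 0" using False by (metis mult_eq_0_iff)
      moreover have "(r + 1) ^ 2 - (r - 1) ^ 2 = 4 * r" by (simp add: power2_eq_square algebra_simps)
      ultimately show ?thesis by (simp add: power_divide flip: diff_divide_distrib)
    qed
    then have "r * t = ((r + 1) / 2) ^ 2 * t + - (((r - 1) / 2) ^ 2 * t)"
      by (metis add_uminus_conv_diff left_diff_distrib')
    then show ?thesis using upper_add_mem[OF sq upper_uminus_mem[OF sq]] by metis
  qed
  from this[of "s / t" for s] have "upper s \<in> K" for s using u(2) by simp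
  then show ?thesis by (rule full_if_all_upper[OF _ g])
qed

lemma full_if_prime_card:
  assumes u: "upper t \<in> K" "t \<noteq> 0" and g: "mat2 a b c d \<in> K" "c \<noteq> 0"
    and surj: "range (of_nat :: nat \<Rightarrow> 'a) = UNIV"
  shows "K = {M. det M = 1}"
proof (rule full_if_all_upper[OF _ g])
  fix s
  obtain n where "s / t = of_nat n" using surj by (metis rangeE UNIV_I)
  then show "upper s \<in> K" using upper_of_nat_mem[OF u(1), of n] u(2) by (simp add: field_simps)
qed

text \<open>An upper triangular element outside the torus supplies a transvection.\<close>

lemma full_if_torus_and_triangular:
  assumes T: "\<And>s. s \<noteq> 0 \<Longrightarrow> torus s \<in> K" and u: "mat2 e f 0 h \<in> K" "f \<noteq> 0"
    and g: "mat2 a b c d \<in> K" "c \<noteq> 0"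
  shows "K = {M. det M = 1}"
proof (rule full_if_torus_and_upper[OF T _ _ g])
  have eh: "e * h = 1" using det_one[OF u(1)] by simp
  then have h: "h \<noteq> 0" by auto
  then have "e = 1 / h" using eh by (simp add: field_simps)
  note h = h this
  have "torus h ** mat2 e f 0 h \<in> K" using T h u by (intro mult_mem) auto
  then show "upper (h * f) \<in> K" using h by (simp add: torus_def upper_def)
  show "h * f \<noteq> 0" using h u by simp
qed

text \<open>An element \<open>g\<close> with \<open>a = 0\<close> takes infinity to zero, which the torus fixes as well. So \<open>g\<^sup>-\<^sup>1 t g\<close> is
  triangular for \<open>t\<close> in the torus.\<close>

lemma full_if_torus_and_swap:
  assumes T: "\<And>s. s \<noteq> 0 \<Longrightarrow> torus s \<in> K" and g: "mat2 0 b c d \<in> K" "d \<noteq> 0"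
    and s: "s \<noteq> 0" "(s::'a) ^ 2 \<noteq> 1"
  shows "K = {M. det M = 1}"
proof -
  have bc: "- (b * c) = 1" using det_one[OF g(1)] by simp
  then have nz: "b \<noteq> 0" "c \<noteq> 0" by auto
  have "adj2 (mat2 0 b c d) ** torus s ** mat2 0 b c d \<in> K"
    using g s T by (intro mult_mem adj_mem)
  also have "adj2 (mat2 0 b c d) ** torus s ** mat2 0 b c d =
      mat2 (- (b * c) / s) (b * d * (s - 1 / s)) 0 (- (b * c) * s)"
    using s by (simp add: torus_def field_simps)
  finally have m: "mat2 (- (b * c) / s) (b * d * (s - 1 / s)) 0 (- (b * c) * s) \<in> K" .
  have "s - 1 / s \<noteq> 0" using s by (simp add: field_simps power2_eq_square)
  then show ?thesis
    using full_if_torus_and_triangular[OF T m _ g(1) nz(2)] nz g by simp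
qed

text \<open>Two elements \<open>h = g t g\<close> and \<open>h' = g t' g\<close> that move infinity into the same orbit of the
  torus differ by an element fixing infinity; the products of diagonal entries show that it is not
  in the torus. Here \<open>s\<close>, \<open>s'\<close> and \<open>r\<close> are the parameters of \<open>t\<close>, \<open>t'\<close> and of the element of the torus
  that links the two images of infinity.\<close>

lemma full_if_torus_and_collision:
  assumes T: "\<And>s. s \<noteq> 0 \<Longrightarrow> torus s \<in> K" and g: "mat2 a b c d \<in> K"
    and nz: "a \<noteq> 0" "b \<noteq> 0" "c \<noteq> 0" "d \<noteq> 0" "s \<noteq> 0" "s' \<noteq> 0" "r \<noteq> 0"
    and c: "a * s + d / s \<noteq> 0" "a * s' + d / s' \<noteq> 0"
    and r: "r ^ 2 * (a ^ 2 * s + b * c / s) * (a * s' + d / s') =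
      (a ^ 2 * s' + b * c / s') * (a * s + d / s)"
    and ne: "s ^ 2 \<noteq> s' ^ 2" "s ^ 2 * s' ^ 2 * a ^ 2 \<noteq> d ^ 2"
  shows "K = {M. det M = 1}"
proof -
  define h where "h s = mat2 (a ^ 2 * s + b * c / s) (b * (a * s + d / s))
    (c * (a * s + d / s)) (b * c * s + d ^ 2 / s)" for s
  have h: "h x \<in> K" if "x \<noteq> 0" for x
  proof -
    have "mat2 a b c d ** torus x ** mat2 a b c d \<in> K" using that g T by (intro mult_mem)
    also have "mat2 a b c d ** torus x ** mat2 a b c d = h x"
      using that by (simp add: h_def torus_def power2_eq_square field_simps)
    finally show ?thesis .
  qed
  define m where "m = adj2 (h s') ** torus r ** h s"
  have mK: "m \<in> K" unfolding m_def using nz by (intro mult_mem adj_mem h T)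
  obtain e f k l where m: "m = mat2 e f k l" by (rule mat2_cases)
  have k: "k = 0"
  proof -
    have "k = - (c * (a * s' + d / s') * (r * (a ^ 2 * s + b * c / s))) +
        (a ^ 2 * s' + b * c / s') * (c * (a * s + d / s) / r)"
      using m unfolding m_def h_def torus_def by (simp add: mult_ac)
    also have "\<dots> = c / r * ((a ^ 2 * s' + b * c / s') * (a * s + d / s) -
        r ^ 2 * (a ^ 2 * s + b * c / s) * (a * s' + d / s'))"
    proof -
      have "- (c * Q' * (r * P)) + P' * (c * Q / r) = c / r * (P' * Q - r ^ 2 * P * Q')" for P Q P' Q'
        using nz(7) by (simp add: field_simps power2_eq_square)
      then show ?thesis .
    qed
    also have "\<dots> = 0" using r by simp
    finally show ?thesis .
  qed
  have "f \<noteq> 0"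
  proof
    assume "f = 0"
    have "det m = 1" using mK det_one by blast
    then have el: "e * l = 1" using m k by simp
    have "torus r ** h s = h s' ** m"
      unfolding m_def using det_one[OF h[OF nz(6)]] by (simp add: matrix_mul_assoc[symmetric] det_one_adj2)
    then have eq: "r * (a ^ 2 * s + b * c / s) = (a ^ 2 * s' + b * c / s') * e"
       "(b * c * s + d ^ 2 / s) / r = (b * c * s' + d ^ 2 / s') * l"
      using m k \<open>f = 0\<close> by (simp_all add: h_def torus_def)
    have "P * S = P' * S' * (e * l)" if "r * P = P' * e" "S / r = S' * l" for P S P' S'
    proof -
      have "P * S = (r * P) * (S / r)" using nz(7) by simp
      also have "\<dots> = P' * S' * (e * l)" unfolding that by (simp only: mult_ac)
      finally show ?thesis .
    qed
    from this[OF eq] have "(a ^ 2 * s + b * c / s) * (b * c * s + d ^ 2 / s) =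
        (a ^ 2 * s' + b * c / s') * (b * c * s' + d ^ 2 / s') * (e * l)" .
    then have "(a ^ 2 * s + b * c / s) * (b * c * s + d ^ 2 / s) =
        (a ^ 2 * s' + b * c / s') * (b * c * s' + d ^ 2 / s')" using el by simp
    then have "b * c * (s ^ 2 - s' ^ 2) * (s ^ 2 * s' ^ 2 * a ^ 2 - d ^ 2) = 0"
      using nz(5,6) by (simp add: field_simps power2_eq_square) 
    then show False using ne nz by simp
  qed
  moreover have "mat2 e f 0 l \<in> K" using mK m k by simp
  ultimately show ?thesis using full_if_torus_and_triangular[OF T _ _ g nz(3)] by blast
qed

lemma torus_mem_if_generator:
  assumes "mult_generator x" "torus x \<in> K" "s \<noteq> 0"
  shows "torus s \<in> K"
proof -
  obtain n where n: "s = x ^ n" using assms by (auto simp: mult_generator_def)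
  then show ?thesis using mpow_mem[OF assms(2), of n] by (simp add: torus_power)
qed

text \<open>Pigeonhole principle: once there are at least seven squares \<open>v = s\<^sup>2\<close>, at least five of
  them avoid the zeros of \<open>(a\<^sup>2 v + b c) (a v + d)\<close>, three of these lie in the same class
  modulo squares, and a product \<open>v v'\<close> takes the forbidden value \<open>d\<^sup>2 / a\<^sup>2\<close> for at most
  one of the partners.\<close>

lemma full_if_torus_and_generic:
  assumes T: "\<And>s. s \<noteq> 0 \<Longrightarrow> torus s \<in> K" and g: "mat2 a b c d \<in> K"
    and nz: "a \<noteq> 0" "b \<noteq> 0" "c \<noteq> 0" "d \<noteq> 0"
    and card: "card (nz_squares :: 'a set) \<ge> 7"
  shows "K = {M. det M = 1}"
proof -
  define \<phi> where "\<phi> v = (a ^ 2 * v + b * c) * (a * v + d)" for v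
  define V where "V = {v \<in> nz_squares. \<phi> v \<noteq> 0}"
  have lin: "v = - Y / X" if "X * v + Y = 0" "X \<noteq> 0" for X Y v :: 'a
  proof -
    have "X * v = - Y" using that by (simp add: eq_neg_iff_add_eq_0)
    then show ?thesis using that by (metis nonzero_mult_div_cancel_left)
  qed
  have "nz_squares - {- (b * c) / a ^ 2, - d / a} \<subseteq> V"
    using lin[of "a ^ 2" _ "b * c"] lin[of a _ d] nz by (auto simp: V_def \<phi>_def)
  then have "card (nz_squares - {- (b * c) / a ^ 2, - d / a}) \<le> card V"
    by (intro card_mono finite)
  moreover have "card (nz_squares :: 'a set) - card {- (b * c) / a ^ 2, - d / a} \<le>
      card (nz_squares - {- (b * c) / a ^ 2, - d / a})"
    by (rule diff_card_le_card_Diff) simp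
  moreover have "card {- (b * c) / a ^ 2, - d / a} \<le> 2" by (simp add: card_insert_if)
  ultimately have "card V \<ge> 5" using card by linarith
  define P where "P = {v \<in> V. \<phi> v \<in> nz_squares}"
  define N where "N = {v \<in> V. \<phi> v \<notin> nz_squares}"
  have "V = P \<union> N" "P \<inter> N = {}" by (auto simp: P_def N_def)
  then have "card V = card P + card N" by (simp add: card_Un_disjoint)
  then have "card P \<ge> 3 \<or> card N \<ge> 3" using \<open>card V \<ge> 5\<close> by linarith
  then obtain C where C: "C = P \<or> C = N" "card C \<ge> 3" by blast
  then obtain D where D: "D \<subseteq> C" "card D = 3" using obtain_subset_with_card_n[OF C(2)] by blast
  then obtain x y z where xyz: "D = {x, y, z}" "x \<noteq> y" "y \<noteq> z" "x \<noteq> z"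
    by (auto simp: card_3_iff)
  have xV: "x \<in> V" using C D xyz by (auto simp: P_def N_def)
  then have x0: "x \<noteq> 0" by (auto simp: V_def nz_squares_def)
  have "x * y * a ^ 2 \<noteq> d ^ 2 \<or> x * z * a ^ 2 \<noteq> d ^ 2"
  proof (rule ccontr)
    assume "\<not> ?thesis"
    then have "x * y * a ^ 2 = x * z * a ^ 2" by simp
    then show False using x0 nz xyz by simp
  qed
  then obtain w where w: "w \<in> D" "w \<noteq> x" "x * w * a ^ 2 \<noteq> d ^ 2" using xyz by blast
  have wV: "w \<in> V" and same: "\<phi> x \<in> nz_squares \<longleftrightarrow> \<phi> w \<in> nz_squares"
    using C D w xyz by (auto simp: P_def N_def)
  obtain s where s: "s \<noteq> 0" "x = s ^ 2" using xV by (auto simp: V_def nz_squares_def)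
  obtain s' where s': "s' \<noteq> 0" "w = s' ^ 2" using wV by (auto simp: V_def nz_squares_def)
  have nzx: "a ^ 2 * x + b * c \<noteq> 0" "a * x + d \<noteq> 0" using xV by (auto simp: V_def \<phi>_def)
  have nzw: "a ^ 2 * w + b * c \<noteq> 0" "a * w + d \<noteq> 0" using wV by (auto simp: V_def \<phi>_def)
  obtain r where r: "r \<noteq> 0" "r ^ 2 * \<phi> x = \<phi> w"
    using nz_squares_ratio[OF _ _ same] nzx nzw by (auto simp: \<phi>_def)
  \<comment> \<open>The torus element with this parameter carries the first image of infinity to the second.\<close>
  define \<rho> where "\<rho> = r * (a * x + d) / (a * w + d)"
  have e: "X + Y / t = (X * t + Y) / t" if "t \<noteq> 0" for X Y t :: 'a using that by (simp add: field_simps)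
  have AS: "a ^ 2 * s + b * c / s = (a ^ 2 * x + b * c) / s" "a * s + d / s = (a * x + d) / s"
    "a ^ 2 * s' + b * c / s' = (a ^ 2 * w + b * c) / s'" "a * s' + d / s' = (a * w + d) / s'"
    using s s' by (simp_all add: field_simps power2_eq_square)
  show ?thesis
  proof (rule full_if_torus_and_collision[OF T g nz s(1) s'(1)])
    show "\<rho> \<noteq> 0" using r nzx nzw by (simp add: \<rho>_def)
    show "a * s + d / s \<noteq> 0" "a * s' + d / s' \<noteq> 0" unfolding AS using nzx nzw s s' by simp_all
    show "s ^ 2 \<noteq> s' ^ 2" "s ^ 2 * s' ^ 2 * a ^ 2 \<noteq> d ^ 2" using w s s' by auto
    have gen: "(R * X / W) ^ 2 * (A / s) * (W / s') = (B / s') * (X / s)"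
      if "R ^ 2 * (A * X) = B * W" "W \<noteq> 0" for R A X B W :: 'a
    proof -
      have "(R * X / W) ^ 2 * (A / s) * (W / s') = R ^ 2 * (A * X) * X / (W * s * s')"
        using that(2) s s' by (simp add: field_simps power2_eq_square)
      also have "\<dots> = (B / s') * (X / s)" unfolding that(1) using that(2) by simp
      finally show ?thesis .
    qed
    show "\<rho>\<^sup>2 * (a\<^sup>2 * s + b * c / s) * (a * s' + d / s') = (a\<^sup>2 * s' + b * c / s') * (a * s + d / s)"
      unfolding AS \<rho>_def by (rule gen) (use r nzw in \<open>simp_all add: \<phi>_def\<close>)
  qed
qed

end

section \<open>The algebra spanned by a pair of matrices\<close>

text \<open>The module spanned by \<open>1\<close>, \<open>A\<close>, \<open>B\<close> and \<open>A B\<close> is an algebra over any coefficient ring. That it is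
  closed under products is best expressed by saying that left multiplication by \<open>A\<close> and by \<open>B\<close>
  preserves it: the matrices with this property are visibly closed under products.\<close>

definition lincomb :: "'a::idom^2^2 \<Rightarrow> 'a^2^2 \<Rightarrow> 'a \<Rightarrow> 'a \<Rightarrow> 'a \<Rightarrow> 'a \<Rightarrow> 'a^2^2" where
  "lincomb A B p q r s = mat p + mat q ** A + mat r ** B + mat s ** (A ** B)"

definition span4 :: "'a::idom^2^2 \<Rightarrow> 'a^2^2 \<Rightarrow> ('a^2^2) set" where
  "span4 A B = {lincomb A B p q r s | p q r s. True}"

definition stab4 :: "'a::idom^2^2 \<Rightarrow> 'a^2^2 \<Rightarrow> ('a^2^2) set" where
  "stab4 A B = {M. \<forall>N\<in>span4 A B. M ** N \<in> span4 A B}"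

lemma lincomb_mem: "lincomb A B p q r s \<in> span4 A B"
  by (auto simp: span4_def)

lemma lincomb_left:
  "A ** lincomb A B p q r s =
    lincomb A B (- q * det A) (p + q * trace A) (- s * det A) (r + s * trace A)"
  "B ** lincomb A B p q r s =
    lincomb A B (q * (trace (A ** B) - trace A * trace B) - r * det B - s * trace A * det B)
      (q * trace B + s * det B) (p + q * trace A + r * trace B + s * trace (A ** B)) (- q)"
  and lincomb_add:
  "lincomb A B p q r s + lincomb A B p' q' r' s' = lincomb A B (p + p') (q + q') (r + r') (s + s')"
  and lincomb_smult: "mat k ** lincomb A B p q r s = lincomb A B (k * p) (k * q) (k * r) (k * s)"
  by (cases A rule: mat2_cases; cases B rule: mat2_cases;
      simp add: lincomb_def mat_eq_mat2 algebra_simps)+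

lemma stab4_A: "A \<in> stab4 A B" and stab4_B: "B \<in> stab4 A B" and stab4_mat: "mat k \<in> stab4 A B"
proof -
  have *: "M \<in> stab4 A B" if "\<And>p q r s. M ** lincomb A B p q r s \<in> span4 A B" for M
    using that by (auto simp: stab4_def span4_def)
  show "A \<in> stab4 A B" "B \<in> stab4 A B" "mat k \<in> stab4 A B"
    by (rule *, simp only: lincomb_left lincomb_smult lincomb_mem)+
qed

lemma stab4_mult: "M \<in> stab4 A B \<Longrightarrow> N \<in> stab4 A B \<Longrightarrow> M ** N \<in> stab4 A B"
  by (simp add: stab4_def matrix_mul_assoc[symmetric])

lemma span4_add: "M \<in> span4 A B \<Longrightarrow> N \<in> span4 A B \<Longrightarrow> M + N \<in> span4 A B"
  unfolding span4_def using lincomb_add by fastforce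

lemma span4_uminus: "M \<in> span4 A B \<Longrightarrow> - M \<in> span4 A B"
proof -
  assume "M \<in> span4 A B"
  then have "mat (- 1) ** M \<in> span4 A B" unfolding span4_def using lincomb_smult by fastforce
  moreover have "mat (- 1) ** M = - M" by (cases M rule: mat2_cases) simp
  ultimately show ?thesis by simp
qed

lemma stab4_sgn: "M \<approx> N \<Longrightarrow> N \<in> stab4 A B \<Longrightarrow> M \<in> stab4 A B"
  by (auto simp: sgn_eq_def stab4_def span4_uminus)

lemma stab4_adj2:
  assumes "M \<in> stab4 A B"
  shows "adj2 M \<in> stab4 A B"
proof -
  have "adj2 M ** N = mat (trace M) ** N + - (M ** N)" for N :: "'a^2^2"
    unfolding adj2_eq
    by (cases M rule: mat2_cases; cases N rule: mat2_cases) (simp add: mat_eq_mat2 algebra_simps)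
  then show ?thesis
    using assms stab4_mat[of "trace M" A B] span4_add span4_uminus unfolding stab4_def by fastforce
qed

lemma stab4_mpow: "M \<in> stab4 A B \<Longrightarrow> mpow M n \<in> stab4 A B"
  by (induction n) (simp_all add: stab4_mult stab4_mat)

lemma stab4_subset_span4: "M \<in> stab4 A B \<Longrightarrow> M \<in> span4 A B"
proof -
  have "lincomb A B 1 0 0 0 = mat 1" by (simp add: lincomb_def)
  then have "mat 1 \<in> span4 A B" by (metis lincomb_mem)
  moreover assume "M \<in> stab4 A B"
  ultimately show ?thesis unfolding stab4_def by fastforce
qed

text \<open>Every \<open>M N - N M\<close> in the algebra is a left multiple of \<open>A B - B A\<close>: the differences
  \<open>[A, A B] = A [A, B]\<close> and \<open>[B, A B] = - [A, B] B\<close> are, since \<open>[A, B] B = (tr B - B) [A, B]\<close>. Hence the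
  discriminant \<open>det (A B - B A)\<close> is determined up to a unit by the algebra, whichever pair
  generates it.\<close>

lemma det_commutator_dvd:
  assumes "M \<in> span4 A B" "N \<in> span4 A B"
  shows "det (A ** B - B ** A) dvd det (M ** N - N ** M)"
proof -
  obtain p q r s where M: "M = lincomb A B p q r s" using assms by (auto simp: span4_def)
  obtain p' q' r' s' where N: "N = lincomb A B p' q' r' s'" using assms by (auto simp: span4_def)
  define D where "D = mat (q * r' - r * q') + mat (q * s' - s * q') ** A +
    mat (r * s' - s * r') ** (B - mat (trace B))"
  obtain x y z w where A: "A = mat2 x y z w" by (rule mat2_cases)
  obtain x' y' z' w' where B: "B = mat2 x' y' z' w'" by (rule mat2_cases)
  have "M ** N - N ** M = D ** (A ** B - B ** A)"
    unfolding M N D_def A B lincomb_def by (simp add: mat_eq_mat2 algebra_simps)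
  then show ?thesis by (simp add: det_mul)
qed

section \<open>A one-parameter family of pairs\<close>

text \<open>Conjugating the first matrix of a pair by the transvection with an indeterminate entry \<open>t\<close>
  deforms the pair into a family over the polynomial ring; at \<open>t = 0\<close> the original pair returns.\<close>

definition const_mat :: "'a::idom^2^2 \<Rightarrow> 'a poly^2^2" where
  "const_mat M = mat2 [:M $ 1 $ 1:] [:M $ 1 $ 2:] [:M $ 2 $ 1:] [:M $ 2 $ 2:]"

definition twist :: "'a::idom^2^2 \<Rightarrow> 'a poly^2^2" where
  "twist M = mat2 1 (- [:0, 1:]) 0 1 ** const_mat M ** mat2 1 [:0, 1:] 0 1"

definition at_zero :: "'a::idom poly^2^2 \<Rightarrow> 'a^2^2" where
  "at_zero M = mat2 (poly (M $ 1 $ 1) 0) (poly (M $ 1 $ 2) 0) (poly (M $ 2 $ 1) 0) (poly (M $ 2 $ 2) 0)"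

lemma const_mat_mat2 [simp]: "const_mat (mat2 a b c d) = mat2 [:a:] [:b:] [:c:] [:d:]"
  by (simp add: const_mat_def)

lemma twist_mat2 [simp]:
  "twist (mat2 a b c d) = mat2 [:a, - c:] [:b, a - d, - c:] [:c:] [:d, c:]"
  by (simp add: twist_def)

lemma at_zero_mat2 [simp]: "at_zero (mat2 a b c d) = mat2 (poly a 0) (poly b 0) (poly c 0) (poly d 0)"
  by (simp add: at_zero_def)

lemma const_mat_mult: "const_mat (M ** N) = const_mat M ** const_mat N"
  by (cases M rule: mat2_cases; cases N rule: mat2_cases) simp

lemma twist_mult: "twist (M ** N) = twist M ** twist N"
proof -
  have "mat2 1 [:0, 1:] 0 1 ** mat2 1 (- [:0, 1:]) 0 1 = (mat 1 :: 'a poly^2^2)"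
    by (simp add: mat_eq_mat2)
  moreover have "twist M ** twist N = mat2 1 (- [:0, 1:]) 0 1 ** const_mat M **
      (mat2 1 [:0, 1:] 0 1 ** mat2 1 (- [:0, 1:]) 0 1) ** const_mat N ** mat2 1 [:0, 1:] 0 1"
    by (simp only: twist_def matrix_mul_assoc)
  ultimately show ?thesis by (simp add: twist_def const_mat_mult matrix_mul_assoc)
qed

lemma at_zero_mult: "at_zero (M ** N) = at_zero M ** at_zero N"
  by (cases M rule: mat2_cases; cases N rule: mat2_cases) simp

lemma at_zero_adj2: "at_zero (adj2 M) = adj2 (at_zero M)"
  by (cases M rule: mat2_cases) simp

lemma det_at_zero: "det (at_zero M) = poly (det M) 0"
  by (cases M rule: mat2_cases) simp

lemma one_family [simp]: "const_mat (mat 1) = mat 1" "twist (mat 1) = mat 1" "at_zero (mat 1) = mat 1"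
  by (simp_all add: mat_eq_mat2 pCons_one)

lemma at_zero_family [simp]: "at_zero (const_mat M) = M" "at_zero (twist M) = M"
  by (cases M rule: mat2_cases; simp)+

lemma minus_family [simp]: "const_mat (- M) = - const_mat M" "twist (- M) = - twist M"
  "at_zero (- N) = - at_zero N"
  by (cases M rule: mat2_cases; simp)+ (cases N rule: mat2_cases; simp)

lemma adj2_family: "adj2 (const_mat M) = const_mat (adj2 M)" "adj2 (twist M) = twist (adj2 M)"
  by (cases M rule: mat2_cases; simp)+

lemma det_family [simp]: "det (const_mat M) = [:det M:]" "det (twist M) = [:det M:]"
proof -
  show *: "det (const_mat M) = [:det M:]" by (cases M rule: mat2_cases) simp
  show "det (twist M) = [:det M:]" unfolding twist_def det_mul * by simp
qed

lemma trace_family [simp]: "trace (const_mat M) = [:trace M:]" "trace (twist M) = [:trace M:]"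
  by (cases M rule: mat2_cases; simp)+

lemma mpow_family: "mpow (const_mat M) n = const_mat (mpow M n)" "mpow (twist M) n = twist (mpow M n)"
  "mpow (at_zero N) n = at_zero (mpow N n)"
  by (induction n; simp add: const_mat_mult twist_mult at_zero_mult)+

lemma sgn_eq_family: "const_mat M \<approx> mat 1 \<longleftrightarrow> M \<approx> mat 1" "twist M \<approx> mat 1 \<longleftrightarrow> M \<approx> mat 1"
proof -
  have "P \<approx> mat 1 \<Longrightarrow> at_zero P \<approx> mat 1" for P :: "'a poly^2^2" by (auto simp: sgn_eq_def)
  from this[of "const_mat M"] this[of "twist M"]
  show "const_mat M \<approx> mat 1 \<longleftrightarrow> M \<approx> mat 1" "twist M \<approx> mat 1 \<longleftrightarrow> M \<approx> mat 1"
    by (auto simp: sgn_eq_def)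
qed

primrec family_prod :: "(('a::idom^2^2) \<times> ('a^2^2)) list \<Rightarrow> 'a poly^2^2" where
  "family_prod [] = mat 1"
| "family_prod (MN # L) = twist (fst MN) ** const_mat (snd MN) ** family_prod L"

text \<open>A factor \<open>twist M ** const_mat N\<close> has an upper left entry of degree two, whose leading coefficient
  is minus the product of the lower left entries of \<open>M\<close> and \<open>N\<close>, and a lower row of degree at most one.
  So no cancellation occurs in a product, and its trace reveals the number of factors.\<close>

lemma family_prod_degrees:
  assumes "L \<noteq> []" "\<forall>(M, N)\<in>set L. M $ 2 $ 1 \<noteq> 0 \<and> N $ 2 $ 1 \<noteq> 0"
  shows "degree (family_prod L $ 1 $ 1) = 2 * length L \<and> degree (family_prod L $ 1 $ 2) \<le> 2 * length L \<and>
    degree (family_prod L $ 2 $ 1) < 2 * length L \<and> degree (family_prod L $ 2 $ 2) < 2 * length L"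
  using assms
proof (induction L rule: list_nonempty_induct)
  case (single MN)
  obtain M N where MN: "MN = (M, N)" by (cases MN)
  obtain p q r s where M: "M = mat2 p q r s" by (rule mat2_cases)
  obtain p' q' r' s' where N: "N = mat2 p' q' r' s'" by (rule mat2_cases)
  show ?case using single by (simp add: MN M N)
next
  case (cons MN L)
  obtain M N where MN: "MN = (M, N)" by (cases MN)
  obtain p q r s where M: "M = mat2 p q r s" by (rule mat2_cases)
  obtain p' q' r' s' where N: "N = mat2 p' q' r' s'" by (rule mat2_cases)
  obtain P Q R S where L: "family_prod L = mat2 P Q R S" by (rule mat2_cases)
  obtain a b c d where F: "twist M ** const_mat N = mat2 a b c d" by (rule mat2_cases)
  have nz: "r \<noteq> 0" "r' \<noteq> 0" using cons.prems by (auto simp: MN M N)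
  have da: "degree a = 2" "degree b \<le> 2" "degree c \<le> 1" "degree d \<le> 1"
    using F nz by (auto simp: M N)
  define n where "n = 2 * length L"
  have n: "n \<ge> 1" using cons.hyps(1) by (cases L) (auto simp: n_def)
  have IH: "degree P = n" "degree Q \<le> n" "degree R < n" "degree S < n"
    using cons by (auto simp: L n_def)
  have a0: "a \<noteq> 0" "P \<noteq> 0" using da IH n by auto
  have aP: "degree (a * P) = n + 2" using a0 da IH by (simp add: degree_mult_eq)
  have le: "degree (x * y) \<le> k + l" if "degree x \<le> k" "degree y \<le> l" for x y :: "'a poly" and k l
    using degree_mult_le[of x y] that by linarith
  have "degree (b * R) < n + 2" using le[of b 2 R "n - 1"] da IH n by linarith
  then have 11: "degree (a * P + b * R) = n + 2" using aP by (simp add: degree_add_eq_left)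
  have 12: "degree (a * Q + b * S) \<le> n + 2"
    using le[of a 2 Q n] le[of b 2 S n] da IH by (intro degree_add_le) linarith+
  have 21: "degree (c * P + d * R) < n + 2"
    using le[of c 1 P n] le[of d 1 R n] da IH by (intro degree_add_less) linarith+
  have 22: "degree (c * Q + d * S) < n + 2"
    using le[of c 1 Q n] le[of d 1 S n] da IH by (intro degree_add_less) linarith+
  show ?case using 11 12 21 22 by (simp add: MN F L n_def)
qed

lemma degree_trace_family_prod:
  assumes "L \<noteq> []" "\<forall>(M, N)\<in>set L. M $ 2 $ 1 \<noteq> 0 \<and> N $ 2 $ 1 \<noteq> 0"
  shows "degree (trace (family_prod L)) = 2 * length L"
proof -
  have "trace (family_prod L) = family_prod L $ 1 $ 1 + family_prod L $ 2 $ 2"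
    by (simp add: trace_def sum_2)
  then show ?thesis using family_prod_degrees[OF assms] by (simp add: degree_add_eq_left)
qed

text \<open>Infinity is not fixed by \<open>X\<close>, hence by none of the non-scalar powers of \<open>X\<close>, as these are linear in \<open>X\<close>.\<close>

lemma mpow_lower_left_nz:
  fixes X :: "'a::idom^2^2"
  assumes "det X = 1" "X $ 2 $ 1 \<noteq> 0" "\<not> mpow X n \<approx> mat 1"
  shows "mpow X n $ 2 $ 1 \<noteq> 0"
proof -
  obtain p q where pq: "mpow X n = mat p ** X + mat q" using mpow_linear'[OF assms(1)] by blast
  have e: "mpow X n $ 2 $ 1 = p * X $ 2 $ 1"
    unfolding pq by (cases X rule: mat2_cases) (simp add: mat_eq_mat2)
  have "p \<noteq> 0"
  proof
    assume "p = 0"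
    then have m: "mpow X n = mat q" using pq by simp
    have "det (mpow X n) = 1" using assms by (simp add: det_mpow)
    then have "q * q = 1" by (simp add: m mat_eq_mat2)
    then have "q = 1 \<or> q = - 1" by (simp add: square_eq_1_iff)
    then show False using assms(3) m by (auto simp: sgn_eq_def mat_eq_mat2)
  qed
  then show ?thesis using e assms by simp
qed

section \<open>Cyclic reduction\<close>

definition conj_sgn :: "'a::comm_ring_1^2^2 \<Rightarrow> 'a^2^2 \<Rightarrow> bool" where
  "conj_sgn M N \<longleftrightarrow> (\<exists>Q. det Q = 1 \<and> Q ** M \<approx> N ** Q)"

lemma conj_sgn_refl: "M \<approx> N \<Longrightarrow> conj_sgn M N"
  unfolding conj_sgn_def by (intro exI[of _ "mat 1"]) simp

lemma conj_sgn_trans: 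
  assumes "conj_sgn M N" "conj_sgn N P"
  shows "conj_sgn M P"
proof -
  obtain Q R where Q: "det Q = 1" "Q ** M \<approx> N ** Q" and R: "det R = 1" "R ** N \<approx> P ** R"
    using assms by (auto simp: conj_sgn_def)
  have "R ** Q ** M \<approx> R ** N ** Q" using sgn_eq_mult[OF sgn_eq_refl[of R] Q(2)] by (simp add: matrix_mul_assoc)
  also have "\<dots> \<approx> P ** (R ** Q)" using sgn_eq_mult[OF R(2) sgn_eq_refl[of Q]] by (simp add: matrix_mul_assoc)
  finally show ?thesis using Q R unfolding conj_sgn_def by (intro exI[of _ "R ** Q"]) (simp add: det_mul)
qed

lemma conj_sgn_rotate: "det M = 1 \<Longrightarrow> conj_sgn (M ** N) (N ** M)"
  unfolding conj_sgn_def
  by (intro exI[of _ "adj2 M"]) (simp add: det_one_adj2 matrix_mul_assoc[symmetric])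

primrec syll_prod :: "'a::comm_ring_1^2^2 \<Rightarrow> 'a^2^2 \<Rightarrow> (nat \<times> nat) list \<Rightarrow> 'a^2^2" where
  "syll_prod V Y [] = mat 1"
| "syll_prod V Y (ij # L) = mpow V (fst ij) ** mpow Y (snd ij) ** syll_prod V Y L"

lemma syll_prod_append: "syll_prod V Y (L @ L') = syll_prod V Y L ** syll_prod V Y L'"
  by (induction L) (simp_all add: matrix_mul_assoc)

lemma det_syll_prod: "det V = 1 \<Longrightarrow> det Y = 1 \<Longrightarrow> det (syll_prod V Y L) = 1"
  by (induction L) (simp_all add: det_mul det_mpow)

abbreviation exp1 :: "(nat \<times> nat) list \<Rightarrow> nat" where "exp1 L \<equiv> sum_list (map fst L)"
abbreviation exp2 :: "(nat \<times> nat) list \<Rightarrow> nat" where "exp2 L \<equiv> sum_list (map snd L)"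

lemma mpow_drop:
  assumes "mpow V i \<approx> mat 1"
  shows "mpow V n \<approx> mpow V (i + n)"
  using sgn_eq_mult[OF sgn_eq_sym[OF assms] sgn_eq_refl[of "mpow V n"]] by (simp add: mpow_add)

text \<open>A syllable with a scalar factor is rotated to the front, which is a conjugation; there the factor
  is dropped and its neighbours are merged. The exponent sums are followed only through the matrix
  powers up to sign, which is what is left of the abelianization of the free product.\<close>

lemma cyclic_reduction:
  fixes V Y :: "'a::comm_ring_1^2^2"
  assumes dV: "det V = 1" and dY: "det Y = 1"
  shows "\<exists>L'. conj_sgn (syll_prod V Y L) (syll_prod V Y L') \<and>
    mpow V (exp1 L') \<approx> mpow V (exp1 L) \<and> mpow Y (exp2 L') \<approx> mpow Y (exp2 L) \<and>
    (length L' \<le> 1 \<or> (\<forall>(i, j)\<in>set L'. \<not> mpow V i \<approx> mat 1 \<and> \<not> mpow Y j \<approx> mat 1))"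
proof (induction L rule: length_induct)
  case (1 L)
  show ?case
  proof (cases "length L \<le> 1 \<or> (\<forall>(i, j)\<in>set L. \<not> mpow V i \<approx> mat 1 \<and> \<not> mpow Y j \<approx> mat 1)")
    case True
    then show ?thesis by (intro exI[of _ L]) (simp add: conj_sgn_refl)
  next
    case False
    then obtain i j where ij: "(i, j) \<in> set L" "mpow V i \<approx> mat 1 \<or> mpow Y j \<approx> mat 1" by blast
    then obtain P R where PR: "L = P @ (i, j) # R" by (meson split_list)
    have "\<not> length L \<le> 1" using False by blast
    then have ne: "R @ P \<noteq> []" unfolding PR by (cases R; cases P) auto
    have rot: "conj_sgn (syll_prod V Y L) (syll_prod V Y ((i, j) # R @ P))"
      using conj_sgn_rotate[OF det_syll_prod[OF dV dY], of P "syll_prod V Y ((i, j) # R)"]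
      unfolding PR syll_prod_append by (simp add: syll_prod_append matrix_mul_assoc)
    have "\<exists>L3. length L3 < length L \<and> conj_sgn (syll_prod V Y ((i, j) # R @ P)) (syll_prod V Y L3) \<and>
      mpow V (exp1 L3) \<approx> mpow V (exp1 L) \<and> mpow Y (exp2 L3) \<approx> mpow Y (exp2 L)"
    proof (cases "mpow Y j \<approx> mat 1")
      case True
      obtain i2 j2 L2 where L2: "R @ P = (i2, j2) # L2" using ne by (cases "R @ P") auto
      have e1: "exp1 (R @ P) = i2 + exp1 L2" and e2: "exp2 (R @ P) = j2 + exp2 L2" unfolding L2 by simp_all
      have "length (R @ P) = Suc (length L2)" unfolding L2 by simp
      have "mpow V i ** mpow Y j ** syll_prod V Y (R @ P) \<approx> mpow V i ** mat 1 ** syll_prod V Y (R @ P)"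
        by (intro sgn_eq_mult True sgn_eq_refl)
      then have "syll_prod V Y ((i, j) # R @ P) \<approx> syll_prod V Y ((i + i2, j2) # L2)"
        by (simp add: L2 mpow_add matrix_mul_assoc)
      moreover have "exp1 ((i + i2, j2) # L2) = exp1 L" "exp2 L = j + exp2 ((i + i2, j2) # L2)"
        using e1 e2 by (simp_all add: PR)
      moreover have "length ((i + i2, j2) # L2) < length L"
        using \<open>length (R @ P) = _\<close> by (simp add: PR)
      ultimately show ?thesis
        using mpow_drop[OF True] by (intro exI[of _ "(i + i2, j2) # L2"]) (simp add: conj_sgn_refl)
    next
      case False
      then have Vi: "mpow V i \<approx> mat 1" using ij by blast
      obtain L2 i2 j2 where L2: "R @ P = L2 @ [(i2, j2)]" using ne by (cases "R @ P" rule: rev_cases) auto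
      have e1: "exp1 (R @ P) = exp1 L2 + i2" and e2: "exp2 (R @ P) = exp2 L2 + j2" unfolding L2 by simp_all
      have len: "length (R @ P) = Suc (length L2)" unfolding L2 by simp
      have "mpow V i ** mpow Y j ** syll_prod V Y (R @ P) \<approx> mat 1 ** mpow Y j ** syll_prod V Y (R @ P)"
        by (intro sgn_eq_mult Vi sgn_eq_refl)
      then have "conj_sgn (syll_prod V Y ((i, j) # R @ P)) (mpow Y j ** syll_prod V Y (R @ P))"
        by (simp add: conj_sgn_refl)
      moreover have "conj_sgn (mpow Y j ** syll_prod V Y (R @ P)) (syll_prod V Y (R @ P) ** mpow Y j)"
        by (rule conj_sgn_rotate) (simp add: dY det_mpow)
      moreover have "syll_prod V Y (R @ P) ** mpow Y j = syll_prod V Y (L2 @ [(i2, j2 + j)])"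
        unfolding L2 by (simp add: syll_prod_append mpow_add matrix_mul_assoc)
      ultimately have "conj_sgn (syll_prod V Y ((i, j) # R @ P)) (syll_prod V Y (L2 @ [(i2, j2 + j)]))"
        using conj_sgn_trans by (metis (no_types))
      moreover have "exp1 L = i + exp1 (L2 @ [(i2, j2 + j)])" "exp2 (L2 @ [(i2, j2 + j)]) = exp2 L"
        using e1 e2 by (simp_all add: PR)
      moreover have "length (L2 @ [(i2, j2 + j)]) < length L"
        using len by (simp add: PR)
      ultimately show ?thesis
        using mpow_drop[OF Vi] by (intro exI[of _ "L2 @ [(i2, j2 + j)]"]) simp
    qed
    then obtain L3 where L3: "length L3 < length L"
      "conj_sgn (syll_prod V Y ((i, j) # R @ P)) (syll_prod V Y L3)"
      "mpow V (exp1 L3) \<approx> mpow V (exp1 L)" "mpow Y (exp2 L3) \<approx> mpow Y (exp2 L)" by blast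
    from 1 L3(1) obtain L' where L': "conj_sgn (syll_prod V Y L3) (syll_prod V Y L')"
      "mpow V (exp1 L') \<approx> mpow V (exp1 L3)" "mpow Y (exp2 L') \<approx> mpow Y (exp2 L3)"
      "length L' \<le> 1 \<or> (\<forall>(i, j)\<in>set L'. \<not> mpow V i \<approx> mat 1 \<and> \<not> mpow Y j \<approx> mat 1)" by blast
    show ?thesis
      using conj_sgn_trans[OF rot conj_sgn_trans[OF L3(2) L'(1)]] L' L3
      by (intro exI[of _ L']) (auto intro: sgn_eq_trans)
  qed
qed

section \<open>Words in a free product of two cyclic groups\<close>

primrec word_val :: "('l \<Rightarrow> 'a::comm_ring_1^2^2) \<Rightarrow> 'l list \<Rightarrow> 'a^2^2" where
  "word_val h [] = mat 1"
| "word_val h (l # w) = h l ** word_val h w"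

definition letter :: "'a::comm_ring_1^2^2 \<Rightarrow> 'a^2^2 \<Rightarrow> int + int \<Rightarrow> 'a^2^2" where
  "letter X Y = case_sum (\<lambda>i. mpow X (nat i)) (\<lambda>j. mpow Y (nat j))"

lemma letter_simps [simp]: "letter X Y (Inl i) = mpow X (nat i)" "letter X Y (Inr j) = mpow Y (nat j)"
  by (simp_all add: letter_def)

lemma word_val_append: "word_val h (u @ w) = word_val h u ** word_val h w"
  by (induction u) (simp_all add: matrix_mul_assoc)

lemma det_word_val: "det X = 1 \<Longrightarrow> det Y = 1 \<Longrightarrow> det (word_val (letter X Y) w) = 1"
proof (induction w)
  case (Cons l w)
  then show ?case by (cases l) (simp_all add: det_mul det_mpow)
qed simp

lemma carrier_C: "n > 0 \<Longrightarrow> carrier (C n) = {0..<int n}"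
  and one_C: "n > 0 \<Longrightarrow> \<one>\<^bsub>C n\<^esub> = 0"
  and mult_C: "n > 0 \<Longrightarrow> i \<otimes>\<^bsub>C n\<^esub> j = (i + j) mod int n"
  by (simp_all add: integer_mod_group_def)

lemma mpow_C_mult:
  assumes "n > 0" "mpow X n \<approx> mat 1" "i \<in> carrier (C n)" "j \<in> carrier (C n)"
  shows "mpow X (nat i) ** mpow X (nat j) \<approx> mpow X (nat (i \<otimes>\<^bsub>C n\<^esub> j))"
proof -
  have "nat ((i + j) mod int n) = (nat i + nat j) mod n"
    using assms by (simp add: carrier_C nat_mod_distrib nat_add_distrib)
  then show ?thesis
    using sgn_eq_sym[OF mpow_mod[OF assms(2), of "nat i + nat j"]] assms(1)
    by (simp add: mult_C mpow_add)
qed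

lemma word_val_fp_rel:
  assumes "(u, v) \<in> fp_rel (C a) (C b)" "a > 0" "b > 0" "mpow X a \<approx> mat 1" "mpow Y b \<approx> mat 1"
  shows "word_val (letter X Y) u \<approx> word_val (letter X Y) v"
  using assms(1)
proof (induction rule: fp_rel.induct)
  case (sym u v) then show ?case using sgn_eq_sym by blast
next
  case (trans u v w) then show ?case by (metis sgn_eq_trans)
next
  case (append u u' v v') then show ?case by (simp add: word_val_append sgn_eq_mult)
next
  case (mult_left i j)
  then show ?case using mpow_C_mult[of a X i j] assms by simp
next
  case (mult_right i j)
  then show ?case using mpow_C_mult[of b Y i j] assms by simp
qed (use assms in \<open>simp_all add: one_C\<close>)

text \<open>A word is read as a product of syllables \<open>X\<^sup>i Y\<^sup>j\<close> in which one of the exponents is zero.\<close>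

definition syllables :: "(int + int) list \<Rightarrow> (nat \<times> nat) list" where
  "syllables w = map (case_sum (\<lambda>i. (nat i, 0)) (\<lambda>j. (0, nat j))) w"

lemma syll_prod_syllables: "syll_prod X Y (syllables w) = word_val (letter X Y) w"
proof (induction w)
  case (Cons l w)
  then show ?case by (cases l) (simp_all add: syllables_def)
qed (simp add: syllables_def)

lemma exp_syllables:
  "mpow X (exp1 (syllables w)) = word_val (letter X (mat 1)) w"
  "mpow Y (exp2 (syllables w)) = word_val (letter (mat 1) Y) w"
proof (induction w)
  case (Cons l w)
  { case 1 then show ?case using Cons by (cases l) (simp_all add: syllables_def mpow_add) next
    case 2 then show ?case using Cons by (cases l) (simp_all add: syllables_def mpow_add) }
qed (simp_all add: syllables_def)

lemma exp_syllables_append: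
  "exp1 (syllables (u @ w)) = exp1 (syllables u) + exp1 (syllables w)"
  "exp2 (syllables (u @ w)) = exp2 (syllables u) + exp2 (syllables w)"
  by (simp_all add: syllables_def)

context
  fixes a b :: nat assumes a: "a > 0" and b: "b > 0"
begin

abbreviation "FP \<equiv> free_product (C a) (C b)"
abbreviation "cls u \<equiv> fp_rel (C a) (C b) `` {u}"

lemma carrier_FP: "carrier FP = {cls u | u. u \<in> fp_words (C a) (C b)}"
  by (auto simp: free_product_def quotient_def)

lemma group_FP: "group FP"
  by (rule group_free_product) simp_all

lemma cls_mult: "u \<in> fp_words (C a) (C b) \<Longrightarrow> v \<in> fp_words (C a) (C b) \<Longrightarrow> cls u \<otimes>\<^bsub>FP\<^esub> cls v = cls (u @ v)"
  by (rule fp_mult_class) simp_all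

lemma cls_eqD: "u \<in> fp_words (C a) (C b) \<Longrightarrow> v \<in> fp_words (C a) (C b) \<Longrightarrow> cls u = cls v \<Longrightarrow>
  (u, v) \<in> fp_rel (C a) (C b)"
  using fp_class_eq_iff[of "C a" "C b" u v] by simp

lemma one_FP: "\<one>\<^bsub>FP\<^esub> = cls []"
  by (simp add: free_product_def)

lemma carrierE_FP:
  assumes "g \<in> carrier FP" obtains u where "u \<in> fp_words (C a) (C b)" "g = cls u"
  using assms by (auto simp: carrier_FP)

text \<open>The inverses that occur in the generated subgroup are adjugates up to sign, hence linear, so
  every word evaluates into the algebra spanned by the values of a generating pair.\<close>

lemma word_val_stab4:
  fixes X Y :: "'a::idom^2^2"
  assumes X: "mpow X a \<approx> mat 1" "det X = 1" and Y: "mpow Y b \<approx> mat 1" "det Y = 1"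
    and u1: "u1 \<in> fp_words (C a) (C b)" and u2: "u2 \<in> fp_words (C a) (C b)"
    and gen: "generate FP {cls u1, cls u2} = carrier FP"
    and w: "w \<in> fp_words (C a) (C b)"
  shows "word_val (letter X Y) w \<in> stab4 (word_val (letter X Y) u1) (word_val (letter X Y) u2)"
    (is "?v w \<in> ?S")
proof -
  interpret group FP by (rule group_FP)
  have rel: "?v u \<approx> ?v v" if "(u, v) \<in> fp_rel (C a) (C b)" for u v
    using word_val_fp_rel[OF that a b X(1) Y(1)] .
  have "\<forall>u\<in>fp_words (C a) (C b). g = cls u \<longrightarrow> ?v u \<in> ?S" if "g \<in> generate FP {cls u1, cls u2}" for g
    using that
  proof (induction rule: generate.induct)
    case one
    show ?case
    proof (intro ballI impI)
      fix u assume u: "u \<in> fp_words (C a) (C b)" "\<one>\<^bsub>FP\<^esub> = cls u"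
      then have "(u, []) \<in> fp_rel (C a) (C b)" by (intro cls_eqD) (simp_all add: one_FP)
      then show "?v u \<in> ?S" using rel[of u "[]"] stab4_mat stab4_sgn by fastforce
    qed
  next
    case (incl h)
    show ?case
    proof (intro ballI impI)
      fix u assume u: "u \<in> fp_words (C a) (C b)" "h = cls u"
      then have "(u, u1) \<in> fp_rel (C a) (C b) \<or> (u, u2) \<in> fp_rel (C a) (C b)"
        using incl cls_eqD u1 u2 by auto
      then show "?v u \<in> ?S" using rel stab4_A stab4_B stab4_sgn by blast
    qed
  next
    case (inv h)
    show ?case
    proof (intro ballI impI)
      fix u assume u: "u \<in> fp_words (C a) (C b)" "inv\<^bsub>FP\<^esub> h = cls u"
      obtain u' where u': "u' \<in> {u1, u2}" "h = cls u'" using inv by blast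
      then have u'w: "u' \<in> fp_words (C a) (C b)" using u1 u2 by auto
      have "h \<in> carrier FP" using u' u'w by (auto simp: carrier_FP)
      then have "cls u \<otimes>\<^bsub>FP\<^esub> cls u' = \<one>\<^bsub>FP\<^esub>" using u(2) u'(2) l_inv by metis
      then have "(u @ u', []) \<in> fp_rel (C a) (C b)"
        using u u'w by (intro cls_eqD) (simp_all add: one_FP cls_mult)
      then have "?v u ** ?v u' \<approx> mat 1" using rel[of "u @ u'" "[]"] by (simp add: word_val_append)
      then have "?v u ** ?v u' ** adj2 (?v u') \<approx> mat 1 ** adj2 (?v u')" by (intro sgn_eq_mult) simp_all
      then have e: "?v u \<approx> adj2 (?v u')"
        using det_word_val[OF X(2) Y(2)] by (simp add: matrix_mul_assoc[symmetric] det_one_adj2)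
      have "?v u' \<in> ?S" using u'(1) stab4_A stab4_B by blast
      then show "?v u \<in> ?S" using stab4_sgn[OF e] stab4_adj2 by blast
    qed
  next
    case (eng g h)
    show ?case
    proof (intro ballI impI)
      fix u assume u: "u \<in> fp_words (C a) (C b)" "g \<otimes>\<^bsub>FP\<^esub> h = cls u"
      have "g \<in> carrier FP" "h \<in> carrier FP" using eng.hyps gen by auto
      then obtain v w where vw: "v \<in> fp_words (C a) (C b)" "g = cls v" "w \<in> fp_words (C a) (C b)" "h = cls w"
        by (metis carrierE_FP)
      then have "(u, v @ w) \<in> fp_rel (C a) (C b)" using u by (intro cls_eqD) (simp_all add: cls_mult)
      then have "?v u \<approx> ?v v ** ?v w" using rel word_val_append by metis
      then show "?v u \<in> ?S" using stab4_sgn stab4_mult eng.IH vw by blast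
    qed
  qed
  then show ?thesis using w gen carrier_FP by blast
qed

lemma word_val_stab4_letters:
  fixes X Y :: "'a::idom^2^2"
  shows "word_val (letter X Y) w \<in> stab4 X Y"
proof (induction w)
  case (Cons l w)
  then show ?case by (cases l) (simp_all add: stab4_mult stab4_mpow stab4_A stab4_B)
qed (simp add: stab4_mat)

lemma inverse_word:
  assumes "u \<in> fp_words (C a) (C b)"
  obtains v where "v \<in> fp_words (C a) (C b)" "(v @ u, []) \<in> fp_rel (C a) (C b)"
  using fp_inv_ex[of "C a" "C b" u] assms by auto

lemma word_val_at_zero:
  fixes X Y :: "'a::idom^2^2"
  shows "at_zero (word_val (letter (twist X) (const_mat Y)) w) = word_val (letter X Y) w"
proof (induction w)
  case (Cons l w)
  then show ?case by (cases l) (simp_all add: at_zero_mult mpow_family)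
qed simp

lemma family_prod_syll:
  "family_prod (map (\<lambda>(i, j). (mpow X i, mpow Y j)) L) = syll_prod (twist X) (const_mat Y) L"
  by (induction L) (auto simp: mpow_family)

text \<open>Over the polynomial ring the two factors are in general position, and the reasoning of Grushko's
  theorem becomes linear algebra. The values \<open>A\<close>, \<open>B\<close> of a generating pair span the same algebra as
  the values \<open>V\<close>, \<open>Z\<close> of the two canonical generators, so the discriminants \<open>\<delta> A B = 2 - tr [A, B]\<close> and \<open>\<delta> V Z\<close> divide each other and \<open>tr [A, B]\<close> has the degree four of
  \<open>tr [V, Z]\<close>. After cyclic reduction \<open>[A, B]\<close> therefore consists of exactly two syllables \<open>V\<^sup>i Z\<^sup>j\<close>, and since its
  exponent sums vanish it is \<open>[V\<^sup>i, Z\<^sup>j]\<close> up to conjugation and sign. The sign is right because otherwise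
  \<open>\<delta> V Z\<close> would divide the constant four.\<close>

lemma commutator_of_generating_pair_general_position:
  fixes X Y :: "'a::field^2^2"
  assumes X: "mpow X a \<approx> mat 1" "det X = 1" "\<not> X \<approx> mat 1" "X $ 2 $ 1 \<noteq> 0"
    and Y: "mpow Y b \<approx> mat 1" "det Y = 1" "\<not> Y \<approx> mat 1" "Y $ 2 $ 1 \<noteq> 0"
    and u1: "u1 \<in> fp_words (C a) (C b)" and u2: "u2 \<in> fp_words (C a) (C b)"
    and gen: "generate FP {cls u1, cls u2} = carrier FP"
  shows "\<exists>i j Q. \<not> mpow X i \<approx> mat 1 \<and> \<not> mpow Y j \<approx> mat 1 \<and> det Q = 1 \<and>
    Q ** comm2 (word_val (letter X Y) u1) (word_val (letter X Y) u2) =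
    comm2 (mpow X i) (mpow Y j) ** Q"
proof -
  define V where "V = twist X"
  define Z where "Z = const_mat Y"
  have VZ: "mpow V a \<approx> mat 1" "det V = 1" "mpow Z b \<approx> mat 1" "det Z = 1"
    using X Y by (simp_all add: V_def Z_def mpow_family sgn_eq_family)
  define A where "A = word_val (letter V Z) u1"
  define B where "B = word_val (letter V Z) u2"
  have dAB: "det A = 1" "det B = 1" using VZ by (simp_all add: A_def B_def det_word_val)
  define \<delta> where "\<delta> M N = det (M ** N - N ** M)" for M N :: "'a poly^2^2"
  have tr: "trace (comm2 M N) = 2 - \<delta> M N" if "det M = 1" "det N = 1" for M N
    using trace_comm2[OF that] by (simp add: \<delta>_def)
  have a1: "a > 1" using X a by (cases "a = 1") auto
  have b1: "b > 1" using Y b by (cases "b = 1") auto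
  have "V \<in> stab4 A B"
    using word_val_stab4[OF VZ u1 u2 gen, of "[Inl 1]"] a1 by (simp add: A_def B_def carrier_C)
  moreover have "Z \<in> stab4 A B"
    using word_val_stab4[OF VZ u1 u2 gen, of "[Inr 1]"] b1 by (simp add: A_def B_def carrier_C)
  ultimately have dvd1: "\<delta> A B dvd \<delta> V Z"
    unfolding \<delta>_def by (intro det_commutator_dvd stab4_subset_span4)
  have dvd2: "\<delta> V Z dvd \<delta> A B"
    unfolding \<delta>_def A_def B_def by (intro det_commutator_dvd stab4_subset_span4 word_val_stab4_letters)
  have deg2: "degree (2 - p) = degree p" for p :: "'a poly"
  proof -
    have c: "degree (2 :: 'a poly) = 0" by (metis degree_numeral)
    show ?thesis
    proof (cases "degree p > 0")
      case True
      then have "degree (- p + 2) = degree (- p)" using c by (intro degree_add_eq_left) simp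
      then show ?thesis by simp
    next
      case False
      then show ?thesis using degree_diff_le[of 2 0 p] c by simp
    qed
  qed
  have lower: "mpow X i $ 2 $ 1 \<noteq> 0" if "\<not> mpow X i \<approx> mat 1" for i
    using mpow_lower_left_nz X that by blast
  have lowerY: "mpow Y i $ 2 $ 1 \<noteq> 0" if "\<not> mpow Y i \<approx> mat 1" for i
    using mpow_lower_left_nz Y that by blast
  have "comm2 V Z = family_prod [(X, Y), (adj2 X, adj2 Y)]"
    by (simp add: comm2_def V_def Z_def adj2_family matrix_mul_assoc)
  moreover have "degree (trace (family_prod [(X, Y), (adj2 X, adj2 Y)])) = 4"
    using degree_trace_family_prod[of "[(X, Y), (adj2 X, adj2 Y)]"] X(4) Y(4) by (simp add: adj2_def)
  ultimately have "degree (2 - \<delta> V Z) = 4" using tr VZ by metis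
  then have degVZ: "degree (\<delta> V Z) = 4" using deg2[of "\<delta> V Z"] by simp
  then have nzVZ: "\<delta> V Z \<noteq> 0" by auto
  then have nzAB: "\<delta> A B \<noteq> 0" using dvd1 by auto
  have degAB: "degree (\<delta> A B) = 4"
    using dvd_imp_degree_le[OF dvd1 nzVZ] dvd_imp_degree_le[OF dvd2 nzAB] degVZ by simp
  then have degtr: "degree (trace (comm2 A B)) = 4" using tr dAB deg2[of "\<delta> A B"] by simp

  obtain v1 where v1: "v1 \<in> fp_words (C a) (C b)" "(v1 @ u1, []) \<in> fp_rel (C a) (C b)"
    by (rule inverse_word[OF u1])
  obtain v2 where v2: "v2 \<in> fp_words (C a) (C b)" "(v2 @ u2, []) \<in> fp_rel (C a) (C b)"
    by (rule inverse_word[OF u2])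
  have val_inv: "word_val (letter V Z) v \<approx> adj2 (word_val (letter V Z) u)"
    if "(v @ u, []) \<in> fp_rel (C a) (C b)" for u v
  proof -
    have "word_val (letter V Z) v ** word_val (letter V Z) u \<approx> mat 1"
      using word_val_fp_rel[OF that a b VZ(1,3)] by (simp add: word_val_append)
    then have "word_val (letter V Z) v ** word_val (letter V Z) u ** adj2 (word_val (letter V Z) u)
        \<approx> mat 1 ** adj2 (word_val (letter V Z) u)" by (intro sgn_eq_mult) simp_all
    then show ?thesis
      using det_word_val[OF VZ(2,4)] by (simp add: matrix_mul_assoc[symmetric] det_one_adj2)
  qed
  define L where "L = syllables (u1 @ u2 @ v1 @ v2)"
  have "syll_prod V Z L = A ** (B ** (word_val (letter V Z) v1 ** word_val (letter V Z) v2))"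
    by (simp add: L_def syll_prod_syllables word_val_append A_def B_def)
  also have "\<dots> \<approx> A ** (B ** (adj2 A ** adj2 B))"
    unfolding A_def B_def by (intro sgn_eq_mult sgn_eq_refl val_inv v1 v2)
  finally have L: "syll_prod V Z L \<approx> comm2 A B" by (simp add: comm2_def matrix_mul_assoc)
  have sumV: "mpow V (exp1 L) \<approx> mat 1"
  proof -
    have *: "mpow V (exp1 (syllables w)) \<approx> mat 1" if "(w, []) \<in> fp_rel (C a) (C b)" for w
      using word_val_fp_rel[OF that a b, of V "mat 1"] VZ by (simp add: exp_syllables)
    have "mpow V (exp1 L) = mpow V (exp1 (syllables (v1 @ u1)) + exp1 (syllables (v2 @ u2)))"
      by (simp add: L_def exp_syllables_append add_ac)
    then show ?thesis using sgn_eq_mult[OF *[OF v1(2)] *[OF v2(2)]] by (simp add: mpow_add)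
  qed
  have sumZ: "mpow Z (exp2 L) \<approx> mat 1"
  proof -
    have *: "mpow Z (exp2 (syllables w)) \<approx> mat 1" if "(w, []) \<in> fp_rel (C a) (C b)" for w
      using word_val_fp_rel[OF that a b, of "mat 1" Z] VZ by (simp add: exp_syllables)
    have "mpow Z (exp2 L) = mpow Z (exp2 (syllables (v1 @ u1)) + exp2 (syllables (v2 @ u2)))"
      by (simp add: L_def exp_syllables_append add_ac)
    then show ?thesis using sgn_eq_mult[OF *[OF v1(2)] *[OF v2(2)]] by (simp add: mpow_add)
  qed
  obtain L' where L': "conj_sgn (syll_prod V Z L) (syll_prod V Z L')"
    "mpow V (exp1 L') \<approx> mpow V (exp1 L)" "mpow Z (exp2 L') \<approx> mpow Z (exp2 L)"
    "length L' \<le> 1 \<or> (\<forall>(i, j)\<in>set L'. \<not> mpow V i \<approx> mat 1 \<and> \<not> mpow Z j \<approx> mat 1)"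
    using cyclic_reduction[OF VZ(2,4), of L] by blast
  have cs: "conj_sgn (comm2 A B) (syll_prod V Z L')"
    using conj_sgn_trans[OF conj_sgn_refl[OF sgn_eq_sym[OF L]] L'(1)] .
  then obtain Q where Q: "det Q = 1" "Q ** comm2 A B \<approx> syll_prod V Z L' ** Q" by (auto simp: conj_sgn_def)
  have trQ: "trace (comm2 A B) = trace M \<or> trace (comm2 A B) = - trace M"
    if "Q ** comm2 A B \<approx> M ** Q" for M
    using that trace_conj[of Q "comm2 A B" M] trace_conj[of Q "comm2 A B" "- M"] Q(1)
    by (auto simp: sgn_eq_def)
  have degL': "degree (trace (syll_prod V Z L')) = 4"
    using trQ[OF Q(2)] degtr by auto
  have deg_good: "degree (trace (syll_prod V Z L')) = 2 * length L'"
    if "L' \<noteq> []" "\<forall>(i, j)\<in>set L'. \<not> mpow V i \<approx> mat 1 \<and> \<not> mpow Z j \<approx> mat 1"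
  proof -
    have "\<forall>(M, N)\<in>set (map (\<lambda>(i, j). (mpow X i, mpow Y j)) L'). M $ 2 $ 1 \<noteq> 0 \<and> N $ 2 $ 1 \<noteq> 0"
      using that(2) lower lowerY by (auto simp: V_def Z_def mpow_family sgn_eq_family)
    then show ?thesis
      using degree_trace_family_prod[of "map (\<lambda>(i, j). (mpow X i, mpow Y j)) L'"] that(1)
      by (simp add: family_prod_syll V_def Z_def)
  qed
  have good: "\<forall>(i, j)\<in>set L'. \<not> mpow V i \<approx> mat 1 \<and> \<not> mpow Z j \<approx> mat 1"
  proof (rule ccontr)
    assume bad: "\<not> ?thesis"
    then have "length L' \<le> 1" "L' \<noteq> []" using L'(4) by auto
    then obtain i j where ij: "L' = [(i, j)]" by (cases L') auto
    then have "mpow V i \<approx> mat 1 \<or> mpow Z j \<approx> mat 1" using bad by auto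
    then have "degree (trace (syll_prod V Z L')) = 0"
    proof
      assume "mpow V i \<approx> mat 1"
      then have "syll_prod V Z L' = mpow Z j \<or> syll_prod V Z L' = - mpow Z j"
        by (auto simp: ij sgn_eq_def)
      then show ?thesis by (auto simp: Z_def mpow_family)
    next
      assume "mpow Z j \<approx> mat 1"
      then have "syll_prod V Z L' = mpow V i \<or> syll_prod V Z L' = - mpow V i"
        by (auto simp: ij sgn_eq_def)
      then show ?thesis by (auto simp: V_def mpow_family)
    qed
    then show False using degL' by simp
  qed
  have "L' \<noteq> []" using degL' by (cases L') (auto simp: trace_I)
  then have "length L' = 2" using deg_good good degL' by simp
  then obtain i j i2 j2 where ij: "L' = [(i, j), (i2, j2)]"
    by (cases L'; cases "tl L'") auto
  have nsc: "\<not> mpow X i \<approx> mat 1" "\<not> mpow Y j \<approx> mat 1"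
    using good by (simp_all add: ij V_def Z_def mpow_family sgn_eq_family)
  have "mpow V (i + i2) \<approx> mat 1" using sgn_eq_trans[OF L'(2) sumV] by (simp add: ij)
  then have i2: "mpow V i2 \<approx> adj2 (mpow V i)" using mpow_inverse VZ by blast
  have "mpow Z (j + j2) \<approx> mat 1" using sgn_eq_trans[OF L'(3) sumZ] by (simp add: ij)
  then have j2: "mpow Z j2 \<approx> adj2 (mpow Z j)" using mpow_inverse VZ by blast
  have "syll_prod V Z L' = mpow V i ** mpow Z j ** mpow V i2 ** mpow Z j2"
    by (simp add: ij matrix_mul_assoc)
  also have "\<dots> \<approx> comm2 (mpow V i) (mpow Z j)"
    unfolding comm2_def by (intro sgn_eq_mult sgn_eq_refl i2 j2)
  finally have "syll_prod V Z L' ** Q \<approx> comm2 (mpow V i) (mpow Z j) ** Q"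
    by (intro sgn_eq_mult sgn_eq_refl)
  then have Qc: "Q ** comm2 A B \<approx> comm2 (mpow V i) (mpow Z j) ** Q"
    using sgn_eq_trans[OF Q(2)] by blast
  have Qe: "Q ** comm2 A B = comm2 (mpow V i) (mpow Z j) ** Q"
  proof (rule ccontr)
    assume ne: "\<not> ?thesis"
    then have neg: "Q ** comm2 A B = - comm2 (mpow V i) (mpow Z j) ** Q"
      using Qc by (simp add: sgn_eq_def)
    then have "trace (comm2 A B) = - trace (comm2 (mpow V i) (mpow Z j))"
      using trace_conj[of Q "comm2 A B" "- comm2 (mpow V i) (mpow Z j)"] Q(1) by simp
    then have "2 - \<delta> A B = - (2 - \<delta> (mpow V i) (mpow Z j))"
      using tr dAB VZ by (simp add: det_mpow)
    then have "\<delta> A B + \<delta> (mpow V i) (mpow Z j) = 4" by (simp add: algebra_simps)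
    moreover have "\<delta> V Z dvd \<delta> (mpow V i) (mpow Z j)"
      unfolding \<delta>_def by (intro det_commutator_dvd stab4_subset_span4 stab4_mpow stab4_A stab4_B)
    ultimately have "\<delta> V Z dvd 4" using dvd2 dvd_add by metis
    moreover have "degree (4 :: 'a poly) = 0" by (metis degree_numeral)
    ultimately have "(4 :: 'a poly) = 0" using dvd_imp_degree_le[of "\<delta> V Z" 4] degVZ by fastforce
    then have "(2 :: 'a poly) * 2 = 0" by simp
    \<comment> \<open>In characteristic two the sign is invisible.\<close>
    then have two: "(2 :: 'a poly) = 0" by (metis mult_eq_0_iff)
    have "- M = M" for M :: "'a poly^2^2"
    proof (cases M rule: mat2_cases)
      case (1 p q r s)
      have "- x = x" for x :: "'a poly" using two by (rule minus_char_2)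
      then show ?thesis by (simp add: 1)
    qed
    then show False using neg ne by simp
  qed
  have "at_zero Q ** comm2 (at_zero A) (at_zero B) = comm2 (mpow X i) (mpow Y j) ** at_zero Q"
    using arg_cong[OF Qe, of at_zero]
    by (simp add: comm2_def at_zero_mult at_zero_adj2 V_def Z_def mpow_family[symmetric] mpow_family(3)[symmetric])
  moreover have "at_zero A = word_val (letter X Y) u1" "at_zero B = word_val (letter X Y) u2"
    by (simp_all add: A_def B_def V_def Z_def word_val_at_zero)
  moreover have "det (at_zero Q) = 1" using Q by (simp add: det_at_zero)
  ultimately show ?thesis using nsc by metis
qed

end

section \<open>Commutators of generating pairs\<close>

text \<open>The matrix \<open>P\<close> moves infinity to a point that is fixed by neither matrix. Fixed points other than infinity are roots of a nonzero
  polynomial of degree at most two for each matrix, and of degree at most one for a matrix that fixes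
  infinity.\<close>

lemma common_non_fixed_point:
  fixes X Y :: "'a::{field,finite}^2^2"
  assumes X: "det X = 1" "\<not> X \<approx> mat 1" and Y: "det Y = 1" "\<not> Y \<approx> mat 1" and q: "CARD('a) \<ge> 4"
  shows "\<exists>P. det P = 1 \<and> (adj2 P ** X ** P) $ 2 $ 1 \<noteq> 0 \<and> (adj2 P ** Y ** P) $ 2 $ 1 \<noteq> 0"
proof (cases "X $ 2 $ 1 \<noteq> 0 \<and> Y $ 2 $ 1 \<noteq> 0")
  case True
  then show ?thesis by (intro exI[of _ "mat 1"]) simp
next
  case False
  define f where "f M = [:- (M $ 1 $ 2), M $ 2 $ 2 - M $ 1 $ 1, M $ 2 $ 1:]" for M :: "'a^2^2"
  have nz: "f M \<noteq> 0" if M: "det M = 1" "\<not> M \<approx> mat 1" for M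
  proof
    assume "f M = 0"
    moreover obtain p q r s where M2: "M = mat2 p q r s" by (rule mat2_cases)
    ultimately have e: "q = 0" "r = 0" "s = p" by (simp_all add: f_def)
    then have "p * p = 1" using M by (simp add: M2)
    then have "p = 1 \<or> p = - 1" by (simp add: square_eq_1_iff)
    then show False using M e by (auto simp: M2 mat_eq_mat2 sgn_eq_def)
  qed
  have d2: "degree (f M) \<le> 2" for M by (simp add: f_def)
  have d1: "degree (f M) \<le> 1" if "M $ 2 $ 1 = 0" for M using that by (simp add: f_def)
  have "degree (f X) + degree (f Y) \<le> 3" using False d1[of X] d1[of Y] d2[of X] d2[of Y] by linarith
  then have "degree (f X * f Y) \<le> 3" using nz X Y by (simp add: degree_mult_eq)
  moreover have "f X * f Y \<noteq> 0" using nz X Y by simp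
  ultimately have "card {z. poly (f X * f Y) z = 0} \<le> 3"
    using card_poly_roots_bound[of "f X * f Y"] by linarith
  then have "{z. poly (f X * f Y) z = 0} \<noteq> UNIV" using q by auto
  then obtain z where z: "poly (f X) z \<noteq> 0" "poly (f Y) z \<noteq> 0" by auto
  \<comment> \<open>The matrix \<open>(z, -1; 1, 0)\<close> takes infinity to \<open>z\<close>.\<close>
  have e: "(adj2 (mat2 z (- 1) 1 0) ** M ** mat2 z (- 1) 1 0) $ 2 $ 1 = poly (f M) z" for M
    by (cases M rule: mat2_cases) (simp add: f_def algebra_simps)
  show ?thesis
    by (rule exI[of _ "mat2 z (- 1) 1 0"]) (use z in \<open>simp only: e, simp\<close>)
qed

lemma conj_mult:
  assumes "det P = 1"
  shows "(adj2 P ** M ** P) ** (adj2 P ** N ** P) = adj2 P ** (M ** N) ** P"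
  using assms by (simp add: matrix_mul_assoc[symmetric] det_one_adj2)

lemma conj_mpow:
  assumes "det P = 1"
  shows "mpow (adj2 P ** M ** P) n = adj2 P ** mpow M n ** P"
proof (induction n)
  case 0 then show ?case using assms by (simp add: det_one_adj2)
next
  case (Suc n)
  then show ?case by (simp add: conj_mult[OF assms])
qed

lemma conj_word_val:
  assumes "det P = 1"
  shows "word_val (letter (adj2 P ** X ** P) (adj2 P ** Y ** P)) w = adj2 P ** word_val (letter X Y) w ** P"
proof (induction w)
  case Nil then show ?case using assms by (simp add: det_one_adj2)
next
  case (Cons l w)
  then show ?case by (cases l) (simp_all add: conj_mpow[OF assms] conj_mult[OF assms])
qed

lemma conj_comm2:
  assumes "det P = 1"
  shows "comm2 (adj2 P ** M ** P) (adj2 P ** N ** P) = adj2 P ** comm2 M N ** P"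
proof -
  have "adj2 (adj2 P ** M ** P) = adj2 P ** adj2 M ** P" for M
    by (simp add: adj2_mult matrix_mul_assoc)
  then show ?thesis by (simp add: comm2_def conj_mult[OF assms])
qed

lemma conj_sgn_one:
  assumes "det P = 1"
  shows "adj2 P ** M ** P \<approx> mat 1 \<longleftrightarrow> M \<approx> mat 1"
proof
  assume "adj2 P ** M ** P \<approx> mat 1"
  then have "P ** (adj2 P ** M ** P) ** adj2 P \<approx> P ** mat 1 ** adj2 P"
    by (intro sgn_eq_mult) simp_all
  then show "M \<approx> mat 1" using assms by (simp add: matrix_mul_assoc[symmetric] det_one_adj2)
next
  assume "M \<approx> mat 1"
  then have "adj2 P ** M ** P \<approx> adj2 P ** mat 1 ** P"
    by (intro sgn_eq_mult) simp_all
  then show "adj2 P ** M ** P \<approx> mat 1" using assms by (simp add: det_one_adj2)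
qed

lemma word_val_powers:
  assumes "\<And>l. \<exists>n. h l \<approx> mpow Z n"
  shows "\<exists>n. word_val h w \<approx> mpow Z n"
proof (induction w)
  case Nil show ?case by (intro exI[of _ 0]) simp
next
  case (Cons l w)
  then obtain n where "word_val h w \<approx> mpow Z n" by blast
  moreover obtain m where "h l \<approx> mpow Z m" using assms by blast
  ultimately have "word_val h (l # w) \<approx> mpow Z (m + n)" by (simp add: mpow_add sgn_eq_mult)
  then show ?case by blast
qed

lemma letter_powers:
  assumes "X \<approx> mat 1"
  shows "\<exists>n. letter X Y l \<approx> mpow Y n" "\<exists>n. letter Y X l \<approx> mpow Y n"
proof -
  have X: "mpow X i \<approx> mpow Y 0" for i using sgn_eq_mpow[OF assms, of i] by simp
  show "\<exists>n. letter X Y l \<approx> mpow Y n" "\<exists>n. letter Y X l \<approx> mpow Y n"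
    using X sgn_eq_refl by (cases l; simp only: letter_simps; blast)+
qed

lemma comm2_powers:
  assumes "A \<approx> mpow Y m" "B \<approx> mpow Y n" "det Y = 1"
  shows "comm2 A B = mat 1"
proof -
  have "comm2 A B = comm2 (mpow Y m) (mpow Y n)" by (rule comm2_sgn[OF assms(1,2)])
  also have "\<dots> = mpow Y n ** mpow Y m ** adj2 (mpow Y m) ** adj2 (mpow Y n)"
    unfolding comm2_def by (simp only: mpow_commute)
  also have "\<dots> = mat 1" using assms(3)
    by (simp add: matrix_mul_assoc[symmetric] det_one_adj2 det_mpow)
  finally show ?thesis .
qed

text \<open>A point fixed by neither matrix is moved to infinity by a conjugation, which puts the pair into
  general position.\<close>

theorem commutator_of_generating_pair:
  fixes X Y :: "'a::{field,finite}^2^2"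
  assumes ab: "a > 0" "b > 0" and q: "CARD('a) \<ge> 4"
    and X: "mpow X a \<approx> mat 1" "det X = 1" and Y: "mpow Y b \<approx> mat 1" "det Y = 1"
    and u1: "u1 \<in> fp_words (C a) (C b)" and u2: "u2 \<in> fp_words (C a) (C b)"
    and gen: "generate (free_product (C a) (C b))
      {fp_rel (C a) (C b) `` {u1}, fp_rel (C a) (C b) `` {u2}} = carrier (free_product (C a) (C b))"
    and nontriv: "comm2 (word_val (letter X Y) u1) (word_val (letter X Y) u2) \<noteq> mat 1"
  shows "\<exists>i j Q. \<not> mpow X i \<approx> mat 1 \<and> \<not> mpow Y j \<approx> mat 1 \<and> det Q = 1 \<and>
    Q ** comm2 (word_val (letter X Y) u1) (word_val (letter X Y) u2) =
    comm2 (mpow X i) (mpow Y j) ** Q"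
proof -
  \<comment> \<open>If a factor acted by scalars, all words would evaluate to powers of one matrix.\<close>
  have cyc: False if "det Z = 1" "\<And>l. \<exists>n. letter X Y l \<approx> mpow Z n" for Z
    using word_val_powers[where h="letter X Y" and Z=Z and w=u1, OF that(2)]
      word_val_powers[where h="letter X Y" and Z=Z and w=u2, OF that(2)]
      comm2_powers[OF _ _ that(1)] nontriv by blast
  have nX: "\<not> X \<approx> mat 1" using cyc[OF Y(2)] letter_powers(1) by blast
  have nY: "\<not> Y \<approx> mat 1" using cyc[OF X(2)] letter_powers(2) by blast
  obtain P where P: "det P = 1" "(adj2 P ** X ** P) $ 2 $ 1 \<noteq> 0" "(adj2 P ** Y ** P) $ 2 $ 1 \<noteq> 0"
    using common_non_fixed_point[OF X(2) nX Y(2) nY q] by blast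
  define X' Y' where "X' = adj2 P ** X ** P" and "Y' = adj2 P ** Y ** P"
  have X': "mpow X' a \<approx> mat 1" "det X' = 1" "\<not> X' \<approx> mat 1" "X' $ 2 $ 1 \<noteq> 0"
    using P X nX by (simp_all add: X'_def conj_mpow conj_sgn_one det_mul)
  have Y': "mpow Y' b \<approx> mat 1" "det Y' = 1" "\<not> Y' \<approx> mat 1" "Y' $ 2 $ 1 \<noteq> 0"
    using P Y nY by (simp_all add: Y'_def conj_mpow conj_sgn_one det_mul)
  obtain i j Q where ij: "\<not> mpow X' i \<approx> mat 1" "\<not> mpow Y' j \<approx> mat 1" and Q: "det Q = 1"
    "Q ** comm2 (word_val (letter X' Y') u1) (word_val (letter X' Y') u2) = comm2 (mpow X' i) (mpow Y' j) ** Q"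
    using commutator_of_generating_pair_general_position[OF ab X' Y' u1 u2 gen] by blast
  define c where "c = comm2 (word_val (letter X Y) u1) (word_val (letter X Y) u2)"
  define c' where "c' = comm2 (mpow X i) (mpow Y j)"
  have "Q ** (adj2 P ** c ** P) = adj2 P ** c' ** P ** Q"
    using Q(2) by (simp add: X'_def Y'_def conj_word_val[OF P(1)] conj_comm2[OF P(1)] conj_mpow[OF P(1)] c_def c'_def)
  then have "P ** (Q ** (adj2 P ** c ** P)) ** adj2 P = P ** (adj2 P ** c' ** P ** Q) ** adj2 P" by simp
  then have "(P ** Q ** adj2 P) ** c = c' ** (P ** Q ** adj2 P)"
    using P(1) by (simp add: matrix_mul_assoc[symmetric] det_one_adj2)
  moreover have "det (P ** Q ** adj2 P) = 1" using P Q by (simp add: det_mul)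
  moreover have "\<not> mpow X i \<approx> mat 1" "\<not> mpow Y j \<approx> mat 1"
    using ij P by (simp_all add: X'_def Y'_def conj_mpow conj_sgn_one)
  ultimately show ?thesis unfolding c_def c'_def by blast
qed

section \<open>The projective group\<close>

definition proj :: "'a::field^2^2 \<Rightarrow> ('a^2^2) set" where "proj M = {M, - M}"

lemma proj_eq_iff: "proj M = proj N \<longleftrightarrow> M \<approx> N"
  by (auto simp: proj_def sgn_eq_def doubleton_eq_iff)

lemma r_coset_pm_one: "{mat 1, - mat 1} #>\<^bsub>SL2 F\<^esub> M = proj M"
  by (auto simp: r_coset_def SL2_def proj_def)

lemma carrier_PSL2: "carrier (PSL2 F) = proj ` {M. det M = 1}"
proof -
  have "carrier (SL2 F) = {M. det M = 1}" by (simp add: SL2_def)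
  then show ?thesis by (auto simp: PSL2_def FactGroup_def RCOSETS_def r_coset_pm_one)
qed

lemma proj_mem_PSL2: "det M = 1 \<Longrightarrow> proj M \<in> carrier (PSL2 F)"
  by (simp add: carrier_PSL2)

lemma one_PSL2: "\<one>\<^bsub>PSL2 F\<^esub> = proj (mat 1)"
  by (simp add: PSL2_def FactGroup_def proj_def)

lemma mult_PSL2:
  assumes "det M = 1" "det N = 1"
  shows "proj M \<otimes>\<^bsub>PSL2 F\<^esub> proj N = proj (M ** N)"
proof -
  have "M \<in> carrier (SL2 F)" "N \<in> carrier (SL2 F)" using assms by (simp_all add: SL2_def)
  from normal.rcos_sum[OF pm_one_normal_SL2 this]
  show ?thesis by (simp add: r_coset_pm_one PSL2_def FactGroup_def) (simp add: SL2_def)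
qed

lemma inv_PSL2:
  assumes "det M = 1" shows "inv\<^bsub>PSL2 F\<^esub> proj M = proj (adj2 M)"
  using assms by (intro group.inv_equality[OF group_PSL2])
    (simp_all add: mult_PSL2 one_PSL2 det_one_adj2 proj_mem_PSL2)

text \<open>The matrices whose classes lie in the subgroup generated by two classes form a subgroup of the
  special linear group.\<close>

lemma generating_pair_PSL2I:
  fixes A B :: "'a::{field,finite}^2^2"
  assumes "det A = 1" "det B = 1"
    and full: "\<And>K. SL2_subgroup K \<Longrightarrow> A \<in> K \<Longrightarrow> B \<in> K \<Longrightarrow> K = {M. det M = 1}"
  shows "generating_pair (PSL2 TYPE('a)) (proj A) (proj B)"
proof -
  interpret group "PSL2 TYPE('a)" by (rule group_PSL2)
  have sub: "{proj A, proj B} \<subseteq> carrier (PSL2 TYPE('a))" using assms by (simp add: proj_mem_PSL2)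
  define K where "K = {M. det M = 1 \<and> proj M \<in> generate (PSL2 TYPE('a)) {proj A, proj B}}"
  have "SL2_subgroup K"
  proof
    show "mat 1 \<in> K" using generate.one[of "PSL2 TYPE('a)"] by (simp add: K_def one_PSL2)
    show "M ** N \<in> K" if "M \<in> K" "N \<in> K" for M N
      using that generate.eng[of "proj M" "PSL2 TYPE('a)" _ "proj N"] by (simp add: K_def mult_PSL2 det_mul)
    show "adj2 M \<in> K" if "M \<in> K" for M
      using that generate_m_inv_closed[OF sub, of "proj M"] by (simp add: K_def inv_PSL2)
  qed (simp add: K_def)
  moreover have "A \<in> K" "B \<in> K" using assms by (simp_all add: K_def generate.incl)
  ultimately have "K = {M. det M = 1}" by (rule full)
  then have "carrier (PSL2 TYPE('a)) \<subseteq> generate (PSL2 TYPE('a)) {proj A, proj B}"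
    by (auto simp: carrier_PSL2 K_def)
  then show ?thesis using generate_incl[OF sub] sub by (auto simp: generating_pair_def)
qed

lemma cyclic_hom_PSL2:
  fixes f :: "int \<Rightarrow> ('a::field^2^2) set"
  assumes n: "n > 0" and f: "f \<in> hom (C n) (PSL2 TYPE('a))"
  obtains X where "det X = 1" "mpow X n \<approx> mat 1" "\<And>i. i \<in> carrier (C n) \<Longrightarrow> f i = proj (mpow X (nat i))"
proof -
  have m: "1 mod int n \<in> carrier (C n)" using n by (simp add: carrier_C)
  then have "f (1 mod int n) \<in> carrier (PSL2 TYPE('a))" using f hom_in_carrier by metis
  then obtain X where X: "det X = 1" "f (1 mod int n) = proj X" by (auto simp: carrier_PSL2)
  have f0: "f 0 = proj (mat 1)"
    using hom_one[OF f group_integer_mod_group group_PSL2] n by (simp add: one_C one_PSL2)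
  have pow: "f (int i) = proj (mpow X i)" if "i < n" for i
    using that
  proof (induction i)
    case 0 then show ?case using f0 by simp
  next
    case (Suc i)
    then have "1 mod int n = 1" by simp
    moreover have "int (Suc i) = (1 mod int n) \<otimes>\<^bsub>C n\<^esub> int i" using Suc n by (simp add: mult_C)
    then have "f (int (Suc i)) = f (1 mod int n) \<otimes>\<^bsub>PSL2 TYPE('a)\<^esub> f (int i)"
      using hom_mult[OF f m, of "int i"] Suc n by (simp add: carrier_C)
    ultimately show ?case using Suc X by (simp add: mult_PSL2 det_mpow)
  qed
  have "proj (X ** mpow X (n - 1)) = f (1 mod int n) \<otimes>\<^bsub>PSL2 TYPE('a)\<^esub> f (int (n - 1))"
    using pow[of "n - 1"] X n by (simp add: mult_PSL2 det_mpow)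
  also have "\<dots> = f ((1 mod int n) \<otimes>\<^bsub>C n\<^esub> int (n - 1))"
    using hom_mult[OF f m, of "int (n - 1)"] n by (simp add: carrier_C)
  also have "(1 mod int n) \<otimes>\<^bsub>C n\<^esub> int (n - 1) = 0"
    using n by (simp add: mult_C mod_add_left_eq of_nat_diff)
  finally have "X ** mpow X (n - 1) \<approx> mat 1" using f0 by (simp add: proj_eq_iff)
  moreover have "X ** mpow X (n - 1) = mpow X n" using n by (cases n) simp_all
  ultimately have "mpow X n \<approx> mat 1" by simp
  moreover have "f i = proj (mpow X (nat i))" if "i \<in> carrier (C n)" for i
    using that pow[of "nat i"] n by (simp add: carrier_C nat_less_iff)
  ultimately show thesis using that X(1) by blast
qed

lemma hom_C_PSL2:
  fixes X :: "'a::field^2^2"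
  assumes "n > 0" "det X = 1" "mpow X n \<approx> mat 1"
  shows "(\<lambda>i. proj (mpow X (nat i))) \<in> hom (C n) (PSL2 TYPE('a))"
proof (rule homI)
  fix i j assume ij: "i \<in> carrier (C n)" "j \<in> carrier (C n)"
  show "proj (mpow X (nat i)) \<in> carrier (PSL2 TYPE('a))" using assms by (simp add: proj_mem_PSL2 det_mpow)
  show "proj (mpow X (nat (i \<otimes>\<^bsub>C n\<^esub> j))) =
      proj (mpow X (nat i)) \<otimes>\<^bsub>PSL2 TYPE('a)\<^esub> proj (mpow X (nat j))"
    using sgn_eq_sym[OF mpow_C_mult[OF assms(1,3) ij]] assms(2) by (simp add: mult_PSL2 det_mpow proj_eq_iff)
qed

lemma hom_onto_if_image_generates:
  assumes "group G" "group H" and \<theta>: "\<theta> \<in> hom G H" and g: "g1 \<in> carrier G" "g2 \<in> carrier G"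
    and gen: "generating_pair H (\<theta> g1) (\<theta> g2)"
  shows "\<theta> ` carrier G = carrier H"
proof -
  interpret group_hom G H \<theta> using assms by (simp add: group_hom_def group_hom_axioms_def)
  have "generate H {\<theta> g1, \<theta> g2} \<subseteq> \<theta> ` carrier G"
    using g img_is_subgroup by (intro H.generate_subgroup_incl) auto
  then have "carrier H \<subseteq> \<theta> ` carrier G" using gen by (simp add: generating_pair_def)
  moreover have "\<theta> ` carrier G \<subseteq> carrier H" using hom_closed by blast
  ultimately show ?thesis by blast
qed

lemma epi_free_product_PSL2:
  fixes X Y :: "'a::field^2^2"
  assumes ab: "a > 0" "b > 0" and X: "det X = 1" "mpow X a \<approx> mat 1" and Y: "det Y = 1" "mpow Y b \<approx> mat 1"
    and gen: "generating_pair (PSL2 TYPE('a)) (proj X) (proj Y)"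
  shows "epi (free_product (C a) (C b)) (PSL2 TYPE('a)) \<noteq> {}"
proof -
  obtain h where h: "h \<in> hom (free_product (C a) (C b)) (PSL2 TYPE('a))"
    "\<forall>i\<in>carrier (C a). h (fp_inl (C a) (C b) i) = proj (mpow X (nat i))"
    "\<forall>j\<in>carrier (C b). h (fp_inr (C a) (C b) j) = proj (mpow Y (nat j))"
    using free_product_lift[OF group_integer_mod_group group_integer_mod_group group_PSL2
      hom_C_PSL2[OF ab(1) X] hom_C_PSL2[OF ab(2) Y]] by blast
  have ma: "1 mod int a \<in> carrier (C a)" and mb: "1 mod int b \<in> carrier (C b)"
    using ab by (simp_all add: carrier_C)
  have *: "proj (mpow M (nat (1 mod int n))) = proj M" if "mpow M n \<approx> mat 1" for M :: "'a^2^2" and n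
    using mpow_mod[OF that, of 1] by (simp add: proj_eq_iff nat_mod_as_int)
  have "h ` carrier (free_product (C a) (C b)) = carrier (PSL2 TYPE('a))"
  proof (rule hom_onto_if_image_generates[OF group_free_product group_PSL2 h(1)])
    show "fp_inl (C a) (C b) (1 mod int a) \<in> carrier (free_product (C a) (C b))"
      using hom_in_carrier[OF fp_inl_hom ma, of "C b"] by simp
    show "fp_inr (C a) (C b) (1 mod int b) \<in> carrier (free_product (C a) (C b))"
      using hom_in_carrier[OF fp_inr_hom mb, of "C a"] by simp
    show "generating_pair (PSL2 TYPE('a)) (h (fp_inl (C a) (C b) (1 mod int a)))
        (h (fp_inr (C a) (C b) (1 mod int b)))"
      using h ma mb gen *[OF X(2)] *[OF Y(2)] by simp
  qed simp_all
  then show ?thesis using h(1) by (auto simp: epi_def)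
qed

lemma hom_C_mem_subgroup:
  assumes n: "n > 0" and f: "f \<in> hom (C n) G" and G: "group G" and S: "subgroup S G"
    and one: "f (1 mod int n) \<in> S" and i: "i \<in> carrier (C n)"
  shows "f i \<in> S"
proof -
  have m: "1 mod int n \<in> carrier (C n)" using n by (simp add: carrier_C)
  have "f (int j) \<in> S" if "j < n" for j
    using that
  proof (induction j)
    case 0
    have "f 0 = \<one>\<^bsub>G\<^esub>" using hom_one[OF f group_integer_mod_group G] n by (simp add: one_C)
    then show ?case using subgroup.one_closed[OF S] by simp
  next
    case (Suc j)
    then have j: "int j \<in> carrier (C n)" by (simp add: carrier_C)
    have "f (int (Suc j)) = f (1 mod int n) \<otimes>\<^bsub>G\<^esub> f (int j)"
      using hom_mult[OF f m j] Suc.prems n by (simp add: mult_C)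
    then show ?case using subgroup.m_closed[OF S one] Suc by simp
  qed
  from this[of "nat i"] show ?thesis using i n by (simp add: carrier_C nat_less_iff)
qed

lemma two_generated_free_product:
  assumes a: "a > 0" and b: "b > 0"
  shows "two_generated (free_product (C a) (C b))"
proof -
  let ?G = "free_product (C a) (C b)"
  have grp: "group ?G" by (rule group_free_product) simp_all
  interpret group ?G by (rule grp)
  let ?x = "fp_inl (C a) (C b) (1 mod int a)" and ?y = "fp_inr (C a) (C b) (1 mod int b)"
  have homs: "fp_inl (C a) (C b) \<in> hom (C a) ?G" "fp_inr (C a) (C b) \<in> hom (C b) ?G"
    by (simp_all add: fp_inl_hom fp_inr_hom)
  have m: "1 mod int a \<in> carrier (C a)" "1 mod int b \<in> carrier (C b)" using a b by (simp_all add: carrier_C)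
  have sub: "{?x, ?y} \<subseteq> carrier ?G"
    using hom_in_carrier[OF homs(1) m(1)] hom_in_carrier[OF homs(2) m(2)] by simp
  let ?S = "generate ?G {?x, ?y}"
  have S: "subgroup ?S ?G" by (rule generate_is_subgroup[OF sub])
  have "cls a b w \<in> ?S" if "w \<in> fp_words (C a) (C b)" for w
    using that
  proof (induction w)
    case Nil
    then show ?case using generate.one[of ?G] by (simp add: one_FP[OF a b])
  next
    case (Cons k w)
    then have w: "w \<in> fp_words (C a) (C b)" "[k] \<in> fp_words (C a) (C b)" by (cases k; simp)+
    have "cls a b [k] \<in> ?S"
    proof (cases k)
      case (Inl i)
      then show ?thesis
        using hom_C_mem_subgroup[OF a homs(1) grp S, of i] Cons.prems by (simp add: generate.incl fp_inl_def)
    next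
      case (Inr i)
      then show ?thesis
        using hom_C_mem_subgroup[OF b homs(2) grp S, of i] Cons.prems by (simp add: generate.incl fp_inr_def)
    qed
    moreover have "cls a b (k # w) = cls a b [k] \<otimes>\<^bsub>?G\<^esub> cls a b w" using cls_mult[OF a b w(2,1)] by simp
    ultimately show ?case using generate.eng Cons.IH w by metis
  qed
  then have "carrier ?G \<subseteq> ?S" by (auto simp: carrier_FP[OF a b])
  then have "generating_pair ?G ?x ?y" using generate_incl[OF sub] sub by (auto simp: generating_pair_def)
  then show ?thesis by (auto simp: two_generated_def)
qed

text \<open>The criterion behind all four cases: the commutator of a pair that lifts to a generating pair
  of the free product is conjugate to the commutator of powers of the images of the two factors.\<close>

theorem image_with_non_lifting_pairI:
  fixes X Y H1 H2 :: "'a::{field,finite}^2^2"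
  assumes ab: "a > 0" "b > 0" and q: "CARD('a) \<ge> 4"
    and X: "det X = 1" "mpow X a \<approx> mat 1" and Y: "det Y = 1" "mpow Y b \<approx> mat 1"
    and gen: "generating_pair (PSL2 TYPE('a)) (proj X) (proj Y)"
    and H: "det H1 = 1" "det H2 = 1" and genH: "generating_pair (PSL2 TYPE('a)) (proj H1) (proj H2)"
    and nontriv: "trace (comm2 H1 H2) \<noteq> 2"
    and no: "\<And>X Y i j Q. det X = 1 \<Longrightarrow> det Y = 1 \<Longrightarrow> mpow X a \<approx> mat 1 \<Longrightarrow> mpow Y b \<approx> mat 1 \<Longrightarrow>
      \<not> mpow X i \<approx> mat 1 \<Longrightarrow> \<not> mpow Y j \<approx> mat 1 \<Longrightarrow> det Q = 1 \<Longrightarrow>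
      Q ** comm2 H1 H2 = comm2 (mpow X i) (mpow Y j) ** Q \<Longrightarrow>
      (\<And>M. det M = 1 \<Longrightarrow> \<exists>w. M \<approx> word_val (letter X Y) w) \<Longrightarrow> False"
  shows "image_with_non_lifting_pair (free_product (C a) (C b)) (PSL2 TYPE('a))"
proof -
  let ?G = "free_product (C a) (C b)" and ?H = "PSL2 TYPE('a)"
  let ?cls = "\<lambda>u. fp_rel (C a) (C b) `` {u}"
  have grp: "group ?G" by (rule group_free_product) simp_all
  have "(\<theta> g1, \<theta> g2) \<noteq> (proj H1, proj H2)"
    if \<theta>: "\<theta> \<in> hom ?G ?H" and g: "generating_pair ?G g1 g2" for \<theta> g1 g2
  proof
    assume eq: "(\<theta> g1, \<theta> g2) = (proj H1, proj H2)"
    have "\<theta> \<circ> fp_inl (C a) (C b) \<in> hom (C a) ?H"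
      using hom_compose[OF fp_inl_hom \<theta>] by simp
    then obtain X where X: "det X = 1" "mpow X a \<approx> mat 1"
      "\<And>i. i \<in> carrier (C a) \<Longrightarrow> \<theta> (fp_inl (C a) (C b) i) = proj (mpow X (nat i))"
      using cyclic_hom_PSL2[OF ab(1)] by (metis comp_apply)
    have "\<theta> \<circ> fp_inr (C a) (C b) \<in> hom (C b) ?H"
      using hom_compose[OF fp_inr_hom \<theta>] by simp
    then obtain Y where Y: "det Y = 1" "mpow Y b \<approx> mat 1"
      "\<And>i. i \<in> carrier (C b) \<Longrightarrow> \<theta> (fp_inr (C a) (C b) i) = proj (mpow Y (nat i))"
      using cyclic_hom_PSL2[OF ab(2)] by (metis comp_apply)
    have val: "\<theta> (?cls w) = proj (word_val (letter X Y) w)" if "w \<in> fp_words (C a) (C b)" for w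
      using that
    proof (induction w)
      case Nil
      then show ?case using hom_one[OF \<theta> grp group_PSL2] by (simp add: one_FP[OF ab] one_PSL2)
    next
      case (Cons k w)
      then have w: "w \<in> fp_words (C a) (C b)" "[k] \<in> fp_words (C a) (C b)" by (cases k; simp)+
      then have "?cls [k] \<in> carrier ?G" "?cls w \<in> carrier ?G" by (auto simp: carrier_FP[OF ab])
      from hom_mult[OF \<theta> this] have "\<theta> (?cls (k # w)) = \<theta> (?cls [k]) \<otimes>\<^bsub>?H\<^esub> \<theta> (?cls w)"
        unfolding cls_mult[OF ab w(2,1)] by simp
      moreover have "\<theta> (?cls [k]) = proj (letter X Y k)"
        using X(3) Y(3) w(2) by (cases k) (simp_all add: fp_inl_def fp_inr_def)
      moreover have "det (letter X Y k) = 1" using X Y by (cases k) (simp_all add: det_mpow)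
      ultimately show ?case using Cons.IH w X Y by (simp add: mult_PSL2 det_word_val)
    qed
    have gc: "g1 \<in> carrier ?G" "g2 \<in> carrier ?G" "generate ?G {g1, g2} = carrier ?G"
      using g by (simp_all add: generating_pair_def)
    obtain u1 where u1: "u1 \<in> fp_words (C a) (C b)" "g1 = ?cls u1" using gc(1) by (auto simp: carrier_FP[OF ab])
    obtain u2 where u2: "u2 \<in> fp_words (C a) (C b)" "g2 = ?cls u2" using gc(2) by (auto simp: carrier_FP[OF ab])
    have "H1 \<approx> word_val (letter X Y) u1" "H2 \<approx> word_val (letter X Y) u2"
      using eq val u1 u2 by (simp_all add: proj_eq_iff[symmetric])
    then have cH: "comm2 H1 H2 = comm2 (word_val (letter X Y) u1) (word_val (letter X Y) u2)"
      by (rule comm2_sgn)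
    have "comm2 H1 H2 \<noteq> mat 1" using nontriv by (auto simp: trace_I)
    then obtain i j Q where ijQ: "\<not> mpow X i \<approx> mat 1" "\<not> mpow Y j \<approx> mat 1" "det Q = 1"
      "Q ** comm2 H1 H2 = comm2 (mpow X i) (mpow Y j) ** Q"
      using commutator_of_generating_pair[OF ab q X(2,1) Y(2,1) u1(1) u2(1)] gc(3) u1 u2 cH by metis
    have "\<theta> ` carrier ?G = carrier ?H"
      using hom_onto_if_image_generates[OF grp group_PSL2 \<theta> gc(1,2)] genH eq by simp
    then have "\<exists>w. M \<approx> word_val (letter X Y) w" if "det M = 1" for M
      using proj_mem_PSL2[OF that] val carrier_FP[OF ab] proj_eq_iff
      by (smt (verit) imageE mem_Collect_eq)
    then show False using no[OF X(1) Y(1) X(2) Y(2) ijQ] by blast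
  qed
  moreover have "two_generated ?H" using gen by (auto simp: two_generated_def)
  ultimately show ?thesis
    unfolding image_with_non_lifting_pair_def
    using two_generated_free_product[OF ab] epi_free_product_PSL2[OF ab X Y gen] genH by blast
qed

section \<open>Arithmetic of finite fields\<close>

lemma CHAR_eq_prime:
  assumes "CARD('a::{field,finite}) = p ^ k" "prime p"
  shows "CHAR('a) = p"
proof -
  have pos: "CHAR('a) > 0" by (rule finite_imp_CHAR_pos) simp
  then have "prime CHAR('a)" by (rule prime_CHAR_semidom)
  moreover have "CHAR('a) dvd p ^ k" using CHAR_dvd_card[where 'a='a] assms by simp
  ultimately have "CHAR('a) dvd p" using prime_dvd_power by blast
  then show ?thesis using \<open>prime CHAR('a)\<close> assms(2) primes_dvd_imp_eq by blast
qed

lemma of_nat_surj_prime_field: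
  assumes "prime CARD('a::{field,finite})"
  shows "range (of_nat :: nat \<Rightarrow> 'a) = UNIV"
proof -
  have c: "CHAR('a) = CARD('a)" using CHAR_eq_prime[where 'a='a and p="CARD('a)" and k=1] assms by simp
  have "inj_on (of_nat :: nat \<Rightarrow> 'a) {..<CARD('a)}"
    by (rule inj_onI) (simp add: of_nat_eq_iff_cong_CHAR c cong_def)
  then have "card ((of_nat :: nat \<Rightarrow> 'a) ` {..<CARD('a)}) = CARD('a)" by (simp add: card_image)
  then have "(of_nat :: nat \<Rightarrow> 'a) ` {..<CARD('a)} = UNIV" by (intro card_subset_eq) auto
  then show ?thesis by blast
qed

lemma not_square_prime_field:
  assumes "prime CARD('a::{field,finite})" "\<forall>k<CARD('a). k * k mod CARD('a) \<noteq> n mod CARD('a)"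
  shows "of_nat n \<noteq> (x::'a) ^ 2"
proof
  assume eq: "of_nat n = x ^ 2"
  have c: "CHAR('a) = CARD('a)" using CHAR_eq_prime[where 'a='a and p="CARD('a)" and k=1] assms by simp
  obtain k where k: "x = of_nat k" using of_nat_surj_prime_field[OF assms(1)] by (metis rangeE UNIV_I)
  have "of_nat n = (of_nat (k * k) :: 'a)" using eq k by (simp add: power2_eq_square)
  then have "n mod CARD('a) = (k * k) mod CARD('a)"
    by (simp only: of_nat_eq_iff_cong_CHAR c cong_def)
  then have "(k mod CARD('a)) * (k mod CARD('a)) mod CARD('a) = n mod CARD('a)"
    by (simp add: mod_mult_eq)
  then show False using assms(2) by simp
qed

lemma no_square_minus_one:
  assumes "CARD('a::{field,finite}) mod 4 = 3"
  shows "(x::'a) ^ 2 \<noteq> - 1"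
proof
  assume x: "x ^ 2 = - 1"
  then have x0: "x \<noteq> 0" by auto
  define k where "k = CARD('a) div 4"
  have q: "CARD('a) = 4 * k + 3" using assms unfolding k_def by presburger
  have e: "CARD('a) - 1 = 2 * (2 * k + 1)" using q by simp
  have "x ^ (CARD('a) - 1) = (x ^ 2) ^ (2 * k + 1)" unfolding e by (rule power_mult)
  also have "\<dots> = - 1" unfolding x by simp
  finally have "(1::'a) = - 1" using finite_field_power[OF x0] by simp
  then have "(2::'a) = 0" by (metis add.right_inverse one_add_one)
  then have "even CARD('a)" by (simp add: two_eq_0_iff_even)
  then show False using q by simp
qed

text \<open>Fields for which the squares are numerous enough for the pigeonhole argument and for which the
  orders of the few special elements below are smaller than that of a generator.\<close>

definition large_field :: "'a::{field,finite} itself \<Rightarrow> bool" where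
  "large_field _ \<longleftrightarrow> CARD('a) \<ge> 14 \<or> CARD('a) \<ge> 8 \<and> even CARD('a)"

lemma small_fields:
  assumes "primepow CARD('a::{field,finite})" "CARD('a) \<ge> 4" "\<not> large_field TYPE('a)"
  shows "CARD('a) \<in> {4, 5, 7, 9, 11, 13}"
proof (cases "even CARD('a)")
  case True
  then have "CARD('a) < 8" using assms by (simp add: large_field_def)
  then have "CARD('a) = 4 \<or> CARD('a) = 6" using True assms(2) by presburger
  moreover have "CARD('a) \<noteq> 6"
  proof
    assume "CARD('a) = 6"
    then obtain p k where pk: "prime p" "(6::nat) = p ^ k" using assms(1) by (auto simp: primepow_def)
    have "2 dvd p ^ k" "3 dvd p ^ k" unfolding pk(2)[symmetric] by simp_all
    then have "2 dvd p" "3 dvd p" using prime_dvd_power[of 2 p k] prime_dvd_power[of 3 p k] by simp_all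
    then have "2 = p" "3 = p" using primes_dvd_imp_eq[of 2 p] primes_dvd_imp_eq[of 3 p] pk(1) by simp_all
    then show False by simp
  qed
  ultimately show ?thesis by simp
next
  case False
  then have "CARD('a) < 14" using assms by (simp add: large_field_def)
  then show ?thesis using False assms(2) by (simp, presburger)
qed

lemma large_field_squares:
  assumes "large_field TYPE('a::{field,finite})"
  shows "card (nz_squares :: 'a set) \<ge> 7"
proof (cases "even CARD('a)")
  case True
  then have nz: "nz_squares = UNIV - {0::'a}" by (intro nz_squares_char_2) (simp add: two_eq_0_iff_even)
  have "card (nz_squares :: 'a set) = CARD('a) - 1" unfolding nz by (rule card_Diff_singleton) simp
  moreover have "CARD('a) \<ge> 8" using assms unfolding large_field_def by linarith
  ultimately show ?thesis by linarith
next
  case False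
  then have "CARD('a) \<ge> 14" using assms unfolding large_field_def by blast
  then show ?thesis using card_nz_squares[where 'a='a] by linarith
qed

text \<open>Each exclusion holds because the order of the generator would otherwise divide a small number:
  \<open>2\<close>, \<open>4\<close>, \<open>12\<close> (\<open>6\<close> in characteristic two), \<open>2\<close> and \<open>3\<close> respectively.\<close>

lemma generator_facts:
  fixes x :: "'a::{field,finite}"
  assumes g: "mult_generator x" and large: "large_field TYPE('a)"
  shows "x \<noteq> 0" "x - 1 / x \<noteq> 0" "(x - 1 / x) ^ 2 \<noteq> - 4" "(x - 1 / x) ^ 2 \<noteq> - 1"
    "x + 1 \<noteq> 0" "x ^ 2 + x + 1 \<noteq> 0"
proof -
  have q: "CARD('a) \<ge> 8" using large unfolding large_field_def by linarith
  have ne: "x ^ k \<noteq> 1" if "0 < k" "k < 7" for k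
    using mult_generator_power[OF g, of k] that q by auto
  show x: "x \<noteq> 0" using g by (simp add: mult_generator_def)
  show "x - 1 / x \<noteq> 0" using ne[of 2] x by (auto simp: field_simps power2_eq_square)
  show "x + 1 \<noteq> 0"
  proof
    assume "x + 1 = 0"
    then have "x = - 1" by (simp add: eq_neg_iff_add_eq_0)
    then show False using ne[of 2] by simp
  qed
  show "x ^ 2 + x + 1 \<noteq> 0"
  proof
    assume "x ^ 2 + x + 1 = 0"
    then have "x ^ 3 = 1" by Groebner_Basis.algebra
    then show False using ne[of 3] by simp
  qed
  show "(x - 1 / x) ^ 2 \<noteq> - 4"
  proof
    assume e: "(x - 1 / x) ^ 2 = - 4"
    have "(x ^ 2 + 1) ^ 2 = x ^ 2 * ((x - 1 / x) ^ 2 + 4)" using x by (simp add: field_simps power2_eq_square)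
    then have "x ^ 2 = - 1" using e by (simp add: eq_neg_iff_add_eq_0)
    then have "x ^ 4 = 1" by Groebner_Basis.algebra
    then show False using ne[of 4] by simp
  qed
  show "(x - 1 / x) ^ 2 \<noteq> - 1"
  proof
    assume e: "(x - 1 / x) ^ 2 = - 1"
    have "x ^ 4 - x ^ 2 + 1 = x ^ 2 * ((x - 1 / x) ^ 2 + 1)"
      using x by (simp add: field_simps power2_eq_square power4_eq_xxxx)
    then have "x ^ 4 - x ^ 2 + 1 = 0" using e by simp
    then have x6: "x ^ 6 = - 1" by Groebner_Basis.algebra
    show False
    proof (cases "even CARD('a)")
      case True
      then have "(2::'a) = 0" by (simp add: two_eq_0_iff_even)
      then have "- 1 = (1::'a)" by (metis add_eq_0_iff one_add_one)
      then show False using x6 ne[of 6] by simp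
    next
      case False
      then have "CARD('a) \<ge> 14" using large by (simp add: large_field_def)
      moreover have "x ^ 12 = (x ^ 6) ^ 2" by (simp flip: power_mult)
      then have "x ^ 12 = 1" using x6 by simp
      ultimately show False using mult_generator_power[OF g, of 12] by simp
    qed
  qed
qed

section \<open>Generating pairs with prescribed commutator trace\<close>

lemma SL2_full_large:
  fixes x :: "'a::{field,finite}"
  assumes "SL2_subgroup K" "mult_generator x" "large_field TYPE('a)" "torus x \<in> K"
    "mat2 a b c d \<in> K" "a \<noteq> 0" "b \<noteq> 0" "c \<noteq> 0" "d \<noteq> 0"
  shows "K = {M. det M = 1}"
proof -
  interpret SL2_subgroup K by fact
  show ?thesis
    by (rule full_if_torus_and_generic[OF torus_mem_if_generator[OF assms(2,4)] assms(5-9)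
        large_field_squares[OF assms(3)]])
qed

lemma SL2_full_prime:
  fixes t :: "'a::{field,finite}"
  assumes "SL2_subgroup K" "prime CARD('a)" "upper t \<in> K" "t \<noteq> 0" "mat2 a b c d \<in> K" "c \<noteq> 0"
  shows "K = {M. det M = 1}"
proof -
  interpret SL2_subgroup K by fact
  show ?thesis using full_if_prime_card of_nat_surj_prime_field assms by blast
qed

lemma det_torus [simp]: "s \<noteq> 0 \<Longrightarrow> det (torus s) = 1" and det_upper [simp]: "det (upper t) = 1"
  by (simp_all add: torus_def upper_def)

lemma trace_comm2_torus:
  fixes s :: "'a::field"
  assumes "s \<noteq> 0" "a * d - b * c = 1"
  shows "trace (comm2 (torus s) (mat2 a b c d)) = 2 - b * c * (s - 1 / s) ^ 2"
proof -
  have "torus s ** mat2 a b c d - mat2 a b c d ** torus s = mat2 0 (b * (s - 1 / s)) (- c * (s - 1 / s)) 0"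
    using assms(1) by (simp add: torus_def field_simps)
  then show ?thesis using assms by (simp add: trace_comm2 power2_eq_square)
qed

lemma trace_comm2_upper:
  fixes t :: "'a::field"
  assumes "a * d - b * c = 1"
  shows "trace (comm2 (upper t) (mat2 a b c d)) = 2 + (t * c) ^ 2"
proof -
  have "upper t ** mat2 a b c d - mat2 a b c d ** upper t = mat2 (t * c) (t * (d - a)) 0 (- (t * c))"
    by (simp add: upper_def algebra_simps)
  then show ?thesis using assms by (simp add: trace_comm2 power2_eq_square)
qed

text \<open>The commutator of the torus element with parameter \<open>x\<close> and a matrix \<open>(a, b; c, d)\<close> has trace
  \<open>2 - b c (x - 1 / x)\<^sup>2\<close>, and \<open>b c\<close> can be prescribed freely. The two excluded traces belong to
  \<open>b c = 0\<close> and to \<open>a d = 0\<close>.\<close>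

lemma generating_pair_with_trace:
  fixes x :: "'a::{field,finite}"
  assumes g: "mult_generator x" and large: "large_field TYPE('a)"
    and \<tau>: "\<tau> \<noteq> 2" "\<tau> \<noteq> 2 + (x - 1 / x) ^ 2"
  obtains \<kappa> where "\<kappa> \<noteq> 0" "det (mat2 1 \<kappa> 1 (1 + \<kappa>)) = 1"
    "generating_pair (PSL2 TYPE('a)) (proj (torus x)) (proj (mat2 1 \<kappa> 1 (1 + \<kappa>)))"
    "trace (comm2 (torus x) (mat2 1 \<kappa> 1 (1 + \<kappa>))) = \<tau>"
proof -
  note x = generator_facts[OF g large]
  define \<kappa> where "\<kappa> = (2 - \<tau>) / (x - 1 / x) ^ 2"
  have k0: "\<kappa> \<noteq> 0" using \<tau> x(2) by (simp add: \<kappa>_def)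
  have k: "\<kappa> * (x - 1 / x) ^ 2 = 2 - \<tau>" using x(2) by (simp add: \<kappa>_def)
  have k1: "1 + \<kappa> \<noteq> 0"
  proof
    assume "1 + \<kappa> = 0"
    then have "\<kappa> = - 1" by (simp add: eq_neg_iff_add_eq_0 add.commute)
    then show False using k \<tau>(2) by (simp add: algebra_simps)
  qed
  have gen: "generating_pair (PSL2 TYPE('a)) (proj (torus x)) (proj (mat2 1 \<kappa> 1 (1 + \<kappa>)))"
    using SL2_full_large[OF _ g large] x(1) k0 k1 by (intro generating_pair_PSL2I) auto
  show thesis
    using that[OF k0 _ gen] trace_comm2_torus[OF x(1), of 1 "1 + \<kappa>" \<kappa> 1] k by simp
qed

section \<open>Elements of small order\<close>

lemma mpow_2: 
  fixes M :: "'a::idom^2^2"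
  assumes "det M = 1" shows "mpow M 2 = mat (trace M) ** M + mat (- 1)"
proof (cases M rule: mat2_cases)
  case (1 x y z w)
  then have "x * w - y * z = 1" using assms by simp
  then show ?thesis unfolding 1
    by (simp add: mat_eq_mat2 numeral_2_eq_2) (intro conjI, (Groebner_Basis.algebra | simp add: algebra_simps)+)
qed

lemma mpow_3: 
  fixes M :: "'a::idom^2^2"
  assumes "det M = 1" shows "mpow M 3 = mat (trace M ^ 2 - 1) ** M + mat (- trace M)"
proof -
  have "mpow M 3 = M ** mpow M 2" by (simp add: numeral_3_eq_3 numeral_2_eq_2)
  also have "\<dots> = mat (trace M ^ 2 - 1) ** M + mat (- trace M)"
    unfolding mpow_2[OF assms]
  proof (cases M rule: mat2_cases)
    case (1 x y z w)
    then have "x * w - y * z = 1" using assms by simp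
    then show "M ** (mat (trace M) ** M + mat (- 1)) = mat ((trace M)\<^sup>2 - 1) ** M + mat (- trace M)"
      unfolding 1
      by (simp add: mat_eq_mat2) (intro conjI, (Groebner_Basis.algebra | simp add: algebra_simps power2_eq_square)+)
  qed
  finally show ?thesis .
qed

lemma order_2_trace:
  fixes M :: "'a::idom^2^2"
  assumes "det M = 1" "\<not> M \<approx> mat 1" "mpow M 2 \<approx> mat 1"
  shows "trace M = 0"
proof -
  have "mat (trace M) ** M + mat (- 1) \<approx> mat 1" using assms(3) unfolding mpow_2[OF assms(1)] .
  then show ?thesis by (rule sgn_eq_one_iff_linear) (use assms in auto)
qed

lemma order_2I:
  fixes M :: "'a::idom^2^2"
  assumes "det M = 1" "trace M = 0"
  shows "mpow M 2 = - mat 1"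
proof -
  have "mpow M 2 = mat (- 1)" using mpow_2[OF assms(1)] assms(2) by simp
  then show ?thesis by (simp add: mat_eq_mat2)
qed

lemma order_3_trace:
  fixes M :: "'a::idom^2^2"
  assumes "det M = 1" "\<not> M \<approx> mat 1" "mpow M 3 \<approx> mat 1"
  shows "trace M ^ 2 = 1"
proof -
  have "mat (trace M ^ 2 - 1) ** M + mat (- trace M) \<approx> mat 1" using assms(3) unfolding mpow_3[OF assms(1)] .
  then have "trace M ^ 2 - 1 = 0" by (rule sgn_eq_one_iff_linear) (use assms in auto)
  then show ?thesis by simp
qed

lemma order_3I:
  fixes M :: "'a::idom^2^2"
  assumes "det M = 1" "trace M ^ 2 = 1"
  shows "mpow M 3 \<approx> mat 1"
proof -
  have "mpow M 3 = mat (- trace M)" using mpow_3[OF assms(1)] assms(2) by simp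
  moreover have "trace M = 1 \<or> trace M = - 1" using assms(2) by (simp add: power2_eq_1_iff)
  ultimately show ?thesis by (auto simp: sgn_eq_def mat_eq_mat2)
qed

lemma mpow_power_sgn_one: "mpow X a \<approx> mat 1 \<Longrightarrow> mpow (mpow X i) a \<approx> mat 1"
  using sgn_eq_mpow[of "mpow X a" "mat 1" i] by (simp add: mpow_mult[symmetric] mult.commute)

text \<open>Let \<open>s\<close> be half the trace. Modulo the characteristic polynomial \<open>x\<^sup>2 - 2 s x + 1\<close> one has
  \<open>(x - s)\<^sup>2 = s\<^sup>2 - 1\<close>, hence \<open>x\<^sup>p = (x - s)\<^sup>p + s\<^sup>p = (s\<^sup>2 - 1)\<^bsup>(p - 1) / 2\<^esup> (x - s) + s\<^sup>p\<close> in odd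
  characteristic \<open>p\<close>. If the \<open>p\<close>-th power is scalar, the coefficient of \<open>x\<close> vanishes, and \<open>s\<^sup>2 = 1\<close>.\<close>

lemma order_p_trace:
  fixes M :: "'a::field^2^2"
  assumes M: "det M = 1" "\<not> M \<approx> mat 1" "mpow M p \<approx> mat 1"
    and p: "prime p" "CHAR('a) = p" "odd p"
  shows "trace M ^ 2 = 4"
proof -
  define s where "s = trace M / 2"
  have two: "(2::'a) \<noteq> 0"
  proof
    assume "(2::'a) = 0"
    then have "p dvd 2" using of_nat_eq_0_iff_char_dvd[of 2, where 'a='a] p by simp
    then show False using p(1,3) primes_dvd_imp_eq[OF p(1) two_is_prime_nat] by auto
  qed
  have s: "trace M = 2 * s" using two by (simp add: s_def)
  define f where "f = [:1, - (2 * s), 1:]"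
  have lin: "\<exists>\<alpha> \<beta>. mpow M n = mat \<alpha> ** M + mat \<beta> \<and> f dvd [:0, 1:] ^ n - [:\<beta>, \<alpha>:]" for n
  proof (induction n)
    case 0
    show ?case by (intro exI[of _ 0] exI[of _ 1]) (auto simp: pCons_one)
  next
    case (Suc n)
    then obtain \<alpha> \<beta> where h: "mpow M n = mat \<alpha> ** M + mat \<beta>" "f dvd [:0, 1:] ^ n - [:\<beta>, \<alpha>:]" by blast
    have e: "[:0, 1:] ^ Suc n - [:- \<alpha>, \<alpha> * (2 * s) + \<beta>:] =
        [:0, 1:] * ([:0, 1:] ^ n - [:\<beta>, \<alpha>:]) + [:\<alpha>:] * f"
      by (simp add: f_def algebra_simps)
    have "f dvd [:0, 1:] ^ Suc n - [:- \<alpha>, \<alpha> * (2 * s) + \<beta>:]"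
      unfolding e by (intro dvd_add dvd_mult h(2) dvd_refl)
    moreover have "mpow M (Suc n) = mat (\<alpha> * (2 * s) + \<beta>) ** M + mat (- \<alpha>)"
    proof -
      have e: "M ** mat \<beta> = mat \<beta> ** M" and e2: "M ** (mat \<alpha> ** M) = mat \<alpha> ** mpow M 2"
        by (cases M rule: mat2_cases; simp add: mat_eq_mat2 numeral_2_eq_2 algebra_simps)+
      have "mpow M (Suc n) = mat \<alpha> ** mpow M 2 + mat \<beta> ** M"
        by (simp add: h(1) matrix_add_ldistrib e e2)
      also have "\<dots> = mat (\<alpha> * (2 * s) + \<beta>) ** M + mat (- \<alpha>)"
        unfolding mpow_2[OF M(1)] s
        by (cases M rule: mat2_cases) (simp add: mat_eq_mat2 algebra_simps)
      finally show ?thesis .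
    qed
    ultimately show ?case by blast
  qed
  obtain \<alpha> \<beta> where h: "mpow M p = mat \<alpha> ** M + mat \<beta>" "f dvd [:0, 1:] ^ p - [:\<beta>, \<alpha>:]" using lin by blast
  have "\<alpha> = 0" using sgn_eq_one_iff_linear[of \<alpha> M \<beta>] h(1) M by simp
  define u where "u = [:- s, 1:]"
  define \<Delta> where "\<Delta> = s ^ 2 - 1"
  obtain k where k: "p = Suc (2 * k)" using p(3) by (metis oddE Suc_eq_plus1)
  have "([:- s, 1:] + [:s:]) ^ p = u ^ p + [:s:] ^ p"
    unfolding u_def by (rule freshmans_dream) (use p in \<open>simp_all\<close>)
  then have xp: "[:0, 1:] ^ p = u ^ p + [:s ^ p:]" by (simp add: poly_const_pow)
  have uf: "u ^ 2 - [:\<Delta>:] = f" by (simp add: u_def \<Delta>_def f_def power2_eq_square)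
  have "f dvd (u ^ 2) ^ k - [:\<Delta>:] ^ k"
    unfolding power_diff_sumr2[of "u ^ 2" k "[:\<Delta>:]"] uf by (rule dvd_triv_left)
  then have "f dvd u * ((u ^ 2) ^ k - [:\<Delta>:] ^ k)" by simp
  moreover have "u * (u ^ 2) ^ k = u ^ p" unfolding k by (simp flip: power_mult)
  ultimately have up: "f dvd u ^ p - u * [:\<Delta> ^ k:]" by (simp add: right_diff_distrib poly_const_pow)
  have "f dvd ([:0, 1:] ^ p - [:\<beta>, \<alpha>:]) - (u ^ p - u * [:\<Delta> ^ k:])" by (rule dvd_diff[OF h(2) up])
  also have "([:0, 1:] ^ p - [:\<beta>, \<alpha>:]) - (u ^ p - u * [:\<Delta> ^ k:]) = [:s ^ p - \<beta> - s * \<Delta> ^ k, \<Delta> ^ k:]"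
    unfolding xp using \<open>\<alpha> = 0\<close> by (simp add: u_def)
  finally have d: "f dvd [:s ^ p - \<beta> - s * \<Delta> ^ k, \<Delta> ^ k:]" .
  have "[:s ^ p - \<beta> - s * \<Delta> ^ k, \<Delta> ^ k:] = 0"
  proof (rule ccontr)
    assume "[:s ^ p - \<beta> - s * \<Delta> ^ k, \<Delta> ^ k:] \<noteq> 0"
    from dvd_imp_degree_le[OF d this] have "degree f \<le> 1" by (auto split: if_splits)
    then show False by (simp add: f_def)
  qed
  then have "\<Delta> ^ k = 0" by simp
  then have "s ^ 2 = 1" by (simp add: \<Delta>_def)
  then show ?thesis unfolding s by (simp add: power_mult_distrib)
qed

section \<open>Commutators of images of the two factors\<close>

lemma trace_comm2_order_2:
  fixes M N :: "'a::idom^2^2"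
  assumes "det M = 1" "\<not> M \<approx> mat 1" "mpow M 2 \<approx> mat 1" "det N = 1"
  shows "trace (comm2 M N) = trace N ^ 2 + trace (M ** N) ^ 2 - 2"
  using trace_comm2_Fricke[OF assms(1,4)] order_2_trace[OF assms(1-3)] by simp

lemma trace_comm2_order_2_3:
  fixes M N :: "'a::idom^2^2"
  assumes "det M = 1" "\<not> M \<approx> mat 1" "mpow M 2 \<approx> mat 1" "det N = 1" "\<not> N \<approx> mat 1" "mpow N 3 \<approx> mat 1"
  shows "trace (comm2 M N) + 1 = trace (M ** N) ^ 2"
  using trace_comm2_order_2[OF assms(1-4)] order_3_trace[OF assms(4-6)] by simp

lemma trace_comm2_order_2_p:
  fixes M N :: "'a::field^2^2"
  assumes "det M = 1" "\<not> M \<approx> mat 1" "mpow M 2 \<approx> mat 1" "det N = 1" "\<not> N \<approx> mat 1" "mpow N p \<approx> mat 1"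
    and p: "prime p" "CHAR('a) = p" "odd p"
  shows "trace (comm2 M N) - 2 = trace (M ** N) ^ 2"
  using trace_comm2_order_2[OF assms(1-4)] order_p_trace[OF assms(4-6) p] by simp

text \<open>The signs of the two traces can be absorbed into the trace of the product.\<close>

lemma trace_comm2_order_3_3:
  fixes M N :: "'a::field^2^2"
  assumes "det M = 1" "\<not> M \<approx> mat 1" "mpow M 3 \<approx> mat 1" "det N = 1" "\<not> N \<approx> mat 1" "mpow N 3 \<approx> mat 1"
  shows "\<exists>c. trace (comm2 M N) = c ^ 2 - c"
proof -
  define x y z where "x = trace M" and "y = trace N" and "z = trace (M ** N)"
  have xy: "x ^ 2 = 1" "y ^ 2 = 1" using order_3_trace assms by (simp_all add: x_def y_def)
  have "trace (comm2 M N) = x ^ 2 + y ^ 2 + z ^ 2 - x * y * z - 2"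
    using trace_comm2_Fricke[OF assms(1,4)] by (simp add: x_def y_def z_def)
  also have "\<dots> = (x * y * z) ^ 2 - x * y * z" by (simp add: xy power_mult_distrib)
  finally show ?thesis by blast
qed

text \<open>The Fricke identity becomes \<open>(tr N)\<^sup>2 + (tr (M N))\<^sup>2 = 0\<close>. Since \<open>- 1\<close> is not a square, both traces vanish,
  and \<open>M\<close>, \<open>N\<close>, \<open>M N\<close> are involutions in the projective group.\<close>

lemma comm2_trace_minus_2:
  fixes M N :: "'a::field^2^2"
  assumes "det M = 1" "\<not> M \<approx> mat 1" "mpow M 2 \<approx> mat 1" "det N = 1"
    and ns: "\<And>x::'a. x ^ 2 \<noteq> - 1" and tr: "trace (comm2 M N) = - 2"
  shows "comm2 M N = - mat 1"
proof -
  define y z where "y = trace N" and "z = trace (M ** N)"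
  have yz: "y ^ 2 + z ^ 2 = 0"
    using trace_comm2_order_2[OF assms(1-4)] tr by (simp add: y_def z_def)
  have z0: "z = 0"
  proof (rule ccontr)
    assume z: "z \<noteq> 0"
    then have "(y / z) ^ 2 = - 1" using yz by (simp add: power_divide eq_neg_iff_add_eq_0 field_simps)
    then show False using ns by blast
  qed
  then have y0: "y = 0" using yz by simp
  have "adj2 M = - M" "adj2 N = - N"
    using order_2_trace[OF assms(1-3)] y0 by (simp_all add: adj2_eq y_def mat_eq_mat2 vec_eq_iff forall_2)
  then have "comm2 M N = mpow (M ** N) 2"
    by (simp add: comm2_def numeral_2_eq_2 matrix_mul_assoc)
  also have "\<dots> = - mat 1" using z0 assms by (intro order_2I) (simp_all add: det_mul z_def)
  finally show ?thesis .
qed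

text \<open>Let \<open>M\<close> be an involution and \<open>N\<close> of order three, in characteristic two. If their commutator has
  trace one, then \<open>M N\<close> is an involution as well, so \<open>M\<close> inverts \<open>N\<close>, and every word in them either
  centralizes or inverts \<open>N\<close>. This cannot hold for two different transvections \<open>upper t\<close>: they would
  have to invert \<open>N\<close>, which means \<open>t r = 1\<close> for the lower left entry \<open>r\<close> of \<open>N\<close>.\<close>

lemma dihedral_too_small:
  fixes X Y :: "'a::{field,finite}^2^2"
  assumes two: "(2::'a) = 0" and q: "CARD('a) \<ge> 4" and X: "det X = 1" "mpow X 2 \<approx> mat 1" and Y: "det Y = 1" "mpow Y 3 \<approx> mat 1"
    and i: "\<not> mpow X i \<approx> mat 1" and j: "\<not> mpow Y j \<approx> mat 1"
    and tr: "trace (comm2 (mpow X i) (mpow Y j)) = 1"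
    and all: "\<And>M. det M = 1 \<Longrightarrow> \<exists>w. M \<approx> word_val (letter X Y) w"
  shows False
proof -
  have neg: "- x = x" for x :: 'a using two by (rule minus_char_2)
  have negM: "- M = M" for M :: "'a^2^2" by (cases M rule: mat2_cases) (simp add: neg)
  have eq: "M \<approx> N \<longleftrightarrow> M = N" for M N :: "'a^2^2" by (auto simp: sgn_eq_def negM)
  define N where "N = mpow Y j"
  have "i mod 2 = Suc 0"
  proof (rule ccontr)
    assume "i mod 2 \<noteq> Suc 0"
    then have "i mod 2 = 0" by presburger
    then show False using mpow_mod[OF X(2), of i] i by (simp add: eq)
  qed
  then have Xi: "mpow X i = X" using mpow_mod[OF X(2), of i] by (simp add: eq)
  have mj: "N = mpow Y (j mod 3)" using mpow_mod[OF Y(2), of j] by (simp add: eq N_def)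
  have "j mod 3 \<noteq> 0"
  proof
    assume "j mod 3 = 0"
    then show False using mj j by (simp add: N_def)
  qed
  then have "j mod 3 = Suc 0 \<or> j mod 3 = 2" by linarith
  moreover have "mpow (mpow Y 2) 2 = mpow Y (3 + 1)" by (simp flip: mpow_mult)
  then have "mpow (mpow Y 2) 2 = Y" using Y(2) by (simp only: mpow_add eq) simp
  \<comment> \<open>\<open>N\<close> is \<open>Y\<close> or its inverse.\<close>
  ultimately obtain k where k: "Y = mpow N k" using mj mpow_1 by metis
  have dN: "det N = 1" using Y by (simp add: N_def det_mpow)
  have nX: "\<not> X \<approx> mat 1" and nN: "\<not> N \<approx> mat 1" using i j Xi by (simp_all add: N_def)
  have N3: "mpow N 3 \<approx> mat 1" unfolding N_def by (rule mpow_power_sgn_one[OF Y(2)])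
  have trXN: "trace (X ** N) = 0"
    using trace_comm2_order_2_3[OF X(1) nX X(2) dN nN N3] tr two by (simp add: Xi N_def)
  have "trace N = 1 \<or> trace N = - 1" using order_3_trace[OF dN nN N3] by (simp add: power2_eq_1_iff)
  then have trN: "trace N = 1" by (simp add: neg)
  have adj: "adj2 N = mat 1 - N" using adj2_eq[of N] trN by simp
  define S where "S = {M. M ** N = N ** M \<or> M ** N = adj2 N ** M}"
  have S_mult: "M ** M' \<in> S" if MS: "M \<in> S" "M' \<in> S" for M M'
  proof -
    have lin: "M ** adj2 N = M - M ** N" "(mat 1 - P) ** M = M - P ** M" for P
      unfolding adj by (cases M rule: mat2_cases; cases N rule: mat2_cases; cases P rule: mat2_cases;
        simp add: mat_eq_mat2 algebra_simps)+
    have "M ** adj2 N = adj2 N ** M" if "M ** N = N ** M" using lin that by (simp add: adj)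
    moreover have "M ** adj2 N = N ** M" if "M ** N = adj2 N ** M" using lin that by (simp add: adj)
    ultimately have M: "\<exists>P'\<in>{N, adj2 N}. M ** P = P' ** M" if "P \<in> {N, adj2 N}" for P
      using MS(1) that by (auto simp: S_def)
    obtain P where P: "P \<in> {N, adj2 N}" "M' ** N = P ** M'" using MS(2) by (auto simp: S_def)
    obtain P' where P': "P' \<in> {N, adj2 N}" "M ** P = P' ** M" using M[OF P(1)] by blast
    have "M ** M' ** N = M ** P ** M'" by (simp only: matrix_mul_assoc[symmetric] P(2))
    also have "\<dots> = P' ** (M ** M')" by (simp only: P'(2) matrix_mul_assoc)
    finally show ?thesis using P'(1) by (auto simp: S_def)
  qed
  have S_one: "mat 1 \<in> S" by (simp add: S_def)
  have "adj2 (X ** N) = X ** N" "adj2 X = X"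
    using trXN order_2_trace[OF X(1) nX X(2)] by (simp_all add: adj2_eq negM mat_eq_mat2 flip: zero_mat2)
  then have XS: "X \<in> S" using adj2_mult[of X N] by (simp add: S_def)
  have YS: "Y \<in> S" unfolding k S_def using mpow_commute[of N k "Suc 0"] by simp
  have pow: "mpow M n \<in> S" if "M \<in> S" for M n
    by (induction n) (simp_all add: S_one S_mult that)
  have "word_val (letter X Y) w \<in> S" for w
  proof (induction w)
    case (Cons l w)
    then show ?case by (cases l) (simp_all add: S_mult pow XS YS)
  qed (simp add: S_one)
  then have SL2_S: "M \<in> S" if "det M = 1" for M using all[OF that] by (auto simp: eq)
  obtain p u r s where N: "N = mat2 p u r s" by (rule mat2_cases)
  have s: "s = 1 - p" using trN by (simp add: N algebra_simps)
  have t: "t * r = 1" if "t \<noteq> 0" for t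
  proof -
    have "upper t \<in> S" by (rule SL2_S) (simp add: upper_def)
    then consider "upper t ** N = N ** upper t" | "upper t ** N = adj2 N ** upper t" by (auto simp: S_def)
    then show ?thesis
    proof cases
      case 1
      then have "t * s = p * t" by (simp add: N upper_def)
      then have "t * (1 - 2 * p) = 0" by (simp add: s algebra_simps)
      then show ?thesis using that by (simp add: two)
    next
      case 2
      then have "p + t * r = s" by (simp add: N upper_def)
      then have "t * r = 1 - 2 * p" by (simp add: s algebra_simps)
      then show ?thesis by (simp add: two)
    qed
  qed
  have "\<not> UNIV \<subseteq> {0, 1::'a}" using q card_mono[of "{0, 1::'a}" UNIV] by auto
  then obtain e :: 'a where "e \<noteq> 0" "e \<noteq> 1" by blast
  then show False using t[of e] t[of 1] by simp
qed

section \<open>Generation by elements of prescribed orders\<close>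

definition order_generated :: "'a::field itself \<Rightarrow> nat \<Rightarrow> nat \<Rightarrow> bool" where
  "order_generated _ a b \<longleftrightarrow> (\<exists>X Y :: 'a^2^2. det X = 1 \<and> det Y = 1 \<and> mpow X a \<approx> mat 1 \<and>
    mpow Y b \<approx> mat 1 \<and> generating_pair (PSL2 TYPE('a)) (proj X) (proj Y))"

text \<open>It is convenient to name the first generator and the product \<open>Z\<close> of the two, because \<open>Z\<close> is the
  element of the torus or the transvection on which the generation criteria rest.\<close>

lemma order_generatedI:
  fixes X Z :: "'a::{field,finite}^2^2"
  assumes "det X = 1" "det Z = 1" "mpow X a \<approx> mat 1" "mpow (adj2 X ** Z) b \<approx> mat 1"
    and full: "\<And>K. SL2_subgroup K \<Longrightarrow> X \<in> K \<Longrightarrow> Z \<in> K \<Longrightarrow> K = {M. det M = 1}"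
  shows "order_generated TYPE('a) a b"
proof -
  have "K = {M. det M = 1}" if "SL2_subgroup K" "X \<in> K" "adj2 X ** Z \<in> K" for K
  proof -
    interpret SL2_subgroup K by fact
    have "Z \<in> K" using mult_mem[OF that(2,3)] unfolding det_one_adj2(3)[OF assms(1)] .
    then show ?thesis using full that by blast
  qed
  then show ?thesis unfolding order_generated_def
    using assms by (intro exI[of _ X] exI[of _ "adj2 X ** Z"]) (auto simp: det_mul intro!: generating_pair_PSL2I)
qed

text \<open>The involution \<open>(\<alpha>, \<beta>; 1, -\<alpha>)\<close> is chosen such that its quotient with a generator of the torus has
  the trace of \<open>W\<close>, hence the order of \<open>W\<close>. The last hypothesis says that \<open>\<beta>\<close> does not vanish.\<close>

lemma order_generated_2_large:
  fixes W :: "'a::{field,finite}^2^2"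
  assumes g: "mult_generator x" and large: "large_field TYPE('a)"
    and W: "det W = 1" "\<not> W \<approx> mat 1" "mpow W m \<approx> mat 1" "trace W \<noteq> 0" "trace W ^ 2 \<noteq> - ((x - 1 / x) ^ 2)"
  shows "order_generated TYPE('a) 2 m"
proof -
  note x = generator_facts[OF g large]
  define \<alpha> where "\<alpha> = - trace W / (x - 1 / x)"
  define \<beta> where "\<beta> = - 1 - \<alpha> ^ 2"
  have a0: "\<alpha> \<noteq> 0" using W x by (simp add: \<alpha>_def)
  have ax: "\<alpha> * (x - 1 / x) = - trace W" using x(2) by (simp add: \<alpha>_def)
  have b0: "\<beta> \<noteq> 0"
  proof
    assume "\<beta> = 0"
    then have "\<alpha> ^ 2 = - 1" by (simp add: \<beta>_def algebra_simps)
    moreover have "trace W ^ 2 = \<alpha> ^ 2 * (x - 1 / x) ^ 2" using ax by (metis power2_minus power_mult_distrib)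
    ultimately show False using W(5) by simp
  qed
  let ?X = "mat2 \<alpha> \<beta> 1 (- \<alpha>)"
  have dX: "det ?X = 1" by (simp add: \<beta>_def power2_eq_square)
  have "adj2 ?X ** torus x = mat2 (- \<alpha> * x) (- \<beta> / x) (- x) (\<alpha> / x)"
    by (simp add: torus_def)
  then have "trace (adj2 ?X ** torus x) = - (\<alpha> * (x - 1 / x))" by (simp add: algebra_simps)
  then have tY: "trace (adj2 ?X ** torus x) = trace W" using ax by simp
  have "det (adj2 ?X ** torus x) = 1" using dX x(1) unfolding det_mul det_adj2 by simp
  then have "mpow (adj2 ?X ** torus x) m \<approx> mat 1"
    using mpow_sgn_one_by_trace[OF W(1-3)] tY by blast
  moreover have "mpow ?X 2 \<approx> mat 1" using order_2I[OF dX] by simp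
  ultimately show ?thesis
    using SL2_full_large[OF _ g large] a0 b0 dX x(1) by (intro order_generatedI[of ?X "torus x"]) auto
qed

text \<open>Over a prime field a transvection replaces the generator of the torus.\<close>

lemma order_generated_2_prime:
  fixes W :: "'a::{field,finite}^2^2"
  assumes q: "prime CARD('a)"
    and W: "det W = 1" "\<not> W \<approx> mat 1" "mpow W m \<approx> mat 1" "trace W \<noteq> 0"
  shows "order_generated TYPE('a) 2 m"
proof -
  define c where "c = - trace W"
  have c: "c \<noteq> 0" using W by (simp add: c_def)
  let ?X = "mat2 0 (- 1 / c) c 0"
  have dX: "det ?X = 1" using c by simp
  have tY: "trace (adj2 ?X ** upper 1) = trace W" using c by (simp add: upper_def c_def)
  have "det (adj2 ?X ** upper 1) = 1" using dX unfolding det_mul det_adj2 by simp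
  then have "mpow (adj2 ?X ** upper 1) m \<approx> mat 1"
    using mpow_sgn_one_by_trace[OF W(1-3)] tY by blast
  moreover have "mpow ?X 2 \<approx> mat 1" using order_2I[OF dX] by simp
  ultimately show ?thesis
    using SL2_full_prime[OF _ q] c dX by (intro order_generatedI[of ?X "upper 1"]) auto
qed

lemma order_3_matrix:
  fixes W :: "'a::field^2^2"
  defines "W \<equiv> mat2 0 (- 1) 1 1"
  shows "det W = 1" "\<not> W \<approx> mat 1" "mpow W 3 \<approx> mat 1" "trace W = 1"
proof -
  show d: "det W = 1" and t: "trace W = 1" by (simp_all add: W_def)
  show "\<not> W \<approx> mat 1" by (simp add: W_def sgn_eq_def mat_eq_mat2)
  show "mpow W 3 \<approx> mat 1" using d t by (intro order_3I) simp_all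
qed

lemma order_generated_2_3:
  assumes "large_field TYPE('a::{field,finite}) \<or> prime CARD('a)"
  shows "order_generated TYPE('a) 2 3"
proof (cases "large_field TYPE('a)")
  case True
  obtain x :: 'a where x: "mult_generator x" using finite_field_generator by blast
  have "(1::'a) \<noteq> - ((x - 1 / x) ^ 2)" using generator_facts(4)[OF x True] by (metis minus_minus)
  then show ?thesis
    using order_generated_2_large[OF x True order_3_matrix(1-3)] unfolding order_3_matrix(4) by simp
next
  case False
  then show ?thesis
    using assms order_generated_2_prime[OF _ order_3_matrix(1-3)] by (simp add: order_3_matrix(4))
qed

lemma order_p_matrix:
  assumes "(2::'a::field) \<noteq> 0" "CHAR('a) dvd m"
  shows "det (upper (1::'a)) = 1" "\<not> upper (1::'a) \<approx> mat 1" "mpow (upper (1::'a)) m \<approx> mat 1"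
    "trace (upper (1::'a)) = 2"
proof -
  have "of_nat m = (0::'a)" using assms(2) by (simp add: of_nat_eq_0_iff_char_dvd)
  then have "mpow (upper (1::'a)) m = mat 1" by (simp add: upper_power) (simp add: upper_def mat_eq_mat2)
  then show "mpow (upper (1::'a)) m \<approx> mat 1" by simp
qed (simp_all add: upper_def sgn_eq_def mat_eq_mat2)

lemma order_generated_2_p:
  assumes "large_field TYPE('a::{field,finite}) \<or> prime CARD('a)" "(2::'a) \<noteq> 0" "CHAR('a) dvd m"
  shows "order_generated TYPE('a) 2 m"
proof (cases "large_field TYPE('a)")
  case True
  obtain x :: 'a where x: "mult_generator x" using finite_field_generator by blast
  have "(4::'a) \<noteq> - ((x - 1 / x) ^ 2)" using generator_facts(3)[OF x True] by (metis minus_minus)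
  then show ?thesis
    using order_generated_2_large[OF x True order_p_matrix(1-3)[OF assms(2,3)]] order_p_matrix(4)[OF assms(2,3)] assms(2)
    by simp
next
  case False
  then show ?thesis
    using assms order_generated_2_prime[OF _ order_p_matrix(1-3)[OF assms(2,3)]] order_p_matrix(4)[OF assms(2,3)] by simp
qed

section \<open>Pairs that do not lift\<close>

context
  fixes H1 H2 :: "'a::{field,finite}^2^2" and \<tau> :: 'a
  assumes q: "CARD('a) \<ge> 4" and H: "det H1 = 1" "det H2 = 1"
    and genH: "generating_pair (PSL2 TYPE('a)) (proj H1) (proj H2)"
    and tr: "trace (comm2 H1 H2) = \<tau>"
begin

text \<open>The powers \<open>X\<^sup>i\<close> and \<open>Y\<^sup>j\<close> inherit the exponents of \<open>X\<close> and \<open>Y\<close>, and their commutator has the trace of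
  its conjugate.\<close>

lemma non_lifting_pairI:
  assumes ab: "a > 0" "b > 0" and og: "order_generated TYPE('a) a b" and \<tau>: "\<tau> \<noteq> 2"
    and no: "\<And>X Y i j Q. det X = 1 \<Longrightarrow> det Y = 1 \<Longrightarrow> mpow X a \<approx> mat 1 \<Longrightarrow> mpow Y b \<approx> mat 1 \<Longrightarrow>
      \<not> mpow X i \<approx> mat 1 \<Longrightarrow> \<not> mpow Y j \<approx> mat 1 \<Longrightarrow> det (mpow X i) = 1 \<Longrightarrow> det (mpow Y j) = 1 \<Longrightarrow>
      mpow (mpow X i) a \<approx> mat 1 \<Longrightarrow> mpow (mpow Y j) b \<approx> mat 1 \<Longrightarrow> det Q = 1 \<Longrightarrow>
      Q ** comm2 H1 H2 = comm2 (mpow X i) (mpow Y j) ** Q \<Longrightarrow>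
      trace (comm2 (mpow X i) (mpow Y j)) = \<tau> \<Longrightarrow>
      (\<And>M. det M = 1 \<Longrightarrow> \<exists>w. M \<approx> word_val (letter X Y) w) \<Longrightarrow> False"
  shows "image_with_non_lifting_pair (free_product (C a) (C b)) (PSL2 TYPE('a))"
proof -
  obtain X Y :: "'a^2^2" where XY: "det X = 1" "mpow X a \<approx> mat 1" "det Y = 1" "mpow Y b \<approx> mat 1"
    "generating_pair (PSL2 TYPE('a)) (proj X) (proj Y)"
    using og by (auto simp: order_generated_def)
  show ?thesis
  proof (rule image_with_non_lifting_pairI[OF ab q XY H genH])
    show "trace (comm2 H1 H2) \<noteq> 2" using tr \<tau> by simp
    fix X Y :: "'a^2^2" and i j Q
    assume *: "det X = 1" "det Y = 1" "mpow X a \<approx> mat 1" "mpow Y b \<approx> mat 1" "\<not> mpow X i \<approx> mat 1"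
      "\<not> mpow Y j \<approx> mat 1" "det Q = 1" "Q ** comm2 H1 H2 = comm2 (mpow X i) (mpow Y j) ** Q"
      "\<And>M. det M = 1 \<Longrightarrow> \<exists>w. M \<approx> word_val (letter X Y) w"
    show False
      by (rule no[OF *(1-6) _ _ mpow_power_sgn_one mpow_power_sgn_one *(7,8) _ *(9)])
        (use * tr trace_conj[OF *(8,7)] in \<open>simp_all add: det_mpow\<close>)
  qed
qed

lemma non_lifting_2_3:
  assumes "order_generated TYPE('a) 2 3" "\<tau> \<noteq> 2" "(\<forall>c. \<tau> + 1 \<noteq> c ^ 2) \<or> (2::'a) = 0 \<and> \<tau> = 1"
  shows "image_with_non_lifting_pair (free_product (C 2) (C 3)) (PSL2 TYPE('a))"
proof (rule non_lifting_pairI)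
  fix X Y :: "'a^2^2" and i j Q
  assume *: "det X = 1" "det Y = 1" "mpow X 2 \<approx> mat 1" "mpow Y 3 \<approx> mat 1" "\<not> mpow X i \<approx> mat 1"
    "\<not> mpow Y j \<approx> mat 1" "det (mpow X i) = 1" "det (mpow Y j) = 1"
    "mpow (mpow X i) 2 \<approx> mat 1" "mpow (mpow Y j) 3 \<approx> mat 1"
    "trace (comm2 (mpow X i) (mpow Y j)) = \<tau>"
    "\<And>M. det M = 1 \<Longrightarrow> \<exists>w. M \<approx> word_val (letter X Y) w"
  have "\<tau> + 1 = trace (mpow X i ** mpow Y j) ^ 2"
    using trace_comm2_order_2_3[OF *(7,5,9,8,6,10)] *(11) by simp
  then have "(2::'a) = 0" "\<tau> = 1" using assms(3) by blast+
  then show False using dihedral_too_small[OF _ q *(1,3,2,4,5,6) _ *(12)] *(11) by simp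
qed (use assms in simp_all)

lemma non_lifting_2_p:
  assumes "order_generated TYPE('a) 2 p" "prime p" "CHAR('a) = p" "odd p" "\<forall>c. \<tau> - 2 \<noteq> c ^ 2"
  shows "image_with_non_lifting_pair (free_product (C 2) (C p)) (PSL2 TYPE('a))"
proof (rule non_lifting_pairI)
  show "\<tau> \<noteq> 2" using assms(5) by (metis diff_self zero_power2)
  show "p > 0" using assms(2) by (simp add: prime_gt_0_nat)
  fix X Y :: "'a^2^2" and i j
  assume *: "\<not> mpow X i \<approx> mat 1" "\<not> mpow Y j \<approx> mat 1" "det (mpow X i) = 1" "det (mpow Y j) = 1"
    "mpow (mpow X i) 2 \<approx> mat 1" "mpow (mpow Y j) p \<approx> mat 1" "trace (comm2 (mpow X i) (mpow Y j)) = \<tau>"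
  show False
    using trace_comm2_order_2_p[OF *(3,1,5,4,2,6) assms(2-4)] *(7) assms(5) by metis
qed (use assms in simp_all)

lemma non_lifting_2_m:
  assumes "order_generated TYPE('a) 2 m" "m > 0" "\<And>x::'a. x ^ 2 \<noteq> - 1" "\<tau> = - 2" "comm2 H1 H2 \<noteq> - mat 1"
  shows "image_with_non_lifting_pair (free_product (C 2) (C m)) (PSL2 TYPE('a))"
proof (rule non_lifting_pairI)
  show "\<tau> \<noteq> 2"
  proof
    assume "\<tau> = 2"
    then have "(2::'a) = - 2" using assms(4) by simp
    then have "(4::'a) = 0" by (simp add: eq_neg_iff_add_eq_0)
    then have "(2::'a) = 0" using four_neq_0 by blast
    then have "(1::'a) ^ 2 = - 1" by (simp add: eq_neg_iff_add_eq_0)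
    then show False using assms(3) by blast
  qed
  fix X Y :: "'a^2^2" and i j Q
  assume *: "\<not> mpow X i \<approx> mat 1" "det (mpow X i) = 1" "det (mpow Y j) = 1" "mpow (mpow X i) 2 \<approx> mat 1"
    "det Q = 1" "Q ** comm2 H1 H2 = comm2 (mpow X i) (mpow Y j) ** Q"
    "trace (comm2 (mpow X i) (mpow Y j)) = \<tau>"
  have "comm2 (mpow X i) (mpow Y j) = - mat 1"
    using comm2_trace_minus_2[OF *(2,1,4,3) assms(3)] *(7) assms(4) by simp
  then have "Q ** comm2 H1 H2 = - Q" using *(6) by simp
  then have "adj2 Q ** (Q ** comm2 H1 H2) = - (adj2 Q ** Q)" by simp
  then show False using assms(5) *(5) by (simp add: det_one_adj2)
qed (use assms in simp_all)

lemma non_lifting_3_3: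
  assumes "order_generated TYPE('a) 3 3" "\<forall>c. \<tau> \<noteq> c ^ 2 - c"
  shows "image_with_non_lifting_pair (free_product (C 3) (C 3)) (PSL2 TYPE('a))"
proof (rule non_lifting_pairI)
  have "(2::'a) = 2 ^ 2 - 2" by simp
  then show "\<tau> \<noteq> 2" using assms(2) by metis
  fix X Y :: "'a^2^2" and i j
  assume *: "\<not> mpow X i \<approx> mat 1" "\<not> mpow Y j \<approx> mat 1" "det (mpow X i) = 1" "det (mpow Y j) = 1"
    "mpow (mpow X i) 3 \<approx> mat 1" "mpow (mpow Y j) 3 \<approx> mat 1" "trace (comm2 (mpow X i) (mpow Y j)) = \<tau>"
  show False
    using trace_comm2_order_3_3[OF *(3,1,5,4,2,6)] *(7) assms(2) by metis
qed (use assms in simp_all)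

end

section \<open>Large fields\<close>

lemma large_field_nonsquare:
  assumes "large_field TYPE('a::{field,finite})" "(2::'a) \<noteq> 0"
  shows "\<exists>\<nu>::'a. (\<forall>c. \<nu> \<noteq> c ^ 2) \<and> \<nu> \<noteq> x \<and> \<nu> \<noteq> y"
proof -
  have "\<not> inj (\<lambda>c::'a. c ^ 2)"
  proof
    assume "inj (\<lambda>c::'a. c ^ 2)"
    then have "(1::'a) = - 1" by (rule injD) simp
    then have "(2::'a) = 0" by (simp add: eq_neg_iff_add_eq_0)
    then show False using assms(2) by simp
  qed
  then have "\<not> surj (\<lambda>c::'a. c ^ 2)" using finite_UNIV_surj_inj[of "\<lambda>c::'a. c ^ 2"] by auto
  then obtain n :: 'a where n: "\<And>c. n \<noteq> c ^ 2" by blast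
  then have n0: "n \<noteq> 0" by (metis zero_power2)
  have ns: "\<forall>c. n * v \<noteq> c ^ 2" if v: "v \<in> nz_squares" for v
  proof (intro allI notI)
    fix c assume e: "n * v = c ^ 2"
    obtain s where s: "s \<noteq> 0" "v = s ^ 2" using v by (auto simp: nz_squares_def)
    have "n = (c / s) ^ 2" using e s by (simp add: power_divide field_simps)
    then show False using n by blast
  qed
  have "card ((\<lambda>v. n * v) ` nz_squares) \<ge> 7"
    using large_field_squares[OF assms(1)] n0 by (simp add: card_image inj_on_def)
  moreover have "card {x, y} \<le> 2" by (simp add: card_insert_if)
  ultimately have "\<not> (\<lambda>v. n * v) ` nz_squares \<subseteq> {x, y}" using card_mono[of "{x, y}" "(\<lambda>v. n * v) ` nz_squares"] by auto
  then show ?thesis using ns by blast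
qed

text \<open>In characteristic two the values of \<open>c\<^sup>2 - c\<close> form a proper additive subgroup, so an element outside
  it can be translated inside its coset away from \<open>y\<close>.\<close>

lemma non_artin_schreier:
  assumes "(2::'a::{field,finite}) = 0" "CARD('a) \<ge> 4"
  shows "\<exists>\<tau>::'a. (\<forall>c. \<tau> \<noteq> c ^ 2 - c) \<and> \<tau> \<noteq> y"
proof -
  have "\<not> inj (\<lambda>c::'a. c ^ 2 - c)"
  proof
    assume "inj (\<lambda>c::'a. c ^ 2 - c)"
    then have "(0::'a) = 1" by (rule injD) simp
    then show False by simp
  qed
  then have "\<not> surj (\<lambda>c::'a. c ^ 2 - c)" using finite_UNIV_surj_inj[of "\<lambda>c::'a. c ^ 2 - c"] by auto
  then obtain t :: 'a where t: "\<And>c. t \<noteq> c ^ 2 - c" by blast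
  have "\<not> UNIV \<subseteq> {0, 1::'a}" using assms(2) card_mono[of "{0, 1::'a}" UNIV] by auto
  then obtain e :: 'a where e: "e \<noteq> 0" "e \<noteq> 1" by blast
  have "t + (e ^ 2 - e) \<noteq> c ^ 2 - c" for c
  proof
    assume "t + (e ^ 2 - e) = c ^ 2 - c"
    moreover have "(c - e) ^ 2 - (c - e) = c ^ 2 - c - (e ^ 2 - e) + 2 * (e ^ 2 - c * e)"
      by (simp add: power2_eq_square algebra_simps)
    ultimately have "(c - e) ^ 2 - (c - e) = t + (e ^ 2 - e) - (e ^ 2 - e) + 0 * (e ^ 2 - c * e)"
      by (simp only: assms(1))
    then have "t = (c - e) ^ 2 - (c - e)" by simp
    then show False using t by blast
  qed
  moreover have "e ^ 2 - e \<noteq> 0" using e by (simp add: power2_eq_square)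
  then have "t + (e ^ 2 - e) \<noteq> t" by simp
  ultimately show ?thesis using t by metis
qed

text \<open>In odd characteristic \<open>\<tau> + 1\<close> is made a non-square. In characteristic two every element is a square,
  and \<open>\<tau> = 1\<close> is used instead, which only a dihedral group of order six can attain.\<close>

lemma large_2_3:
  assumes large: "large_field TYPE('a::{field,finite})"
  shows "image_with_non_lifting_pair (free_product (C 2) (C 3)) (PSL2 TYPE('a))"
proof -
  have q: "CARD('a) \<ge> 4" using large unfolding large_field_def by linarith
  obtain x :: 'a where g: "mult_generator x" using finite_field_generator by blast
  note x = generator_facts[OF g large]
  have "\<exists>\<tau>::'a. \<tau> \<noteq> 2 \<and> \<tau> \<noteq> 2 + (x - 1 / x) ^ 2 \<and> ((\<forall>c. \<tau> + 1 \<noteq> c ^ 2) \<or> (2::'a) = 0 \<and> \<tau> = 1)"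
  proof (cases "(2::'a) = 0")
    case True
    then have "(x - 1 / x) ^ 2 \<noteq> 1" using x(4) minus_char_2[OF True, of 1] by simp
    then show ?thesis using True by (intro exI[of _ 1]) auto
  next
    case False
    obtain \<nu> :: 'a where "\<forall>c. \<nu> \<noteq> c ^ 2" "\<nu> \<noteq> 3" "\<nu> \<noteq> 3 + (x - 1 / x) ^ 2"
      using large_field_nonsquare[OF large False] by blast
    then show ?thesis by (intro exI[of _ "\<nu> - 1"]) (auto simp: algebra_simps)
  qed
  then obtain \<tau> :: 'a where \<tau>: "\<tau> \<noteq> 2" "\<tau> \<noteq> 2 + (x - 1 / x) ^ 2"
    "(\<forall>c. \<tau> + 1 \<noteq> c ^ 2) \<or> (2::'a) = 0 \<and> \<tau> = 1" by blast
  from generating_pair_with_trace[OF g large \<tau>(1,2)] obtain \<kappa> where k: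
    "det (mat2 1 \<kappa> 1 (1 + \<kappa>)) = 1"
    "generating_pair (PSL2 TYPE('a)) (proj (torus x)) (proj (mat2 1 \<kappa> 1 (1 + \<kappa>)))"
    "trace (comm2 (torus x) (mat2 1 \<kappa> 1 (1 + \<kappa>))) = \<tau>" by metis
  show ?thesis
    by (rule non_lifting_2_3[OF q det_torus[OF x(1)] k]) (use large \<tau> order_generated_2_3 in auto)
qed

lemma large_2_p:
  assumes large: "large_field TYPE('a::{field,finite})" and p: "prime p" "CHAR('a) = p" "odd p"
    and two: "(2::'a) \<noteq> 0"
  shows "image_with_non_lifting_pair (free_product (C 2) (C p)) (PSL2 TYPE('a))"
proof -
  have q: "CARD('a) \<ge> 4" using large unfolding large_field_def by linarith
  obtain x :: 'a where g: "mult_generator x" using finite_field_generator by blast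
  note x = generator_facts[OF g large]
  obtain \<nu> :: 'a where \<nu>: "\<forall>c. \<nu> \<noteq> c ^ 2" using large_field_nonsquare[OF large two] by blast
  have "2 + \<nu> \<noteq> 2" using \<nu> by (metis add_cancel_left_right zero_power2)
  moreover have "2 + \<nu> \<noteq> 2 + (x - 1 / x) ^ 2" using \<nu> by simp
  ultimately obtain \<kappa> where k:
    "det (mat2 1 \<kappa> 1 (1 + \<kappa>)) = 1"
    "generating_pair (PSL2 TYPE('a)) (proj (torus x)) (proj (mat2 1 \<kappa> 1 (1 + \<kappa>)))"
    "trace (comm2 (torus x) (mat2 1 \<kappa> 1 (1 + \<kappa>))) = 2 + \<nu>"
    using generating_pair_with_trace[OF g large] by metis
  show ?thesis
    by (rule non_lifting_2_p[OF q det_torus[OF x(1)] k order_generated_2_p p])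
      (use large \<nu> two p in auto)
qed

lemma comm2_minus_one:
  assumes "det A = 1" "det B = 1" "comm2 A B = - mat 1"
  shows "A ** B = - (B ** A)"
proof -
  have "comm2 A B ** (B ** A) = A ** B"
    using assms(1,2) by (simp add: comm2_def matrix_mul_assoc[symmetric] det_one_adj2)
  then show ?thesis unfolding assms(3) by simp
qed

lemma large_2_m:
  assumes large: "large_field TYPE('a::{field,finite})" and ns: "\<And>x::'a. x ^ 2 \<noteq> - 1"
    and og: "order_generated TYPE('a) 2 m" "m > 0" and two: "(2::'a) \<noteq> 0"
  shows "image_with_non_lifting_pair (free_product (C 2) (C m)) (PSL2 TYPE('a))"
proof -
  have q: "CARD('a) \<ge> 4" using large unfolding large_field_def by linarith
  obtain x :: 'a where g: "mult_generator x" using finite_field_generator by blast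
  note x = generator_facts[OF g large]
  have four: "(4::'a) \<noteq> 0" using two by (rule four_neq_0)
  have "(- 2::'a) \<noteq> 2"
  proof
    assume "(- 2::'a) = 2"
    then have "(2::'a) + 2 = 0" by (metis add.left_inverse)
    then show False using four by simp
  qed
  moreover have "- 2 \<noteq> 2 + (x - 1 / x) ^ 2"
  proof
    assume "- 2 = 2 + (x - 1 / x) ^ 2"
    then have "(x - 1 / x) ^ 2 = - 2 - 2" by (metis add_diff_cancel_left')
    then show False using x(3) by simp
  qed
  ultimately obtain \<kappa> where k:
    "det (mat2 1 \<kappa> 1 (1 + \<kappa>)) = 1"
    "generating_pair (PSL2 TYPE('a)) (proj (torus x)) (proj (mat2 1 \<kappa> 1 (1 + \<kappa>)))"
    "trace (comm2 (torus x) (mat2 1 \<kappa> 1 (1 + \<kappa>))) = - 2"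
    using generating_pair_with_trace[OF g large] by metis
  have "comm2 (torus x) (mat2 1 \<kappa> 1 (1 + \<kappa>)) \<noteq> - mat 1"
  proof
    assume "comm2 (torus x) (mat2 1 \<kappa> 1 (1 + \<kappa>)) = - mat 1"
    from comm2_minus_one[OF det_torus[OF x(1)] k(1) this] have "x = - x" by (simp add: torus_def)
    then have "x + x = 0" unfolding eq_neg_iff_add_eq_0 .
    then have "2 * x = 0" by (simp only: mult_2)
    then show False using two x(1) by simp
  qed
  then show ?thesis by (intro non_lifting_2_m[OF q det_torus[OF x(1)] k og ns]) simp_all
qed

text \<open>Both this matrix and its quotient with the torus element have trace one, hence order three in the
  projective group.\<close>

lemma triple_3_3:
  fixes x :: "'a::field"
  assumes "x \<noteq> 0" "x + 1 \<noteq> 0"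
  defines "X \<equiv> mat2 (x / (x + 1)) (- (x ^ 2 + x + 1) / (x + 1) ^ 2) 1 (1 / (x + 1))"
  shows "det X = 1" "mpow X 3 \<approx> mat 1" "mpow (adj2 X ** torus x) 3 \<approx> mat 1"
proof -
  have s: "x / (x + 1) + 1 / (x + 1) = 1" using assms by (simp flip: add_divide_distrib)
  show d: "det X = 1"
  proof -
    have "x / (x + 1) * (1 / (x + 1)) = x / (x + 1) ^ 2" by (simp add: power2_eq_square)
    then have "det X = (x - - (x ^ 2 + x + 1)) / (x + 1) ^ 2"
      by (simp only: X_def det_mat2 mult_1_right diff_divide_distrib)
    moreover have "x - - (x ^ 2 + x + 1) = (x + 1) ^ 2" by (simp add: power2_eq_square algebra_simps)
    ultimately show ?thesis using assms by simp
  qed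
  show "mpow X 3 \<approx> mat 1" using d s by (intro order_3I) (simp_all add: X_def)
  have "trace (adj2 X ** torus x) = 1" using s assms by (simp add: X_def torus_def add.commute)
  moreover have "det (adj2 X ** torus x) = 1" using d assms unfolding det_mul det_adj2 by simp
  ultimately show "mpow (adj2 X ** torus x) 3 \<approx> mat 1" by (intro order_3I) simp_all
qed

text \<open>The trace \<open>\<tau>\<close> is not of the form \<open>c\<^sup>2 - c\<close>; in odd characteristic this means that \<open>1 + 4 \<tau>\<close> is not a square.\<close>

lemma large_3_3:
  assumes large: "large_field TYPE('a::{field,finite})"
  shows "image_with_non_lifting_pair (free_product (C 3) (C 3)) (PSL2 TYPE('a))"
proof -
  have q: "CARD('a) \<ge> 4" using large unfolding large_field_def by linarith
  obtain x :: 'a where g: "mult_generator x" using finite_field_generator by blast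
  note x = generator_facts[OF g large]
  have "order_generated TYPE('a) 3 3"
  proof (rule order_generatedI[OF triple_3_3(1) det_torus triple_3_3(2,3)])
    fix K assume K: "SL2_subgroup K" "torus x \<in> K"
      "mat2 (x / (x + 1)) (- (x ^ 2 + x + 1) / (x + 1) ^ 2) 1 (1 / (x + 1)) \<in> K"
    have "- (x ^ 2 + x + 1) / (x + 1) ^ 2 \<noteq> 0" using x(5,6) by (simp del: minus_add_distrib)
    then show "K = {M. det M = 1}"
      using SL2_full_large[OF K(1) g large K(2,3)] x(1,5) by simp
  qed (use x in simp_all)
  moreover have "\<exists>\<tau>::'a. (\<forall>c. \<tau> \<noteq> c ^ 2 - c) \<and> \<tau> \<noteq> 2 + (x - 1 / x) ^ 2"
  proof (cases "(2::'a) = 0")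
    case True then show ?thesis using non_artin_schreier q by blast
  next
    case False
    have four: "(4::'a) \<noteq> 0" using False by (rule four_neq_0)
    obtain \<nu> :: 'a where \<nu>: "\<forall>c. \<nu> \<noteq> c ^ 2" "\<nu> \<noteq> 1 + 4 * (2 + (x - 1 / x) ^ 2)"
      using large_field_nonsquare[OF large False] by blast
    have "(\<nu> - 1) / 4 \<noteq> c ^ 2 - c" for c
    proof
      assume "(\<nu> - 1) / 4 = c ^ 2 - c"
      then have "\<nu> - 1 = 4 * (c ^ 2 - c)" using four by (simp add: field_simps)
      then have "\<nu> = (2 * c - 1) ^ 2" by (simp add: power2_eq_square algebra_simps)
      then show False using \<nu>(1) by blast
    qed
    moreover have "(\<nu> - 1) / 4 \<noteq> 2 + (x - 1 / x) ^ 2"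
    proof
      assume e: "(\<nu> - 1) / 4 = 2 + (x - 1 / x) ^ 2"
      have "\<nu> - 1 = 4 * ((\<nu> - 1) / 4)" using four by simp
      then have "\<nu> = 1 + 4 * (2 + (x - 1 / x) ^ 2)" unfolding e by (simp add: algebra_simps)
      then show False using \<nu>(2) by simp
    qed
    ultimately show ?thesis by blast
  qed
  then obtain \<tau> :: 'a where \<tau>: "\<forall>c. \<tau> \<noteq> c ^ 2 - c" "\<tau> \<noteq> 2 + (x - 1 / x) ^ 2" by blast
  have "(2::'a) = 2 ^ 2 - 2" by simp
  then have "\<tau> \<noteq> 2" using \<tau>(1) by metis
  then obtain \<kappa> where k:
    "det (mat2 1 \<kappa> 1 (1 + \<kappa>)) = 1"
    "generating_pair (PSL2 TYPE('a)) (proj (torus x)) (proj (mat2 1 \<kappa> 1 (1 + \<kappa>)))"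
    "trace (comm2 (torus x) (mat2 1 \<kappa> 1 (1 + \<kappa>))) = \<tau>"
    using generating_pair_with_trace[OF g large _ \<tau>(2)] by metis
  ultimately show ?thesis
    using non_lifting_3_3[OF q det_torus[OF x(1)] k] \<tau>(1) by blast
qed

section \<open>Small fields\<close>

lemma CHAR_prime_card: "prime CARD('a::{field,finite}) \<Longrightarrow> CHAR('a) = CARD('a)"
  using CHAR_eq_prime[where 'a='a and p="CARD('a)" and k=1] by simp

lemma upper_lower_generating_pair:
  fixes c :: "'a::{field,finite}"
  assumes "prime CARD('a)" "c \<noteq> 0"
  shows "generating_pair (PSL2 TYPE('a)) (proj (upper 1)) (proj (mat2 1 0 c 1))"
    "trace (comm2 (upper 1) (mat2 1 0 c 1)) = 2 + c ^ 2"
proof -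
  show "generating_pair (PSL2 TYPE('a)) (proj (upper 1)) (proj (mat2 1 0 c 1))"
    using SL2_full_prime[OF _ assms(1)] assms(2) by (intro generating_pair_PSL2I) auto
  show "trace (comm2 (upper 1) (mat2 1 0 c 1)) = 2 + c ^ 2"
    using trace_comm2_upper[of 1 1 0 c 1] by simp
qed

text \<open>With a transvection as first element the commutator trace is \<open>2 + c\<^sup>2\<close>, so a non-square of the form
  \<open>3 + c\<^sup>2\<close> is wanted.\<close>

lemma prime_field_2_3:
  assumes q: "prime CARD('a::{field,finite})" "CARD('a) \<ge> 4" and k: "0 < k" "k < CARD('a)"
    and ns: "\<forall>j<CARD('a). j * j mod CARD('a) \<noteq> (3 + k * k) mod CARD('a)"
  shows "image_with_non_lifting_pair (free_product (C 2) (C 3)) (PSL2 TYPE('a))"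
proof -
  define c where "c = (of_nat k :: 'a)"
  have c: "c \<noteq> 0"
    using k by (auto simp: c_def of_nat_eq_0_iff_char_dvd CHAR_prime_card[OF q(1)] dest: dvd_imp_le)
  have "2 + c ^ 2 + 1 = of_nat (3 + k * k)" by (simp add: c_def power2_eq_square)
  then have "2 + c ^ 2 + 1 \<noteq> y ^ 2" for y using not_square_prime_field[OF q(1) ns] by metis
  moreover have "2 + c ^ 2 \<noteq> 2" using c by simp
  ultimately show ?thesis
    using non_lifting_2_3[OF q(2) _ _ upper_lower_generating_pair[OF q(1) c]] order_generated_2_3 q(1) by auto
qed

text \<open>Now \<open>1 + 4 (2 + c\<^sup>2) = 9 + 4 c\<^sup>2\<close> has to be a non-square.\<close>

lemma prime_field_3_3:
  assumes q: "prime CARD('a::{field,finite})" "CARD('a) \<ge> 4" and k: "0 < k" "k < CARD('a)"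
    and ns: "\<forall>j<CARD('a). j * j mod CARD('a) \<noteq> (9 + 4 * (k * k)) mod CARD('a)"
  shows "image_with_non_lifting_pair (free_product (C 3) (C 3)) (PSL2 TYPE('a))"
proof -
  define c where "c = (of_nat k :: 'a)"
  have c: "c \<noteq> 0"
    using k by (auto simp: c_def of_nat_eq_0_iff_char_dvd CHAR_prime_card[OF q(1)] dest: dvd_imp_le)
  have nsq: "2 + c ^ 2 \<noteq> y ^ 2 - y" for y
  proof
    assume e: "2 + c ^ 2 = y ^ 2 - y"
    have "of_nat (9 + 4 * (k * k)) = 1 + 4 * (2 + c ^ 2)" by (simp add: c_def power2_eq_square)
    also have "\<dots> = (2 * y - 1) ^ 2" unfolding e by (simp add: power2_eq_square algebra_simps)
    finally show False using not_square_prime_field[OF q(1) ns] by metis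
  qed
  have two: "(2::'a) \<noteq> 0"
    using q of_nat_eq_0_iff_char_dvd[of 2, where 'a='a] CHAR_prime_card[OF q(1)] by (auto dest: dvd_imp_le)
  have d: "det (mat2 0 (- 1 / 2) 2 (1::'a)) = 1" using two by simp
  have "order_generated TYPE('a) 3 3"
  proof (rule order_generatedI[OF d det_upper])
    show "mpow (mat2 0 (- 1 / 2) 2 (1::'a)) 3 \<approx> mat 1" using d by (intro order_3I) simp_all
    show "mpow (adj2 (mat2 0 (- 1 / 2) 2 1) ** upper (1::'a)) 3 \<approx> mat 1"
    proof (rule order_3I)
      show "det (adj2 (mat2 0 (- 1 / 2) 2 1) ** upper (1::'a)) = 1" using d unfolding det_mul det_adj2 by simp
    qed (simp add: upper_def)
    show "K = {M. det M = 1}" if "SL2_subgroup K" "mat2 0 (- 1 / 2) 2 (1::'a) \<in> K" "upper 1 \<in> K" for K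
      using SL2_full_prime[OF that(1) q(1) that(3) _ that(2)] two by simp
  qed
  then show ?thesis
    using non_lifting_3_3[OF q(2) _ _ upper_lower_generating_pair[OF q(1) c]] nsq by auto
qed

text \<open>The free generators of the commutator subgroup of the modular group, which belong to the Markoff
  triple \<open>(3, 3, 3)\<close>, have a parabolic commutator of trace \<open>- 2\<close>.\<close>

lemma Markoff_pair:
  assumes q: "prime CARD('a::{field,finite})" "CARD('a) > 3"
  defines "A \<equiv> mat2 2 (- 1) (- 1) (1::'a)" and "B \<equiv> mat2 2 1 1 (1::'a)"
  shows "det A = 1" "det B = 1" "generating_pair (PSL2 TYPE('a)) (proj A) (proj B)"
    "trace (comm2 A B) = - 2" "comm2 A B \<noteq> - mat 1"
proof -
  show d: "det A = 1" "det B = 1" by (simp_all add: A_def B_def)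
  have c: "comm2 A B = mat2 (- 1) 6 0 (- 1)" by (simp add: comm2_def A_def B_def)
  show "trace (comm2 A B) = - 2" by (simp add: c)
  have ne: "of_nat n \<noteq> (0::'a)" if "coprime CARD('a) n" for n
  proof
    assume "of_nat n = (0::'a)"
    then have "CARD('a) dvd n" by (simp add: of_nat_eq_0_iff_char_dvd CHAR_prime_card[OF q(1)])
    then have "CARD('a) = 1" using that coprime_absorb_left by auto
    then show False using q(2) by simp
  qed
  have "coprime CARD('a) 2" "coprime CARD('a) 3"
    using q primes_coprime[of "CARD('a)" 2] primes_coprime[of "CARD('a)" 3] by simp_all
  then have "coprime CARD('a) (2 * 3)" "coprime CARD('a) (2 * 2 * 3)" by (simp_all only: coprime_mult_right_iff simp_thms)
  then have s: "(6::'a) \<noteq> 0" "(12::'a) \<noteq> 0" using ne[of 6] ne[of 12] by simp_all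
  show "comm2 A B \<noteq> - mat 1" using s by (simp add: c mat_eq_mat2)
  show "generating_pair (PSL2 TYPE('a)) (proj A) (proj B)"
  proof (rule generating_pair_PSL2I[OF d])
    fix K assume K: "SL2_subgroup K" "A \<in> K" "B \<in> K"
    interpret SL2_subgroup K by fact
    have "comm2 A B ** comm2 A B \<in> K" unfolding comm2_def by (intro mult_mem adj_mem K)
    then have "upper (- 12) \<in> K" by (simp add: c upper_def)
    then show "K = {M. det M = 1}" using SL2_full_prime[OF K(1) q(1)] K(3) s by (auto simp: B_def)
  qed
qed

text \<open>For \<open>b c = 2\<close> the number \<open>\<tau> - 2\<close> is \<open>- 2\<close> times a square, and \<open>- 2\<close> is not a square modulo 13.
  The collision of the parameters \<open>s = 1\<close> and \<open>s' = 4\<close> shows that the pair generates.\<close>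

lemma field_13_2_p:
  assumes q: "CARD('a::{field,finite}) = 13"
  shows "image_with_non_lifting_pair (free_product (C 2) (C 13)) (PSL2 TYPE('a))"
proof -
  have pr: "prime CARD('a)" using q by simp
  have ch: "CHAR('a) = 13" using CHAR_prime_card[OF pr] q by simp
  have 13: "(13::'a) = 0" using of_nat_eq_0_iff_char_dvd[of 13, where 'a='a] ch by simp
  have nz: "(2::'a) \<noteq> 0" "(3::'a) \<noteq> 0" "(4::'a) \<noteq> 0" "(7::'a) \<noteq> 0" "(15::'a) \<noteq> 0" "(19::'a) \<noteq> 0"
    using of_nat_eq_0_iff_char_dvd[of 2, where 'a='a] of_nat_eq_0_iff_char_dvd[of 3, where 'a='a]
      of_nat_eq_0_iff_char_dvd[of 4, where 'a='a] of_nat_eq_0_iff_char_dvd[of 7, where 'a='a]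
      of_nat_eq_0_iff_char_dvd[of 15, where 'a='a] of_nat_eq_0_iff_char_dvd[of 19, where 'a='a] ch by simp_all
  obtain x :: 'a where g: "mult_generator x" using finite_field_generator by blast
  then have x: "x \<noteq> 0" by (simp add: mult_generator_def)
  have "x ^ 2 \<noteq> 1" using mult_generator_power[OF g, of 2] q by auto
  then have x2: "x - 1 / x \<noteq> 0" using x by (auto simp: field_simps power2_eq_square)
  have d: "det (mat2 1 1 2 (3::'a)) = 1" by simp
  define w where "w = 1 / (4::'a)"
  have w: "4 * w = 1" using nz by (simp add: w_def)
  have gen: "generating_pair (PSL2 TYPE('a)) (proj (torus x)) (proj (mat2 1 1 2 3))"
  proof (rule generating_pair_PSL2I[OF det_torus[OF x] d])
    fix K assume K: "SL2_subgroup K" "torus x \<in> K" "mat2 1 1 2 3 \<in> K"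
    interpret SL2_subgroup K by fact
    show "K = {M. det M = 1}"
    proof (rule full_if_torus_and_collision[OF torus_mem_if_generator[OF g K(2)] K(3), where s = 1 and s' = 4 and r = 2])
      show "1 * 4 + 3 / 4 \<noteq> (0::'a)"
      proof
        assume "1 * 4 + 3 / 4 = (0::'a)"
        then have "4 + 3 * w = 0" by (simp add: w_def)
        moreover have "(19::'a) = 4 * (4 + 3 * w) + 3 * (1 - 4 * w)" by (simp add: algebra_simps)
        ultimately have "(19::'a) = 0" using w by simp
        then show False using nz by simp
      qed
      have "2 ^ 2 * (1 ^ 2 * 1 + 1 * 2) * (1 * 4 + 3 * w) = 48 + 9 * (4 * w)"
        "(1 ^ 2 * 4 + 1 * 2 * w) * (1 * 1 + 3) = 16 + 2 * (4 * w)"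
        by (simp_all add: power2_eq_square algebra_simps)
      moreover have "48 + 9 * 1 = 16 + 2 * 1 + 13 * (3::'a)" by simp
      ultimately have "2 ^ 2 * (1 ^ 2 * 1 + 1 * 2) * (1 * 4 + 3 * w) = (1 ^ 2 * 4 + 1 * 2 * w) * (1 * 1 + 3)"
        unfolding w 13 by simp
      then show "2\<^sup>2 * (1\<^sup>2 * 1 + 1 * 2 / 1) * (1 * 4 + 3 / 4) = (1\<^sup>2 * 4 + 1 * 2 / 4) * (1 * 1 + 3 / (1::'a))"
        by (simp add: w_def)
      have "(15::'a) = 4 ^ 2 - 1 ^ 2" "(7::'a) = 1 ^ 2 * 4 ^ 2 * 1 ^ 2 - 3 ^ 2" by simp_all
      then show "1 ^ 2 \<noteq> (4::'a) ^ 2" "1 ^ 2 * 4 ^ 2 * 1 ^ 2 \<noteq> (3::'a) ^ 2"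
        using nz(4,5) by (metis diff_self)+
    qed (use nz in simp_all)
  qed
  have "- 2 * (x - 1 / x) ^ 2 \<noteq> c ^ 2" for c
  proof
    assume "- 2 * (x - 1 / x) ^ 2 = c ^ 2"
    then have "- 2 = (c / (x - 1 / x)) ^ 2" using x2 by (simp add: power_divide nonzero_eq_divide_eq)
    moreover have "(- 2::'a) = of_nat 11"
    proof -
      have "of_nat 11 = - 2 + (13::'a)" by simp
      then show ?thesis unfolding 13 by simp
    qed
    moreover have "\<forall>j\<in>{..<13::nat}. j * j mod 13 \<noteq> 11 mod 13" by (simp add: lessThan_nat_numeral lessThan_Suc)
    then have "\<forall>j<CARD('a). j * j mod CARD('a) \<noteq> 11 mod CARD('a)" unfolding q by simp
    ultimately show False using not_square_prime_field[OF pr] by metis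
  qed
  moreover have "trace (comm2 (torus x) (mat2 1 1 2 3)) = 2 - 2 * (x - 1 / x) ^ 2"
    using trace_comm2_torus[OF x, of 1 3 1 2] by simp
  ultimately show ?thesis
    using non_lifting_2_p[OF _ det_torus[OF x] d gen, of _ 13] order_generated_2_p[where 'a='a and m=13] ch nz q by simp
qed

text \<open>Over the field with four elements the generator \<open>x\<close> of the multiplicative group is a cube root of
  unity, so that the torus element itself has order three.\<close>

lemma field_4_2_3:
  assumes q: "CARD('a::{field,finite}) = 4"
  shows "image_with_non_lifting_pair (free_product (C 2) (C 3)) (PSL2 TYPE('a))"
proof -
  have two: "(2::'a) = 0" using q by (simp add: two_eq_0_iff_even)
  obtain x :: 'a where g: "mult_generator x" using finite_field_generator by blast
  then have x: "x \<noteq> 0" by (simp add: mult_generator_def)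
  have x1: "x \<noteq> 1" "x ^ 2 \<noteq> 1" using mult_generator_power[OF g, of 1] mult_generator_power[OF g, of 2] q by auto
  have x3: "x ^ 3 = 1" using finite_field_power[OF x] q by simp
  have "(x - 1) * (x ^ 2 + x + 1) = x ^ 3 - 1" by (simp add: power2_eq_square power3_eq_cube algebra_simps)
  then have xx: "x ^ 2 + x + 1 = 0" using x1 x3 by simp
  have torus3: "mpow (torus x) 3 \<approx> mat 1"
    using x x3 by (simp add: torus_def numeral_3_eq_3 mat_eq_mat2 power3_eq_cube mult_ac)
  let ?X = "mat2 x x 1 x"
  have dX: "det ?X = 1"
  proof -
    have "x * x - x = 1 + 2 * (- x - 1)" using xx by Groebner_Basis.algebra
    then show ?thesis unfolding two by simp
  qed
  have full: "K = {M. det M = 1}" if "SL2_subgroup K" "torus x \<in> K" "mat2 0 b c d \<in> K" "d \<noteq> 0" for K and b c d :: 'a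
  proof -
    interpret SL2_subgroup K by fact
    show ?thesis
      using full_if_torus_and_swap[OF torus_mem_if_generator[OF g that(2)] that(3,4) x x1(2)] by simp
  qed
  have "generating_pair (PSL2 TYPE('a)) (proj ?X) (proj (torus x))"
  proof (rule generating_pair_PSL2I[OF dX det_torus[OF x]])
    fix K assume K: "SL2_subgroup K" "?X \<in> K" "torus x \<in> K"
    interpret SL2_subgroup K by fact
    have "?X ** torus x ** ?X \<in> K" by (intro mult_mem K)
    also have "?X ** torus x ** ?X = mat2 0 (1 + x) (x ^ 2 + 1) 1"
    proof -
      have "x * x * x + 1 = 2" "x * x * x + x = 1 + x" "x * x + x = 1 + 2 * (- 1)"
        using xx by Groebner_Basis.algebra+
      then have "x * x * x + 1 = 0" "x * x * x + x = 1 + x" "x * x + x = 1" unfolding two by simp_all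
      then show ?thesis using x by (simp add: torus_def power2_eq_square)
    qed
    finally show "K = {M. det M = 1}" using full[OF K(1,3)] by simp
  qed
  moreover have "mpow ?X 2 \<approx> mat 1" using order_2I[OF dX] two by (simp flip: mult_2)
  ultimately have og: "order_generated TYPE('a) 2 3"
    unfolding order_generated_def using dX det_torus[OF x] torus3 by blast
  have "- (1::'a) = 1 + 2 * (- 1)" by simp
  then have "- (1::'a) = 1" unfolding two by simp
  then have dB: "det (mat2 0 1 1 (1::'a)) = 1" by simp
  have gen: "generating_pair (PSL2 TYPE('a)) (proj (torus x)) (proj (mat2 0 1 1 1))"
    using full by (intro generating_pair_PSL2I[OF det_torus[OF x] dB]) auto
  have "trace (comm2 (torus x) (mat2 0 1 1 1)) = 2 - (x - 1 / x) ^ 2"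
    using trace_comm2_torus[OF x, of 0 1 1 1] dB by simp
  also have "1 / x = x ^ 2" using x x3 by (simp add: field_simps power2_eq_square power3_eq_cube)
  also have "2 - (x - x ^ 2) ^ 2 = 1 + 2 * 2" using xx by Groebner_Basis.algebra
  also have "1 + 2 * 2 = (1::'a)" unfolding two by simp
  finally have "trace (comm2 (torus x) (mat2 0 1 1 1)) = 1" .
  then show ?thesis
    using non_lifting_2_3[OF _ det_torus[OF x] dB gen _ og] two q by simp
qed

text \<open>In characteristic three \<open>x\<^sup>2 + x + 1 = (x - 1)\<^sup>2\<close> is a square, so the element with
  parameter \<open>s = (x - 1) / x\<close> makes the upper left entry of \<open>X t X\<close> vanish. For the pair that does not lift,
  \<open>x\<^sup>2\<close> is a square root of \<open>- 1\<close> and \<open>1 + x\<^sup>2\<close> is not a square because its fourth power is \<open>- 1\<close>.\<close>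

lemma field_9_3_3:
  assumes q: "CARD('a::{field,finite}) = 9"
  shows "image_with_non_lifting_pair (free_product (C 3) (C 3)) (PSL2 TYPE('a))"
proof -
  have "CHAR('a) = 3" using CHAR_eq_prime[where 'a='a and p=3 and k=2] q by simp
  then have three: "(3::'a) = 0" using of_nat_eq_0_iff_char_dvd[of 3, where 'a='a] by simp
  obtain x :: 'a where g: "mult_generator x" using finite_field_generator by blast
  then have x: "x \<noteq> 0" by (simp add: mult_generator_def)
  have ne: "x ^ k \<noteq> 1" if "0 < k" "k < 8" for k using mult_generator_power[OF g, of k] that q by auto
  have x8: "y ^ 8 = 1" if "y \<noteq> 0" for y :: 'a using finite_field_power[OF that] q by simp
  have "(x ^ 4) ^ 2 = 1" using x8[OF x] by (simp flip: power_mult)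
  then have "x ^ 4 = 1 \<or> x ^ 4 = - 1" unfolding power2_eq_1_iff .
  then have x4: "x ^ 4 = - 1" using ne[of 4] by auto
  have x1: "x ^ 2 \<noteq> 1" "x - 1 \<noteq> 0" using ne[of 2] ne[of 1] by auto
  have xp: "x + 1 \<noteq> 0"
  proof
    assume "x + 1 = 0"
    then have "x = - 1" by (simp add: eq_neg_iff_add_eq_0)
    then show False using x1 by simp
  qed
  have xsq: "x ^ 2 + 1 \<noteq> 0"
  proof
    assume "x ^ 2 + 1 = 0"
    then have "x ^ 4 = 1" by Groebner_Basis.algebra
    then show False using ne[of 4] by simp
  qed
  have og: "order_generated TYPE('a) 3 3"
  proof (rule order_generatedI[OF triple_3_3(1)[OF x xp] det_torus[OF x] triple_3_3(2,3)[OF x xp]])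
    fix K assume K: "SL2_subgroup K" "torus x \<in> K"
      "mat2 (x / (x + 1)) (- (x ^ 2 + x + 1) / (x + 1) ^ 2) 1 (1 / (x + 1)) \<in> K"
    interpret SL2_subgroup K by fact
    define e s t where "e = 1 / (x + 1)" and "s = (x - 1) / x" and "t = x / (x - 1)"
    have xs: "x * s = x - 1" and xt: "(x - 1) * t = x" using x x1 by (simp_all add: s_def t_def)
    have s0: "s \<noteq> 0" and ts: "1 / s = t" using x x1 by (simp_all add: s_def t_def)
    define \<beta> where "\<beta> = - (x ^ 2 + x + 1) * e ^ 2"
    have e0: "e \<noteq> 0" using xp by (simp add: e_def)
    have "- (x ^ 2 + x + 1) / (x + 1) ^ 2 = \<beta>" "x / (x + 1) = x * e" "1 / (x + 1) = e"
      unfolding \<beta>_def e_def by (simp_all add: power_divide)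
    then have X: "mat2 (x * e) \<beta> 1 e \<in> K" using K(3) by simp
    let ?X = "mat2 (x * e) \<beta> 1 e"
    have T: "torus s \<in> K" by (rule torus_mem_if_generator[OF g K(2) s0])
    have "?X ** torus s ** ?X \<in> K" by (intro mult_mem X T)
    moreover obtain B C' where P: "?X ** torus s ** ?X = mat2 (x * e * s * (x * e) + \<beta> * t) B C' (s * \<beta> + e * t * e)"
      by (simp add: torus_def ts)
    define A D where "A = x * e * s * (x * e) + \<beta> * t" and "D = s * \<beta> + e * t * e"
    have AD: "A = e ^ 2 * (x ^ 2 * s - (x ^ 2 + x + 1) * t)" "D = e ^ 2 * (t - (x ^ 2 + x + 1) * s)"
      unfolding A_def D_def \<beta>_def by (simp_all add: power2_eq_square algebra_simps)
    have "A = 0"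
    proof -
      have "x ^ 2 * s - (x ^ 2 + x + 1) * t = 3 * (- (x * t))" using xs xt by Groebner_Basis.algebra
      then show ?thesis using AD(1) unfolding three by simp
    qed
    moreover have "D \<noteq> 0"
    proof
      assume "D = 0"
      then have "t - (x ^ 2 + x + 1) * s = 0" using AD(2) e0 by simp
      then have "(x ^ 2 + 1) * (x + 1) ^ 2 = 3 * (x ^ 3 + x ^ 2 + x)" using xs xt by Groebner_Basis.algebra
      then show False using xp xsq unfolding three by simp
    qed
    ultimately show "K = {M. det M = 1}"
      using full_if_torus_and_swap[OF torus_mem_if_generator[OF g K(2)] _ _ x x1(1), of B C' D] P
      unfolding A_def[symmetric] D_def[symmetric] by simp
  qed
  have inv: "1 / x ^ 3 = - x" using x x4 by (simp add: field_simps power3_eq_cube power4_eq_xxxx)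
  let ?B = "mat2 1 1 (- (1 + x ^ 2)) (- (x ^ 2))"
  have dB: "det ?B = 1" by simp
  have gen: "generating_pair (PSL2 TYPE('a)) (proj (torus x)) (proj ?B)"
  proof (rule generating_pair_PSL2I[OF det_torus[OF x] dB])
    fix K assume K: "SL2_subgroup K" "torus x \<in> K" "?B \<in> K"
    interpret SL2_subgroup K by fact
    show "K = {M. det M = 1}"
    proof (rule full_if_torus_and_collision[OF torus_mem_if_generator[OF g K(2)] K(3), where s = 1 and s' = "x ^ 3" and r = "x ^ 3"])
      have i2: "- (x ^ 2) / x ^ 3 = x ^ 3" "1 * - (1 + x ^ 2) / x ^ 3 = (1 + x ^ 2) * x"
      proof -
        have dv: "u / x ^ 3 = - (x * u)" for u
        proof -
          have "u / x ^ 3 = u * (1 / x ^ 3)" by simp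
          then show ?thesis unfolding inv by simp
        qed
        show "- (x ^ 2) / x ^ 3 = x ^ 3" "1 * - (1 + x ^ 2) / x ^ 3 = (1 + x ^ 2) * x"
          unfolding dv by (simp_all add: power2_eq_square power3_eq_cube algebra_simps)
      qed
      have "1 * x ^ 3 + x ^ 3 = - (x ^ 3) + 3 * x ^ 3" by simp
      then have sum: "1 * x ^ 3 + x ^ 3 = - (x ^ 3) + 0 * x ^ 3" unfolding three .
      show "1 * x ^ 3 + - (x ^ 2) / x ^ 3 \<noteq> 0" unfolding i2 sum using x by simp
      show "(x ^ 3)\<^sup>2 * (1\<^sup>2 * 1 + 1 * - (1 + x\<^sup>2) / 1) * (1 * x ^ 3 + - (x\<^sup>2) / x ^ 3) =
          (1\<^sup>2 * x ^ 3 + 1 * - (1 + x\<^sup>2) / x ^ 3) * (1 * 1 + - (x\<^sup>2) / 1)"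
      proof -
        have "(x ^ 3)\<^sup>2 * (1 + - (1 + x\<^sup>2)) * (x ^ 3 + x ^ 3) =
            (x ^ 3 + (1 + x\<^sup>2) * x) * (1 + - (x\<^sup>2)) + 3 * (- (x ^ 3) - x)"
          using x4 by Groebner_Basis.algebra
        then have "(x ^ 3)\<^sup>2 * (1 + - (1 + x\<^sup>2)) * (x ^ 3 + x ^ 3) =
            (x ^ 3 + (1 + x\<^sup>2) * x) * (1 + - (x\<^sup>2))"
          unfolding three by (simp only: mult_zero_left add_0_right)
        then show ?thesis unfolding i2 div_by_1 by (simp only: power_one mult_1_left mult_1_right)
      qed
      show "- (1 + x ^ 2) \<noteq> 0" using xsq by (simp add: add.commute del: minus_add_distrib)
      show "1\<^sup>2 \<noteq> (x ^ 3)\<^sup>2" using ne[of 6] by (simp flip: power_mult)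
      show "1\<^sup>2 * (x ^ 3)\<^sup>2 * 1\<^sup>2 \<noteq> (- (x\<^sup>2))\<^sup>2"
      proof
        assume "1\<^sup>2 * (x ^ 3)\<^sup>2 * 1\<^sup>2 = (- (x\<^sup>2))\<^sup>2"
        then have "x ^ 6 = x ^ 4" by (simp flip: power_mult)
        moreover have "x ^ 6 = x ^ 2 * x ^ 4" by (simp flip: power_add)
        ultimately have "x ^ 2 = 1" using x4 by simp
        then show False using x1 by simp
      qed
    qed (use x x1 in simp_all)
  qed
  have "trace (comm2 (torus x) ?B) = 2 - 1 * - (1 + x ^ 2) * (x - 1 / x) ^ 2"
    by (rule trace_comm2_torus[OF x]) simp
  also have "1 / x = - (x ^ 3)" using x x4 by (simp add: field_simps power3_eq_cube power4_eq_xxxx)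
  also have "2 - 1 * - (1 + x ^ 2) * (x - - (x ^ 3)) ^ 2 = x ^ 2 + 3 * (- (x ^ 2))"
    using x4 by Groebner_Basis.algebra
  also have "x ^ 2 + 3 * (- (x ^ 2)) = x ^ 2" unfolding three by simp
  finally have tr: "trace (comm2 (torus x) ?B) = x ^ 2" .
  have "x ^ 2 \<noteq> c ^ 2 - c" for c
  proof
    assume "x ^ 2 = c ^ 2 - c"
    then have "(2 * c - 1) ^ 2 = 1 + x ^ 2 + 3 * x ^ 2" by Groebner_Basis.algebra
    then have y: "(2 * c - 1) ^ 2 = 1 + x ^ 2" unfolding three by simp
    then have "2 * c - 1 \<noteq> 0" using xsq by (auto simp: add.commute)
    then have "(2 * c - 1) ^ 8 = 1" by (rule x8)
    moreover have "(2 * c - 1) ^ 8 = ((2 * c - 1) ^ 2) ^ 4" by (simp flip: power_mult)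
    ultimately have "(1 + x ^ 2) ^ 4 = 1" unfolding y by simp
    moreover have "(1 + x ^ 2) ^ 4 = - 4" using x4 by Groebner_Basis.algebra
    ultimately have "1 = (- 4::'a)" by simp
    then have "1 + 4 = (0::'a)" unfolding eq_neg_iff_add_eq_0 .
    then have "(5::'a) = 0" by simp
    moreover have "(1::'a) = 3 * 2 - 5" by simp
    ultimately have "(1::'a) = 0" unfolding three by simp
    then show False by simp
  qed
  then show ?thesis
    using non_lifting_3_3[OF _ det_torus[OF x] dB gen tr og] q by simp
qed

section \<open>Elements whose order divides half of q - 1 or half of q + 1\<close>

text \<open>The torus contains an element \<open>W\<close> with \<open>W\<^sup>e = - 1\<close>, and its trace \<open>\<mu> + 1 / \<mu>\<close> vanishes only if \<open>- 1\<close> is a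
  square.\<close>

lemma split_element:
  assumes q: "CARD('a::{field,finite}) mod 4 = 3" and e: "e dvd (CARD('a) - 1) div 2" "e \<ge> 3" "e dvd m"
  shows "\<exists>W::'a^2^2. det W = 1 \<and> \<not> W \<approx> mat 1 \<and> mpow W m \<approx> mat 1 \<and> trace W \<noteq> 0"
proof -
  obtain x :: 'a where g: "mult_generator x" using finite_field_generator by blast
  then have x: "x \<noteq> 0" by (simp add: mult_generator_def)
  obtain t where t: "(CARD('a) - 1) div 2 = e * t" using e(1) by blast
  have card: "CARD('a) - 1 = 2 * (e * t)" using q t by presburger
  have tpos: "t > 0" using card q by (cases "t = 0") auto
  define \<mu> where "\<mu> = x ^ t"
  have m0: "\<mu> \<noteq> 0" using x by (simp add: \<mu>_def)
  have "(\<mu> ^ e) ^ 2 = x ^ (CARD('a) - 1)" unfolding card \<mu>_def by (simp flip: power_mult add: mult_ac)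
  then have "(\<mu> ^ e) ^ 2 = 1" using finite_field_power[OF x] by simp
  moreover have "\<mu> ^ e \<noteq> 1"
  proof
    assume "\<mu> ^ e = 1"
    then have "x ^ (t * e) = 1" by (simp add: \<mu>_def power_mult)
    then have "CARD('a) - 1 \<le> t * e" using mult_generator_power[OF g, of "t * e"] tpos e by simp
    moreover have "0 < t * e" using tpos e by simp
    ultimately show False using card by (simp add: mult.commute)
  qed
  ultimately have me: "\<mu> ^ e = - 1" by (simp add: power2_eq_1_iff)
  have "torus (- 1::'a) \<approx> mat 1" by (simp add: torus_def mat_eq_mat2 sgn_eq_def)
  then have "mpow (torus \<mu>) e \<approx> mat 1" using torus_power[of \<mu> e] me by simp
  moreover obtain k where "m = e * k" using e(3) by blast
  ultimately have "mpow (torus \<mu>) m \<approx> mat 1" using sgn_eq_mpow[of "mpow (torus \<mu>) e" "mat 1" k] by (simp add: mpow_mult)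
  moreover have "\<not> torus \<mu> \<approx> mat 1"
  proof
    assume "torus \<mu> \<approx> mat 1"
    then have "\<mu> = 1 \<or> \<mu> = - 1" by (auto simp: torus_def mat_eq_mat2 sgn_eq_def)
    then have "\<mu> ^ 2 = 1" by auto
    then have "x ^ (t * 2) = 1" by (simp add: \<mu>_def power_mult)
    then have "2 * (e * t) \<le> t * 2" using mult_generator_power[OF g, of "t * 2"] tpos card by simp
    then have "e \<le> 1" using tpos by simp
    then show False using e by simp
  qed
  moreover have "trace (torus \<mu>) \<noteq> 0"
  proof
    assume "trace (torus \<mu>) = 0"
    then have "\<mu> + 1 / \<mu> = 0" by (simp add: torus_def)
    then have "\<mu> * (\<mu> + 1 / \<mu>) = 0" by simp
    then have "\<mu> ^ 2 = - 1" using m0 by (simp add: distrib_left power2_eq_square eq_neg_iff_add_eq_0)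
    then show False using no_square_minus_one[OF q] by blast
  qed
  ultimately show ?thesis using det_torus[OF m0] by blast
qed

text \<open>When \<open>- 1\<close> is not a square, the matrices of similitudes \<open>a + b i\<close> form a field with \<open>q\<^sup>2\<close>
  elements, on which the determinant is the norm.\<close>

definition complex_mats :: "('a::field^2^2) set" where
  "complex_mats = {mat2 a (- b) b a | a b. True}"

lemma complex_mats_mem [simp]: "mat2 a (- b) b a \<in> complex_mats"
  by (auto simp: complex_mats_def)

lemma complex_matsE:
  assumes "M \<in> complex_mats" obtains a b where "M = mat2 a (- b) b a"
  using assms by (auto simp: complex_mats_def)

lemma complex_mats_0_1: "0 \<in> (complex_mats :: ('a::field^2^2) set)" "mat 1 \<in> (complex_mats :: ('a^2^2) set)"
  using complex_mats_mem[of 0 "0::'a"] complex_mats_mem[of 1 "0::'a"] by (simp_all add: zero_mat2 mat_eq_mat2)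

lemma complex_mats_closed:
  assumes "M \<in> complex_mats" "N \<in> complex_mats"
  shows "M ** N \<in> complex_mats" "M + N \<in> complex_mats" "M ** N = N ** M"
proof -
  obtain a b where M: "M = mat2 a (- b) b a" by (rule complex_matsE[OF assms(1)])
  obtain c d where N: "N = mat2 c (- d) d c" by (rule complex_matsE[OF assms(2)])
  have "M ** N = mat2 (a * c - b * d) (- (a * d + b * c)) (a * d + b * c) (a * c - b * d)"
    "M + N = mat2 (a + c) (- (b + d)) (b + d) (a + c)"
    by (simp_all add: M N algebra_simps)
  then show "M ** N \<in> complex_mats" "M + N \<in> complex_mats" by (metis complex_mats_mem)+
  show "M ** N = N ** M" by (simp add: M N algebra_simps)
qed

lemma card_complex_mats: "card (complex_mats :: ('a::{field,finite}^2^2) set) = CARD('a) ^ 2"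
proof -
  have "complex_mats = (\<lambda>(a, b). mat2 a (- b) b a) ` (UNIV :: ('a \<times> 'a) set)"
    by (auto simp: complex_mats_def)
  moreover have "card ((\<lambda>(a, b). mat2 a (- b) b (a::'a)) ` UNIV) = card (UNIV :: ('a \<times> 'a) set)"
    by (rule card_image) (auto simp: inj_on_def)
  ultimately have "card (complex_mats :: ('a^2^2) set) = card (UNIV :: ('a \<times> 'a) set)" by simp
  then show ?thesis by (simp only: card_cartesian_product power2_eq_square UNIV_Times_UNIV[symmetric])
qed

lemma complex_mats_generator:
  assumes ns: "\<And>x::'a::{field,finite}. x ^ 2 \<noteq> - 1"
  shows "\<exists>G::'a^2^2. G \<in> complex_mats \<and> G \<noteq> 0 \<and> (\<forall>M\<in>complex_mats. M \<noteq> 0 \<longrightarrow> (\<exists>n. M = mpow G n)) \<and>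
    mpow G (CARD('a) ^ 2 - 1) = mat 1"
proof -
  define R :: "('a^2^2) ring" where
    "R = \<lparr>carrier = complex_mats, monoid.mult = (**), one = mat 1, zero = 0, add = (+)\<rparr>"
  have n0: "a ^ 2 + b ^ 2 \<noteq> 0" if "a \<noteq> 0 \<or> b \<noteq> 0" for a b :: 'a
  proof
    assume e: "a ^ 2 + b ^ 2 = 0"
    have "b \<noteq> 0" using e that by auto
    then have "(a / b) ^ 2 = - 1" using e by (simp add: power_divide eq_neg_iff_add_eq_0 field_simps)
    then show False using ns by blast
  qed
  have distrib: "(M + N) ** P = M ** P + N ** P" for M N P :: "'a^2^2"
  proof -
    obtain a b c d where M: "M = mat2 a b c d" by (rule mat2_cases)
    obtain a' b' c' d' where N: "N = mat2 a' b' c' d'" by (rule mat2_cases)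
    show ?thesis unfolding M N by (cases P rule: mat2_cases) (simp add: algebra_simps)
  qed
  have R: "field R"
  proof (rule cring.cring_fieldI)
    show "cring R"
    proof (rule cringI)
      show "abelian_group R"
      proof (rule abelian_groupI)
        fix M assume "M \<in> carrier R"
        then obtain a b where M: "M = mat2 a (- b) b a" using complex_matsE by (auto simp: R_def)
        show "\<exists>N\<in>carrier R. N \<oplus>\<^bsub>R\<^esub> M = \<zero>\<^bsub>R\<^esub>"
          by (intro bexI[of _ "mat2 (- a) (- (- b)) (- b) (- a)"]) (simp_all add: R_def M zero_mat2 del: minus_minus)
      qed (auto simp: R_def complex_mats_closed complex_mats_0_1 algebra_simps)
      show "comm_monoid R"
        by (rule comm_monoidI) (simp_all add: R_def complex_mats_closed(1) complex_mats_0_1 matrix_mul_assoc, rule complex_mats_closed(3))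
    qed (simp add: R_def distrib)
    show "Units R = carrier R - {\<zero>\<^bsub>R\<^esub>}"
    proof
      show "Units R \<subseteq> carrier R - {\<zero>\<^bsub>R\<^esub>}"
        by (auto simp: R_def Units_def mat_eq_mat2 zero_mat2) (metis mat2_cases mat2_mult mat2_eq_iff mult_zero_right add_0 zero_neq_one)
      show "carrier R - {\<zero>\<^bsub>R\<^esub>} \<subseteq> Units R"
      proof
        fix M assume M: "M \<in> carrier R - {\<zero>\<^bsub>R\<^esub>}"
        then obtain a b where ab: "M = mat2 a (- b) b a" using complex_matsE by (auto simp: R_def)
        then have "a \<noteq> 0 \<or> b \<noteq> 0" using M by (auto simp: R_def zero_mat2)
        then have n: "a ^ 2 + b ^ 2 \<noteq> 0" by (rule n0)
        let ?N = "mat2 (a / (a ^ 2 + b ^ 2)) (- (- b / (a ^ 2 + b ^ 2))) (- b / (a ^ 2 + b ^ 2)) (a / (a ^ 2 + b ^ 2))"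
        have N: "?N \<in> complex_mats" by (rule complex_mats_mem)
        have "M ** ?N = mat 1" using n
          by (simp add: ab mat_eq_mat2 flip: add_divide_distrib) (simp add: power2_eq_square)
        moreover have "?N ** M = M ** ?N" using complex_mats_closed(3)[OF N, of M] M by (simp add: R_def)
        ultimately show "M \<in> Units R" using M N unfolding Units_def by (auto simp: R_def)
      qed
    qed
  qed
  interpret F: field R by (rule R)
  let ?U = "Multiplicative_Group.mult_of R"
  interpret U: group ?U by (rule F.field_mult_group)
  have pow: "M [^]\<^bsub>R\<^esub> n = mpow M n" if "M \<in> complex_mats" for M and n :: nat
    using that
  proof (induction n)
    case (Suc n)
    have "mpow M n \<in> complex_mats" using Suc.prems by (induction n) (simp_all add: complex_mats_0_1 complex_mats_closed)
    then show ?case using Suc by (simp add: F.nat_pow_Suc) (simp add: R_def complex_mats_closed(3))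
  qed (simp add: R_def)
  have fin: "finite (carrier R)" by (simp add: R_def)
  from F.finite_field_mult_group_has_gen[OF fin]
  obtain G where G: "G \<in> carrier ?U" "carrier ?U = {G [^]\<^bsub>R\<^esub> i | i::nat. i \<in> UNIV}" by blast
  then have GC: "G \<in> complex_mats" "G \<noteq> 0" by (auto simp: R_def Multiplicative_Group.carrier_mult_of)
  have gen: "\<exists>n. M = mpow G n" if "M \<in> complex_mats" "M \<noteq> 0" for M
  proof -
    have "M \<in> carrier ?U" using that by (simp add: R_def Multiplicative_Group.carrier_mult_of)
    then show ?thesis using G(2) pow[OF GC(1)] by auto
  qed
  have "Coset.order ?U = CARD('a) ^ 2 - 1"
    using complex_mats_0_1(1)[where 'a='a] by (simp add: Coset.order_def Multiplicative_Group.carrier_mult_of R_def card_Diff_singleton card_complex_mats)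
  then have "G [^]\<^bsub>?U\<^esub> (CARD('a) ^ 2 - 1) = \<one>\<^bsub>?U\<^esub>" using U.pow_order_eq_1[OF G(1)] by simp
  then have "mpow G (CARD('a) ^ 2 - 1) = mat 1"
    using pow[OF GC(1)] by (simp add: Multiplicative_Group.nat_pow_mult_of) (simp add: R_def)
  then show ?thesis using GC gen by blast
qed

text \<open>The power \<open>W = G\<^sup>D\<close> of a generator \<open>G\<close> of this field with \<open>2 e D = q\<^sup>2 - 1\<close> has order \<open>2 e\<close>, which is at
  least six; so \<open>W\<^sup>e = - 1\<close> but \<open>W\<^sup>2\<close> is neither \<open>1\<close> nor \<open>- 1\<close>. Its norm \<open>(det G)\<^sup>D\<close> is one because \<open>q - 1\<close>
  divides \<open>D\<close>.\<close>

lemma nonsplit_element: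
  assumes q: "CARD('a::{field,finite}) mod 4 = 3" and e: "e dvd (CARD('a) + 1) div 2" "e \<ge> 3" "e dvd m"
  shows "\<exists>W::'a^2^2. det W = 1 \<and> \<not> W \<approx> mat 1 \<and> mpow W m \<approx> mat 1 \<and> trace W \<noteq> 0"
proof -
  note ns = no_square_minus_one[OF q]
  obtain G :: "'a^2^2" where G: "G \<in> complex_mats" "G \<noteq> 0" "\<forall>M\<in>complex_mats. M \<noteq> 0 \<longrightarrow> (\<exists>n. M = mpow G n)"
    "mpow G (CARD('a) ^ 2 - 1) = mat 1" using complex_mats_generator[OF ns] by blast
  define N where "N = CARD('a) ^ 2 - 1"
  have bound: "N \<le> k" if k: "mpow G k = mat 1" "k > 0" for k
  proof -
    have "mpow G n = mpow G (n mod k)" for n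
      using mpow_add[of G "k * (n div k)" "n mod k"] k(1) by (simp add: mpow_mult)
    moreover have "complex_mats - {0} \<subseteq> range (mpow G)" using G(3) by blast
    ultimately have "card (complex_mats - {0::'a^2^2}) \<le> k"
      using card_le_period[of "complex_mats - {0}" "mpow G" k] k(2) by blast
    moreover have "0 \<in> (complex_mats :: ('a^2^2) set)" by (rule complex_mats_0_1)
    ultimately show ?thesis by (simp add: N_def card_Diff_singleton card_complex_mats)
  qed
  obtain t where t: "(CARD('a) + 1) div 2 = e * t" using e(1) by blast
  have card: "CARD('a) + 1 = 2 * (e * t)" using q t by presburger
  have tpos: "t > 0" using card by (cases "t = 0") auto
  define D where "D = (CARD('a) - 1) * t"
  have "CARD('a) \<noteq> 1" using q by auto
  moreover have "CARD('a) > 0" by simp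
  ultimately have c1: "CARD('a) > 1" by linarith
  have Dpos: "D > 0" using tpos c1 by (simp add: D_def)
  have ND: "N = 2 * e * D"
  proof -
    have "N = (CARD('a) - 1) * (CARD('a) + 1)"
      using c1 by (simp add: N_def power2_eq_square algebra_simps diff_mult_distrib2)
    then show ?thesis unfolding card D_def by (simp add: algebra_simps)
  qed
  define W where "W = mpow G D"
  have Wpow: "mpow W k = mpow G (D * k)" for k by (simp add: W_def mpow_mult)
  have small: "mpow W k \<noteq> mat 1" if "0 < k" "k < 2 * e" for k
  proof
    assume "mpow W k = mat 1"
    then have "N \<le> D * k" using bound[of "D * k"] Dpos that by (simp add: Wpow)
    then show False using ND Dpos that by simp
  qed
  have powC: "mpow G n \<in> complex_mats" for n
    by (induction n) (simp_all add: complex_mats_0_1 complex_mats_closed G(1))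
  have two: "(2::'a) \<noteq> 0"
  proof -
    have "odd CARD('a)" using q by presburger
    then show ?thesis by (simp add: two_eq_0_iff_even)
  qed
  have dG: "det G \<noteq> 0"
  proof
    assume "det G = 0"
    then have "det (mpow G N) = 0" using ND Dpos e by (simp add: det_mpow)
    then show False using G(4) by (simp add: N_def)
  qed
  have dW: "det W = 1"
    using finite_field_power[OF dG] by (simp add: W_def D_def det_mpow power_mult)
  have "D * (e + e) = CARD('a) ^ 2 - 1" using ND by (simp add: N_def algebra_simps)
  then have "mpow W (e + e) = mat 1" using G(4) by (simp only: Wpow)
  moreover obtain a b where P: "mpow W e = mat2 a (- b) b a" using powC complex_matsE by (metis Wpow)
  ultimately have "mat2 a (- b) b a ** mat2 a (- b) b a = mat 1"
    by (simp only: mpow_add)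
  then have ab: "a * a - b * b = 1" "2 * (a * b) = 0" by (simp_all add: mat_eq_mat2 mult.commute)
  have "b = 0"
  proof (rule ccontr)
    assume "b \<noteq> 0"
    then have "a = 0" using ab(2) two by simp
    then have "b ^ 2 = - 1" using ab(1) by (simp add: power2_eq_square minus_equation_iff[of "b * b"])
    then show False using ns by blast
  qed
  then have "a * a = 1" using ab(1) by simp
  then have "a = 1 \<or> a = - 1" by (simp add: square_eq_1_iff)
  then have "mpow W e \<approx> mat 1" using P \<open>b = 0\<close> by (auto simp: sgn_eq_def mat_eq_mat2)
  moreover obtain k where "m = e * k" using e(3) by blast
  ultimately have "mpow W m \<approx> mat 1" using sgn_eq_mpow[of "mpow W e" "mat 1" k] by (simp add: mpow_mult)
  moreover have "\<not> W \<approx> mat 1"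
  proof
    assume "W \<approx> mat 1"
    then have "mpow W 2 = mat 1" by (auto simp: sgn_eq_def numeral_2_eq_2)
    then show False using small[of 2] e by simp
  qed
  moreover have "trace W \<noteq> 0"
  proof
    assume "trace W = 0"
    then have "mpow W 2 = - mat 1" by (rule order_2I[OF dW])
    then have "mpow W (2 * 2) = mat 1" unfolding mpow_mult by (simp add: numeral_2_eq_2)
    then show False using small[of 4] e by simp
  qed
  ultimately show ?thesis using dW by blast
qed

lemma order_generated_2_by_element:
  fixes W :: "'a::{field,finite}^2^2"
  assumes "large_field TYPE('a) \<or> prime CARD('a)" and ns: "\<And>x::'a. x ^ 2 \<noteq> - 1"
    and W: "det W = 1" "\<not> W \<approx> mat 1" "mpow W m \<approx> mat 1" "trace W \<noteq> 0"
  shows "order_generated TYPE('a) 2 m"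
proof (cases "large_field TYPE('a)")
  case True
  obtain x :: 'a where x: "mult_generator x" using finite_field_generator by blast
  have "trace W ^ 2 \<noteq> - ((x - 1 / x) ^ 2)"
  proof
    assume e: "trace W ^ 2 = - ((x - 1 / x) ^ 2)"
    have key: "u / v = - 1" if "v = - u" "v \<noteq> 0" for u v :: 'a using that by simp
    have "((x - 1 / x) / trace W) ^ 2 = - 1"
      unfolding power_divide by (rule key[OF e]) (use W(4) in simp)
    then show False using ns by blast
  qed
  then show ?thesis by (rule order_generated_2_large[OF x True W])
qed (use assms order_generated_2_prime in blast)

section \<open>Projective groups as images of free products\<close>

lemma C2_C3_PSL2:
  assumes "primepow CARD('a::{field,finite})" "CARD('a) \<ge> 4" "CARD('a) \<noteq> 9"
  shows "image_with_non_lifting_pair (free_product (C 2) (C 3)) (PSL2 TYPE('a))"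
proof (cases "large_field TYPE('a)")
  case False
  then have "CARD('a) \<in> {4, 5, 7, 11, 13}" using small_fields[OF assms(1,2) False] assms(3) by auto
  then consider "CARD('a) = 4" | "CARD('a) = 5" | "CARD('a) = 7" | "CARD('a) = 11" | "CARD('a) = 13" by auto
  then show ?thesis
  proof cases
    case 1 then show ?thesis by (rule field_4_2_3)
  next
    case 2
    have "\<forall>j\<in>{..<5::nat}. j * j mod 5 \<noteq> (3 + 2 * 2) mod 5" by (simp add: lessThan_nat_numeral lessThan_Suc)
    then show ?thesis using prime_field_2_3[where 'a='a and k=2] 2 by simp
  next
    case 3
    have "\<forall>j\<in>{..<7::nat}. j * j mod 7 \<noteq> (3 + 3 * 3) mod 7" by (simp add: lessThan_nat_numeral lessThan_Suc)
    then show ?thesis using prime_field_2_3[where 'a='a and k=3] 3 by simp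
  next
    case 4
    have "\<forall>j\<in>{..<11::nat}. j * j mod 11 \<noteq> (3 + 2 * 2) mod 11" by (simp add: lessThan_nat_numeral lessThan_Suc)
    then show ?thesis using prime_field_2_3[where 'a='a and k=2] 4 by simp
  next
    case 5
    have "\<forall>j\<in>{..<13::nat}. j * j mod 13 \<noteq> (3 + 4 * 4) mod 13" by (simp add: lessThan_nat_numeral lessThan_Suc)
    then show ?thesis using prime_field_2_3[where 'a='a and k=4] 5 by simp
  qed
qed (rule large_2_3)

lemma C3_C3_PSL2:
  assumes "primepow CARD('a::{field,finite})" "CARD('a) \<ge> 5"
  shows "image_with_non_lifting_pair (free_product (C 3) (C 3)) (PSL2 TYPE('a))"
proof (cases "large_field TYPE('a)")
  case False
  have "CARD('a) \<in> {4, 5, 7, 9, 11, 13}" using small_fields[OF assms(1) _ False] assms(2) by simp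
  then consider "CARD('a) = 9" | "CARD('a) = 5" | "CARD('a) = 7" | "CARD('a) = 11" | "CARD('a) = 13"
    using assms(2) by auto
  then show ?thesis
  proof cases
    case 1 then show ?thesis by (rule field_9_3_3)
  next
    case 2
    have "\<forall>j\<in>{..<5::nat}. j * j mod 5 \<noteq> (9 + 4 * (1 * 1)) mod 5" by (simp add: lessThan_nat_numeral lessThan_Suc)
    then show ?thesis using prime_field_3_3[where 'a='a and k=1] 2 by simp
  next
    case 3
    have "\<forall>j\<in>{..<7::nat}. j * j mod 7 \<noteq> (9 + 4 * (1 * 1)) mod 7" by (simp add: lessThan_nat_numeral lessThan_Suc)
    then show ?thesis using prime_field_3_3[where 'a='a and k=1] 3 by simp
  next
    case 4
    have "\<forall>j\<in>{..<11::nat}. j * j mod 11 \<noteq> (9 + 4 * (1 * 1)) mod 11" by (simp add: lessThan_nat_numeral lessThan_Suc)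
    then show ?thesis using prime_field_3_3[where 'a='a and k=1] 4 by simp
  next
    case 5
    have "\<forall>j\<in>{..<13::nat}. j * j mod 13 \<noteq> (9 + 4 * (3 * 3)) mod 13" by (simp add: lessThan_nat_numeral lessThan_Suc)
    then show ?thesis using prime_field_3_3[where 'a='a and k=3] 5 by simp
  qed
qed (rule large_3_3)

lemma C2_Cp_PSL2:
  assumes p: "prime p" "p \<ge> 3" and q: "CARD('a::{field,finite}) = p ^ k" "CARD('a) \<ge> 7" "CARD('a) \<noteq> 9"
  shows "image_with_non_lifting_pair (free_product (C 2) (C p)) (PSL2 TYPE('a))"
proof -
  have ch: "CHAR('a) = p" by (rule CHAR_eq_prime[OF q(1) p(1)])
  have "odd p" using p primes_dvd_imp_eq[of 2 p] by auto
  then have "odd CARD('a)" using q(1) by simp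
  then have two: "(2::'a) \<noteq> 0" by (simp add: two_eq_0_iff_even)
  have "k > 0" using q by (cases k) auto
  then have pp: "primepow CARD('a)" using p q(1) by (auto simp: primepow_def)
  show ?thesis
  proof (cases "large_field TYPE('a)")
    case True then show ?thesis by (rule large_2_p[OF _ p(1) ch \<open>odd p\<close> two])
  next
    case False
    have "CARD('a) \<in> {4, 5, 7, 9, 11, 13}" using small_fields[OF pp _ False] q by simp
    then have c: "CARD('a) = 7 \<or> CARD('a) = 11 \<or> CARD('a) = 13" using q by auto
    then have pr: "prime CARD('a)" by auto
    then have pq: "p = CARD('a)" using CHAR_prime_card[OF pr] ch by simp
    show ?thesis
    proof (cases "CARD('a) = 13")
      case True then show ?thesis using field_13_2_p[OF True] pq by simp
    next
      case False
      then have "CARD('a) mod 4 = 3" using c by auto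
      then have ns: "\<And>x::'a. x ^ 2 \<noteq> - 1" by (rule no_square_minus_one)
      have "- 2 - 2 \<noteq> (y::'a) ^ 2" for y
      proof
        assume "- 2 - 2 = y ^ 2"
        then have y: "y ^ 2 = - 4" by simp
        have four: "(4::'a) \<noteq> 0" using two by (rule four_neq_0)
        have "(y / 2) ^ 2 = - 4 / 4" unfolding power_divide y by simp
        also have "\<dots> = - 1" using four by simp
        finally show False using ns by blast
      qed
      moreover have "CARD('a) > 3" using q by simp
      note M = Markoff_pair[OF pr this]
      have "order_generated TYPE('a) 2 p" using order_generated_2_p[where 'a='a and m=p] pr two ch by simp
      ultimately show ?thesis
        using non_lifting_2_p[OF _ M(1-4) _ p(1) ch \<open>odd p\<close>] q by simp
    qed
  qed
qed

text \<open>The commutator trace of the chosen pair is \<open>- 2\<close>, which cannot be attained because \<open>- 1\<close> is not a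
  square. The three divisibility conditions supply a matrix of trace different from zero whose order in the projective group
  divides \<open>m\<close>: a transvection, an element of a non-split torus, or an element of the split torus.\<close>

lemma C2_Cm_PSL2:
  assumes m: "m \<ge> 1" and p: "prime p" "CARD('a::{field,finite}) = p ^ k" and q: "CARD('a) mod 4 = 3" "CARD('a) \<noteq> 3"
    and d: "p dvd m \<or> gcd m ((CARD('a) + 1) div 2) \<ge> 3 \<or> gcd m ((CARD('a) - 1) div 2) \<ge> 3"
  shows "image_with_non_lifting_pair (free_product (C 2) (C m)) (PSL2 TYPE('a))"
proof -
  have ch: "CHAR('a) = p" by (rule CHAR_eq_prime[OF p(2,1)])
  have "odd CARD('a)" using q by presburger
  then have two: "(2::'a) \<noteq> 0" by (simp add: two_eq_0_iff_even)
  have "k > 0" using q p(2) by (cases k) auto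
  then have pp: "primepow CARD('a)" using p by (auto simp: primepow_def)
  have ge: "CARD('a) \<ge> 7" using q by presburger
  have c: "CARD('a) = 7 \<or> CARD('a) = 11" if "\<not> large_field TYPE('a)"
    using small_fields[OF pp _ that] ge q by auto
  have lp: "large_field TYPE('a) \<or> prime CARD('a)"
  proof (cases "large_field TYPE('a)")
    case False
    then have "CARD('a) = 7 \<or> CARD('a) = 11" by (rule c)
    then show ?thesis by auto
  qed simp
  note ns = no_square_minus_one[OF q(1)]
  have "\<exists>W::'a^2^2. det W = 1 \<and> \<not> W \<approx> mat 1 \<and> mpow W m \<approx> mat 1 \<and> trace W \<noteq> 0"
    using d
  proof (elim disjE)
    assume "p dvd m"
    then show ?thesis using order_p_matrix[where 'a='a and m=m] two ch by metis
  next
    assume "gcd m ((CARD('a) + 1) div 2) \<ge> 3"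
    then show ?thesis using nonsplit_element[OF q(1) gcd_dvd2 _ gcd_dvd1] by blast
  next
    assume "gcd m ((CARD('a) - 1) div 2) \<ge> 3"
    then show ?thesis using split_element[OF q(1) gcd_dvd2 _ gcd_dvd1] by blast
  qed
  then have og: "order_generated TYPE('a) 2 m" using order_generated_2_by_element[OF lp ns] by blast
  have m0: "m > 0" using m by simp
  show ?thesis
  proof (cases "large_field TYPE('a)")
    case True then show ?thesis by (rule large_2_m[OF _ ns og m0 two])
  next
    case False
    then have pr: "prime CARD('a)" using lp by simp
    moreover have "CARD('a) > 3" using ge by simp
    ultimately have M: "prime CARD('a)" "CARD('a) > 3" by simp_all
    show ?thesis
      using non_lifting_2_m[OF _ Markoff_pair(1-4)[OF M] og m0 ns _ Markoff_pair(5)[OF M]] ge by simp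
  qed
qed

theorem theorem1p1:
  fixes q :: nat
  assumes "CARD('f::{field,finite}) = q"
  shows
   "(primepow q \<and> q \<ge> 4 \<and> q \<noteq> 9 \<longrightarrow>
      image_with_non_lifting_pair (free_product (C 2) (C 3)) (PSL2 TYPE('f))) \<and>
    (\<forall>p k. prime p \<and> p \<ge> 3 \<and> q = p ^ k \<and> q \<ge> 7 \<and> q \<noteq> 9 \<longrightarrow>
      image_with_non_lifting_pair (free_product (C 2) (C p)) (PSL2 TYPE('f))) \<and>
    (\<forall>m p k. m \<ge> 1 \<and> prime p \<and> q = p ^ k \<and> q mod 4 = 3 \<and> q \<noteq> 3 \<and>
        (p dvd m \<or> gcd m ((q + 1) div 2) \<ge> 3 \<or> gcd m ((q - 1) div 2) \<ge> 3) \<longrightarrow>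
      image_with_non_lifting_pair (free_product (C 2) (C m)) (PSL2 TYPE('f))) \<and>
    (primepow q \<and> q \<ge> 5 \<longrightarrow>
      image_with_non_lifting_pair (free_product (C 3) (C 3)) (PSL2 TYPE('f)))"
  unfolding assms[symmetric]
  by (intro conjI allI impI; elim conjE;
      (rule C2_C3_PSL2; assumption | rule C3_C3_PSL2; assumption | rule C2_Cp_PSL2; assumption | rule C2_Cm_PSL2; assumption))

end
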